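(* Let $1\le p,q<\infty$ and $\delta>0$, and let $T\colon H^p(H^q)\to H^p(H^q)$ be a bounded linear operator satisfying $$|\langle T h_{I\times J},h_{I\times J}\rangle|\ \ge\ \delta\,|I\times J|\qquad\text{for all } I\times J\in\mathscr R .$$ Then the identity operator on $H^p(H^q)$ factors through $T$, that is, there are bounded linear operators $R,S\colon H^p(H^q)\to H^p(H^q)$ such that $I_{H^p(H^q)}=STR$. Moreover, for any $\eta\in(0,1]$ the operators $R$ and $S$ can be chosen such that $\|R\|\,\|S\|\le(1+\eta)/\delta$.
   Context: Let $\mathscr D=\{[k2^{-n},(k+1)2^{-n}) : n,k\in\mathbb N_0,\ 0\le k\le 2^n-1\}$ be the dyadic intervals in $[0,1)$ and $\mathscr R=\{I\times J: I,J\in\mathscr D\}$ the dyadic rectangles; $|\cdot|$ denotes Lebesgue measure (length, respectively area). For $I=[a,b)\in\mathscr D$ with $c=(a+b)/2$, the $L^\infty$-normalized Haar function is $h_I=1$ on $[a,c)$, $h_I=-1$ on $[c,b)$, and $h_I=0$ elsewhere; and $h_{I\times J}(x,y)=h_I(x)h_J(y)$ for $x,y\in[0,1)$. For $1\le p,q<\infty$, the mixed-norm Hardy space $H^p(H^q)$ is the completion of $\operatorname{span}\{h_{I\times J}: I\times J\in\mathscr R\}$ under the norm $$\|f\|_{H^p(H^q)}=\bigg(\int_0^1\Big(\int_0^1\big(\sum_{I\times J}|a_{I\times J}|^2h_{I\times J}^2(x,y)\big)^{q/2}\,dy\Big)^{p/q}dx\bigg)^{1/p},\qquad f=\sum_{I\times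 J}a_{I\times J}h_{I\times J}.$$ The system $(h_{I\times J})_{I\times J\in\mathscr R}$ is a $1$-unconditional basis of $H^p(H^q)$ (so no ordering of $\mathscr R$ needs to be specified). The pairing is the bilinear pairing $\langle f,g\rangle=\int_0^1\int_0^1 f(x,y)g(x,y)\,dy\,dx$; in particular $\langle f,h_{I\times J}\rangle=a_{I\times J}|I\times J|$ for $f=\sum a_{I\times J}h_{I\times J}\in H^p(H^q)$. *)

theory Defs
  imports "HOL-Analysis.Analysis"
begin

section \<open>Dyadic rectangles and the bi-parameter Haar system\<close>

definition dyadic_intervals :: "real set set" where
  "dyadic_intervals = {{real k / 2 ^ n ..< (real k + 1) / 2 ^ n} | n k. k \<le> 2 ^ n - (1::nat)}"

text \<open>The rectangle \<open>I \<times> J\<close> is represented by the pair \<open>(I, J)\<close> of its sides.\<close>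

type_synonym rect = "real set \<times> real set"

definition dyadic_rects :: "rect set" where
  "dyadic_rects = dyadic_intervals \<times> dyadic_intervals"

definition area :: "rect \<Rightarrow> real" where
  "area = (\<lambda>(I, J). measure lborel I * measure lborel J)"

text \<open>For \<open>I = {a..<b}\<close> with \<open>a < b\<close> we have \<open>a = Inf I\<close> and \<open>b = Sup I\<close>.\<close>

definition haar :: "real set \<Rightarrow> real \<Rightarrow> real" where
  "haar I x =
    (let a = Inf I; b = Sup I; c = (a + b) / 2
     in if x \<in> {a..<c} then 1 else if x \<in> {c..<b} then - 1 else 0)"

definition haar2 :: "rect \<Rightarrow> real \<Rightarrow> real \<Rightarrow> real" where
  "haar2 = (\<lambda>(I, J) x y. haar I x * haar J y)"


section \<open>The mixed-norm Hardy space\<close>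

text \<open>
  A (formal) Haar series \<open>\<Sum>R. a R * h R\<close> is represented by its coefficient family \<open>a\<close>, which
  vanishes off the dyadic rectangles.
\<close>

type_synonym haar_series = "rect \<Rightarrow> real"

definition haar_span :: "haar_series set" where
  "haar_span = {a. finite {R. a R \<noteq> 0} \<and> {R. a R \<noteq> 0} \<subseteq> dyadic_rects}"

definition haar_unit :: "rect \<Rightarrow> haar_series" where
  "haar_unit R = (\<lambda>Q. if Q = R then 1 else 0)"

text \<open>Real powers on \<open>[0, \<infinity>]\<close>, used with a positive exponent \<open>r\<close> only.\<close>

definition epow :: "ennreal \<Rightarrow> real \<Rightarrow> ennreal" where
  "epow t r = (if t = \<infinity> then \<infinity> else ennreal (enn2real t powr r))"

definition square_sum :: "haar_series \<Rightarrow> real \<Rightarrow> real \<Rightarrow> ennreal" where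
  "square_sum a x y = (\<Sum>\<^sub>\<infinity>R\<in>dyadic_rects. ennreal (\<bar>a R\<bar>\<^sup>2 * (haar2 R x y)\<^sup>2))"

definition mixed_enorm :: "real \<Rightarrow> real \<Rightarrow> haar_series \<Rightarrow> ennreal" where
  "mixed_enorm p q a =
    epow (\<integral>\<^sup>+x\<in>{0..<1}.
            epow (\<integral>\<^sup>+y\<in>{0..<1}. epow (square_sum a x y) (q / 2) \<partial>lborel) (p / q)
          \<partial>lborel) (1 / p)"

text \<open>
  The completion of the span of the Haar system: by Fatou's lemma the families of finite extended
  norm form a complete normed space, and a limit is determined by its coefficients because
  \<open>\<bar>a R\<bar>\<close> is bounded by a constant (depending on \<open>R\<close>) times the norm of \<open>a\<close>.  Hence the closure
  of the finitely supported families in that space is the completion.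
\<close>

definition hardy :: "real \<Rightarrow> real \<Rightarrow> haar_series set" where
  "hardy p q =
    {a. mixed_enorm p q a < \<infinity> \<and> (\<forall>R. R \<notin> dyadic_rects \<longrightarrow> a R = 0) \<and>
        (\<forall>\<epsilon>>0. \<exists>b\<in>haar_span. mixed_enorm p q (\<lambda>R. a R - b R) < ennreal \<epsilon>)}"

definition hardy_norm :: "real \<Rightarrow> real \<Rightarrow> haar_series \<Rightarrow> real" where
  "hardy_norm p q a = enn2real (mixed_enorm p q a)"

text \<open>
  The bilinear pairing, i.e. the integral of \<open>f * g\<close> over the unit square, where the functions with
  Haar series \<open>a\<close> and \<open>b\<close> are approximated by partial sums along the net of finite sets of
  rectangles.
\<close>

definition partial_haar :: "rect set \<Rightarrow> haar_series \<Rightarrow> real \<Rightarrow> real \<Rightarrow> real" where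
  "partial_haar F a x y = (\<Sum>R\<in>F. a R * haar2 R x y)"

definition pairing :: "haar_series \<Rightarrow> haar_series \<Rightarrow> real" where
  "pairing a b =
    Lim (finite_subsets_at_top dyadic_rects)
      (\<lambda>F. LINT x:{0..<1}|lborel. (LINT y:{0..<1}|lborel. partial_haar F a x y * partial_haar F b x y))"


section \<open>Bounded linear operators on the mixed-norm Hardy space\<close>

definition bounded_op :: "real \<Rightarrow> real \<Rightarrow> (haar_series \<Rightarrow> haar_series) \<Rightarrow> bool" where
  "bounded_op p q T \<longleftrightarrow>
    (\<forall>f\<in>hardy p q. T f \<in> hardy p q) \<and>
    (\<forall>f\<in>hardy p q. \<forall>g\<in>hardy p q. T (\<lambda>R. f R + g R) = (\<lambda>R. T f R + T g R)) \<and>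
    (\<forall>f\<in>hardy p q. \<forall>c. T (\<lambda>R. c * f R) = (\<lambda>R. c * T f R)) \<and>
    (\<exists>C. \<forall>f\<in>hardy p q. hardy_norm p q (T f) \<le> C * hardy_norm p q f)"

definition op_norm :: "real \<Rightarrow> real \<Rightarrow> (haar_series \<Rightarrow> haar_series) \<Rightarrow> real" where
  "op_norm p q T = (SUP f\<in>hardy p q. hardy_norm p q (T f) / hardy_norm p q f)"

end

theory Submission
  imports Defs
begin

text \<open>
  The norm of a Haar series only involves the squares \<open>a\<^sub>R\<^sup>2 h\<^sub>R\<^sup>2\<close>, hence only the absolute values of the
  coefficients and the supports of the rectangles.  Replace every \<open>h\<close> at \<open>R = I \<times> J\<close> by a signed sum
  of the \<open>h\<close> at \<open>Q \<in> B R\<close>, where \<open>B R\<close> consists of rectangles of one single shape: a point \<open>x\<close>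
  is covered in the first variable iff its binary digits at the positions \<open>\<nu> 0 < \<nu> 1 < \<dots>\<close> are those
  describing \<open>I\<close>, and likewise for \<open>y\<close> and \<open>J\<close>.  Reading the digits at the positions \<open>\<nu> i\<close> preserves
  the measure, so the substitution is an isometry; averaging the coefficients over \<open>B R\<close> is dominated
  by averaging over all the digits at the other positions, so it is a contraction.

  One side length of the rectangles in \<open>B R\<close> is still free and may be taken arbitrarily small.  A sum
  of \<open>n\<close> blocks of different frequencies has norm at most \<open>sqrt n\<close>, so for some small side length the
  interaction under \<open>T\<close> of the new block with all earlier ones is negligible for every choice of signs,
  and suitable signs keep the diagonal entry at least \<open>\<delta>\<close>.  Compressed to the blocks, \<open>T\<close> is
  thus a diagonal operator bounded below by \<open>\<delta>\<close> plus a small perturbation, which a Neumann series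
  inverts.
\<close>

section \<open>Normalized averages and \<open>L\<^sup>p\<close> norms on finite sets\<close>

text \<open>The diagonal is bounded only in absolute value, and \<open>p = 1\<close> or
  \<open>q = 1\<close> is allowed, so neither a common sign nor reflexivity is available. The signs
  of the diagonal entries are therefore moved into the averaging operator, and the two directions of
  interaction need different arguments: images of earlier blocks are small on a new one because
  finitely supported series are dense, while the image of a new block is small on earlier ones by
  the \<open>sqrt n\<close> bound. The combinatorial obstacle is that one digit sequence has to
  serve both variables and all rectangles. A side of level \<open>k\<close> must resolve exactly the
  digits \<open>\<nu> 0, ..., \<nu> (k - 1)\<close>, so a fresh, very small side is possible only on
  the side of larger level; the other one stays as long as it can. Hence the rectangles are treated
  in the order of their larger level, and \<open>\<nu> i\<close> is settled once those up to level
  \<open>i\<close> are done. Distinct frequencies give distinct shapes, so at each point every block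
  contributes at most one term to the square function.\<close>

definition lp :: "real \<Rightarrow> 'a set \<Rightarrow> ('a \<Rightarrow> real) \<Rightarrow> real" where
  "lp r A g = ((\<Sum>x\<in>A. g x powr r) / card A) powr (1 / r)"

definition avg :: "'a set \<Rightarrow> ('a \<Rightarrow> real) \<Rightarrow> real" where
  "avg A g = (\<Sum>x\<in>A. g x) / card A"

lemma lp_nonneg [simp]: "0 \<le> lp r A g"
  by (simp add: lp_def)

lemma lp_avg_eq: "lp r A g = avg A (\<lambda>x. g x powr r) powr (1 / r)"
  by (simp add: lp_def avg_def)

lemma avg_nonneg: "(\<And>x. x \<in> A \<Longrightarrow> 0 \<le> g x) \<Longrightarrow> 0 \<le> avg A g"
  by (simp add: avg_def sum_nonneg)

lemma avg_mono: "(\<And>x. x \<in> A \<Longrightarrow> f x \<le> g x) \<Longrightarrow> avg A f \<le> avg A g"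
  by (simp add: avg_def sum_mono divide_right_mono)

lemma avg_const: "finite A \<Longrightarrow> A \<noteq> {} \<Longrightarrow> avg A (\<lambda>x. c) = c"
  by (simp add: avg_def)

lemma avg_add: "avg A (\<lambda>x. f x + g x) = avg A f + avg A g"
  by (simp add: avg_def sum.distrib add_divide_distrib)

lemma avg_cmult: "avg A (\<lambda>x. c * f x) = c * avg A f"
  by (simp add: avg_def sum_distrib_left)

lemma avg_cong: "(\<And>x. x \<in> A \<Longrightarrow> f x = g x) \<Longrightarrow> avg A f = avg A g"
  by (simp add: avg_def)

lemma avg_Times: "avg (V \<times> U) (\<lambda>(x, y). g x y) = avg V (\<lambda>x. avg U (g x))"
  by (simp add: avg_def sum.cartesian_product[symmetric] card_cartesian_product sum_divide_distrib
      mult.commute)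

lemma avg_bij:
  assumes "bij_betw h A B" shows "avg B g = avg A (\<lambda>x. g (h x))"
  by (simp add: avg_def sum.reindex_bij_betw[OF assms] bij_betw_same_card[OF assms])

lemma lp_bij:
  assumes "bij_betw h A B" shows "lp r B g = lp r A (\<lambda>x. g (h x))"
  by (simp add: lp_avg_eq avg_bij[OF assms])

lemma lp_cong: "(\<And>x. x \<in> A \<Longrightarrow> f x = g x) \<Longrightarrow> lp r A f = lp r A g"
  by (simp add: lp_def)

lemma lp_mono:
  assumes "0 < r" "\<And>x. x \<in> A \<Longrightarrow> 0 \<le> f x" "\<And>x. x \<in> A \<Longrightarrow> f x \<le> g x"
  shows "lp r A f \<le> lp r A g"
  unfolding lp_avg_eq using assms
  by (intro powr_mono2 avg_mono avg_nonneg) auto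

lemma lp_const: "finite A \<Longrightarrow> A \<noteq> {} \<Longrightarrow> 0 < r \<Longrightarrow> 0 \<le> c \<Longrightarrow> lp r A (\<lambda>x. c) = c"
  by (simp add: lp_avg_eq avg_const powr_powr)

lemma lp_powr: "0 < r \<Longrightarrow> (lp r A g) powr r = avg A (\<lambda>x. g x powr r)"
  by (simp add: lp_avg_eq powr_powr avg_nonneg)

lemma lp_cmult:
  assumes "0 < r" "0 \<le> c" "\<And>x. x \<in> A \<Longrightarrow> 0 \<le> g x"
  shows "lp r A (\<lambda>x. c * g x) = c * lp r A g"
proof -
  have "avg A (\<lambda>x. (c * g x) powr r) = c powr r * avg A (\<lambda>x. g x powr r)"
    using assms by (subst avg_cmult[symmetric], intro avg_cong) (simp add: powr_mult)
  then show ?thesis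
    using assms by (simp add: lp_avg_eq powr_mult avg_nonneg powr_powr)
qed

text \<open>Functions may vanish on some cells, so the end point \<open>0\<close> is included; there
  the claim reduces to \<open>t powr r \<le> t\<close>.\<close>

lemma convex_on_powr:
  fixes r :: real
  assumes "1 \<le> r" shows "convex_on {0..} (\<lambda>x. x powr r)"
proof (rule convex_on_linorderI)
  fix t x y :: real
  assume t: "0 < t" "t < 1" and xy: "x \<in> {0..}" "y \<in> {0..}" "x < y"
  show "((1 - t) *\<^sub>R x + t *\<^sub>R y) powr r \<le> (1 - t) * x powr r + t * y powr r"
  proof (cases "x = 0")
    case True
    have "t powr r \<le> t powr 1" using t assms by (intro powr_mono') auto
    then have "t powr r * y powr r \<le> t * y powr r" using t by (intro mult_right_mono) auto
    then show ?thesis using True t xy by (simp add: powr_mult)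
  next
    case False
    then show ?thesis
      using convex_onD[OF powr_convex[OF assms], of t x y] t xy by simp
  qed
qed simp

lemma powr_convex_comb:
  fixes r x y t :: real
  assumes "1 \<le> r" "0 \<le> x" "0 \<le> y" "0 \<le> t" "t \<le> 1"
  shows "((1 - t) * x + t * y) powr r \<le> (1 - t) * x powr r + t * y powr r"
proof -
  have "convex_on {0..} (\<lambda>x::real. x powr r)"
    using assms(1) by (rule convex_on_powr)
  from convex_onD[OF this, of t x y] show ?thesis using assms by simp
qed

text \<open>Minkowski's inequality. After scaling both functions to norm \<open>1\<close>, their sum
  is \<open>s + t\<close> times a convex combination, and convexity of the power bounds the norm of
  the latter by \<open>1\<close>.\<close>

lemma lp_add_le:
  assumes r: "1 \<le> r" and A: "finite A" and f: "\<And>x. x \<in> A \<Longrightarrow> 0 \<le> f x" and g: "\<And>x. x \<in> A \<Longrightarrow> 0 \<le> g x"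
  shows "lp r A (\<lambda>x. f x + g x) \<le> lp r A f + lp r A g"
proof -
  define s t where "s = lp r A f" and "t = lp r A g"
  have st: "0 \<le> s" "0 \<le> t" by (auto simp: s_def t_def)
  have zero: "\<forall>x\<in>A. h x = 0" if "lp r A h = 0" "\<And>x. x \<in> A \<Longrightarrow> 0 \<le> h x" for h
  proof (cases "A = {}")
    case False
    then have "(\<Sum>x\<in>A. h x powr r) = 0" using that(1) A by (auto simp: lp_def)
    then show ?thesis using A by (simp add: sum_nonneg_eq_0_iff)
  qed auto
  show ?thesis
  proof (cases "s = 0 \<or> t = 0")
    case True
    then show ?thesis
    proof
      assume "s = 0"
      then have "\<forall>x\<in>A. f x = 0" using zero f by (auto simp: s_def)
      then show ?thesis by (simp add: lp_def)
    next
      assume "t = 0"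
      then have "\<forall>x\<in>A. g x = 0" using zero g by (auto simp: t_def)
      then show ?thesis by (simp add: lp_def)
    qed
  next
    case False
    with st have pos: "0 < s" "0 < t" by auto
    \<comment> \<open>The weight for which \<open>(f + g) / (s + t)\<close> equals
      \<open>(1 - u) * (f / s) + u * (g / t)\<close>.\<close>
    define u where "u = t / (s + t)"
    have u: "0 \<le> u" "u \<le> 1" "1 - u = s / (s + t)"
      using pos by (auto simp: u_def field_simps)
    have su: "avg A (\<lambda>x. (f x / s) powr r) = 1"
    proof -
      have "avg A (\<lambda>x. (f x / s) powr r) = (lp r A (\<lambda>x. (1/s) * f x)) powr r"
        using r by (simp add: lp_powr)
      also have "\<dots> = 1" using r f pos by (subst lp_cmult) (auto simp: s_def)
      finally show ?thesis .
    qed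
    have tu: "avg A (\<lambda>x. (g x / t) powr r) = 1"
    proof -
      have "avg A (\<lambda>x. (g x / t) powr r) = (lp r A (\<lambda>x. (1/t) * g x)) powr r"
        using r by (simp add: lp_powr)
      also have "\<dots> = 1" using r g pos by (subst lp_cmult) (auto simp: t_def)
      finally show ?thesis .
    qed
    have "avg A (\<lambda>x. ((1 - u) * (f x / s) + u * (g x / t)) powr r)
        \<le> avg A (\<lambda>x. (1 - u) * (f x / s) powr r + u * (g x / t) powr r)"
      using r f g pos u by (intro avg_mono powr_convex_comb) auto
    also have "\<dots> = 1" by (simp add: avg_add avg_cmult su tu)
    finally have *: "avg A (\<lambda>x. ((1 - u) * (f x / s) + u * (g x / t)) powr r) \<le> 1" .
    have "lp r A (\<lambda>x. f x + g x) = lp r A (\<lambda>x. (s + t) * ((1 - u) * (f x / s) + u * (g x / t)))"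
      unfolding u(3) using pos by (intro lp_cong) (simp add: u_def distrib_left)
    also have "\<dots> = (s + t) * lp r A (\<lambda>x. (1 - u) * (f x / s) + u * (g x / t))"
      using r f g pos u by (intro lp_cmult) auto
    also have "\<dots> \<le> (s + t) * 1"
    proof (rule mult_left_mono)
      show "lp r A (\<lambda>x. (1 - u) * (f x / s) + u * (g x / t)) \<le> 1"
        using powr_mono2[OF _ _ *, of "1/r"] r by (simp add: lp_avg_eq avg_nonneg)
    qed (use pos in auto)
    finally show ?thesis by (simp add: s_def t_def)
  qed
qed

lemma avg_powr_le:
  assumes "1 \<le> r" "finite U" "U \<noteq> {}" "\<And>x. x \<in> U \<Longrightarrow> 0 \<le> g x"
  shows "(avg U g) powr r \<le> avg U (\<lambda>x. g x powr r)"
proof -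
  have "convex_on {0..} (\<lambda>x::real. x powr r)"
    using assms(1) by (rule convex_on_powr)
  from convex_on_sum[OF assms(2,3) this, of "\<lambda>_. 1 / card U" g]
  have "(\<Sum>i\<in>U. (1 / card U) * g i) powr r \<le> (\<Sum>i\<in>U. (1 / card U) * g i powr r)"
    using assms by auto
  then show ?thesis by (simp add: avg_def sum_divide_distrib)
qed

text \<open>Jensen's inequality in the inner variable: averaging out an independent variable is
  contractive.\<close>

lemma lp_avg_le:
  assumes "1 \<le> r" "finite U" "U \<noteq> {}" "\<And>x y. x \<in> V \<Longrightarrow> y \<in> U \<Longrightarrow> 0 \<le> g x y"
  shows "lp r V (\<lambda>x. avg U (g x)) \<le> lp r (V \<times> U) (\<lambda>(x, y). g x y)"
proof -
  have "avg V (\<lambda>x. avg U (g x) powr r) \<le> avg V (\<lambda>x. avg U (\<lambda>y. g x y powr r))"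
    using assms by (intro avg_mono avg_powr_le) auto
  also have "\<dots> = avg (V \<times> U) (\<lambda>(x, y). g x y powr r)"
    by (simp add: avg_Times)
  also have "\<dots> = avg (V \<times> U) (\<lambda>z. (case z of (x, y) \<Rightarrow> g x y) powr r)"
    by (intro avg_cong) auto
  finally show ?thesis
    unfolding lp_avg_eq using assms(1) by (intro powr_mono2 avg_nonneg) auto
qed

lemma avg_le_lp:
  assumes "1 \<le> r" "finite U" "U \<noteq> {}" "\<And>x. x \<in> U \<Longrightarrow> 0 \<le> g x"
  shows "avg U g \<le> lp r U g"
proof -
  have "((avg U g) powr r) powr (1/r) \<le> lp r U g"
    unfolding lp_avg_eq using assms by (intro powr_mono2 avg_powr_le) auto
  then show ?thesis using assms by (simp add: powr_powr avg_nonneg)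
qed

text \<open>The integral form of the triangle inequality; it lets an average over free digits of the
  first variable leave the inner norm over the second.\<close>

lemma lp_avg_Minkowski:
  assumes r: "1 \<le> r" and A: "finite A" and U: "finite U" and g: "\<And>b x. b \<in> U \<Longrightarrow> x \<in> A \<Longrightarrow> 0 \<le> g b x"
  shows "lp r A (\<lambda>x. avg U (\<lambda>b. g b x)) \<le> avg U (\<lambda>b. lp r A (g b))"
proof -
  have "lp r A (\<lambda>x. \<Sum>b\<in>W. g b x) \<le> (\<Sum>b\<in>W. lp r A (g b))" if "W \<subseteq> U" for W
    using finite_subset[OF that U] that
  proof (induction W rule: finite_induct)
    case empty
    then show ?case using r by (simp add: lp_def)
  next
    case (insert b W)
    have "lp r A (\<lambda>x. g b x + (\<Sum>b\<in>W. g b x)) \<le> lp r A (g b) + lp r A (\<lambda>x. \<Sum>b\<in>W. g b x)"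
      using insert.prems r A g by (intro lp_add_le sum_nonneg) auto
    then show ?case using insert by simp
  qed
  from this[of U]
  have le: "lp r A (\<lambda>x. \<Sum>b\<in>U. g b x) \<le> (\<Sum>b\<in>U. lp r A (g b))" by simp
  have "lp r A (\<lambda>x. avg U (\<lambda>b. g b x)) = (1 / card U) * lp r A (\<lambda>x. \<Sum>b\<in>U. g b x)"
    using r g by (subst lp_cmult[symmetric]) (auto simp: avg_def intro!: sum_nonneg)
  also have "\<dots> \<le> (1 / card U) * (\<Sum>b\<in>U. lp r A (g b))"
    using le by (intro mult_left_mono) auto
  finally show ?thesis by (simp add: avg_def)
qed

lemma L2_set_avg_Minkowski:
  assumes U: "finite U"
  shows "L2_set (\<lambda>x. avg U (\<lambda>b. g b x)) A \<le> avg U (\<lambda>b. L2_set (g b) A)"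
proof -
  have "L2_set (\<lambda>x. \<Sum>b\<in>U. g b x) A \<le> (\<Sum>b\<in>U. L2_set (g b) A)"
    using U
  proof (induction U rule: finite_induct)
    case empty
    then show ?case by (simp add: L2_set_def)
  next
    case (insert b W)
    have "L2_set (\<lambda>x. g b x + (\<Sum>b\<in>W. g b x)) A \<le> L2_set (g b) A + L2_set (\<lambda>x. \<Sum>b\<in>W. g b x) A"
      by (rule L2_set_triangle_ineq)
    then show ?case using insert by simp
  qed
  then have le: "(1 / card U) * L2_set (\<lambda>x. \<Sum>b\<in>U. g b x) A \<le> (1 / card U) * (\<Sum>b\<in>U. L2_set (g b) A)"
    by (intro mult_left_mono) auto
  have "L2_set (\<lambda>x. avg U (\<lambda>b. g b x)) A = (1 / card U) * L2_set (\<lambda>x. \<Sum>b\<in>U. g b x) A"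
    by (subst L2_set_right_distrib) (auto simp: avg_def)
  with le show ?thesis by (simp add: avg_def)
qed

section \<open>Dyadic intervals as binary cylinders\<close>

text \<open>
  A dyadic interval of length \<open>2\<^sup>-\<^sup>n\<close> is encoded by the set \<open>s \<subseteq> {..<n}\<close> of the positions of the
  digits \<open>1\<close> in the binary expansion of its left end point; position \<open>0\<close> has weight \<open>1 / 2\<close>.
\<close>

definition left_end :: "nat set \<Rightarrow> real" where
  "left_end s = (\<Sum>d\<in>s. (1 / 2) ^ Suc d)"

definition ivl :: "nat \<Rightarrow> nat set \<Rightarrow> real set" where
  "ivl n s = {left_end s ..< left_end s + (1 / 2) ^ n}"

text \<open>Horner's scheme with digit \<open>0\<close> most significant: the number of a cell of
  level \<open>n\<close>, counted from the left. Digits at positions from \<open>n\<close> on are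
  ignored, so passing to a coarser cell needs no explicit truncation.\<close>

fun cell_index :: "nat \<Rightarrow> nat set \<Rightarrow> nat" where
  "cell_index 0 s = 0"
| "cell_index (Suc n) s = 2 * cell_index n s + (if n \<in> s then 1 else 0)"

lemma cell_index_inter: "n \<le> m \<Longrightarrow> cell_index n (s \<inter> {..<m}) = cell_index n s"
  by (induction n) auto

lemma cell_index_less: "cell_index n s < 2 ^ n"
  by (induction n) auto

lemma cell_index_inj: "cell_index n s = cell_index n t \<Longrightarrow> s \<inter> {..<n} = t \<inter> {..<n}"
proof (induction n)
  case (Suc n)
  have "cell_index n s = cell_index n t \<and> (n \<in> s \<longleftrightarrow> n \<in> t)"
    using Suc.prems by (auto split: if_splits; presburger)
  then show ?case using Suc.IH by (auto simp: lessThan_Suc)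
qed simp

lemma cell_index_surj: "k < 2 ^ n \<Longrightarrow> \<exists>s \<subseteq> {..<n}. cell_index n s = k"
proof (induction n arbitrary: k)
  case (Suc n)
  then have "k div 2 < 2 ^ n" by auto
  with Suc.IH obtain s where s: "s \<subseteq> {..<n}" "cell_index n s = k div 2" by blast
  have e: "cell_index n (insert n s) = cell_index n s"
    using cell_index_inter[of n n "insert n s"] cell_index_inter[of n n s] by (simp add: Int_insert_left)
  have ns: "n \<notin> s" using s by auto
  show ?case
  proof (cases "even k")
    case True
    then show ?thesis using s ns by (intro exI[of _ s]) auto
  next
    case False
    then show ?thesis using s e by (intro exI[of _ "insert n s"]) auto
  qed
qed simp

lemma left_end_index: "s \<subseteq> {..<n} \<Longrightarrow> left_end s = cell_index n s / 2 ^ n"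
proof (induction n arbitrary: s)
  case 0
  then show ?case by (simp add: left_end_def)
next
  case (Suc n)
  have fin: "finite s" using Suc.prems finite_subset by blast
  have "left_end (s \<inter> {..<n}) = cell_index n s / 2 ^ n"
    using Suc.IH[of "s \<inter> {..<n}"] by (simp add: cell_index_inter)
  moreover have "left_end s = left_end (s \<inter> {..<n}) + (if n \<in> s then (1 / 2) ^ Suc n else 0)"
  proof -
    have "s = (s \<inter> {..<n}) \<union> (s \<inter> {n})" using Suc.prems by (auto simp: lessThan_Suc)
    then have "left_end s = left_end ((s \<inter> {..<n}) \<union> (s \<inter> {n}))" by simp
    also have "\<dots> = left_end (s \<inter> {..<n}) + left_end (s \<inter> {n})"
      unfolding left_end_def using fin by (intro sum.union_disjoint) auto
    finally show ?thesis by (auto simp: left_end_def)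
  qed
  ultimately show ?case by (simp add: field_simps power_one_over)
qed

text \<open>Membership becomes an equation for one integer, from which existence and uniqueness of
  the cell containing a point follow.\<close>

lemma mem_ivl_iff:
  assumes "s \<subseteq> {..<n}"
  shows "x \<in> ivl n s \<longleftrightarrow> \<lfloor>2 ^ n * x\<rfloor> = int (cell_index n s)"
proof -
  have "x \<in> ivl n s \<longleftrightarrow> real (cell_index n s) \<le> 2 ^ n * x \<and> 2 ^ n * x < real (cell_index n s) + 1"
    by (auto simp: ivl_def left_end_index[OF assms] field_simps power_one_over)
  then show ?thesis by (simp add: floor_eq_iff)
qed

lemma ivl_cell_unique:
  assumes "s \<subseteq> {..<n}" "t \<subseteq> {..<n}" "x \<in> ivl n s" "x \<in> ivl n t"
  shows "s = t"
  using assms cell_index_inj[of n s t] by (auto simp: mem_ivl_iff)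

lemma ex_ivl_cell:
  assumes "0 \<le> x" "x < 1"
  obtains s where "s \<subseteq> {..<n}" "x \<in> ivl n s"
proof -
  have "0 \<le> \<lfloor>2 ^ n * x\<rfloor>" "\<lfloor>2 ^ n * x\<rfloor> < 2 ^ n"
    using assms by (auto simp: floor_less_iff)
  then have "nat \<lfloor>2 ^ n * x\<rfloor> < 2 ^ n" by (simp add: nat_less_iff)
  from cell_index_surj[OF this] obtain s where "s \<subseteq> {..<n}" "cell_index n s = nat \<lfloor>2 ^ n * x\<rfloor>" by blast
  with \<open>0 \<le> \<lfloor>2 ^ n * x\<rfloor>\<close> that show thesis by (simp add: mem_ivl_iff)
qed

lemma dyadic_intervals_eq: "dyadic_intervals = {ivl n s | n s. s \<subseteq> {..<n}}"
proof (intro set_eqI iffI)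
  fix I assume "I \<in> dyadic_intervals"
  then obtain k n where I: "I = {real k / 2 ^ n ..< (real k + 1) / 2 ^ n}" and "k \<le> 2 ^ n - (1::nat)"
    by (auto simp: dyadic_intervals_def)
  then have "k < 2 ^ n" by (metis Suc_diff_1 less_Suc_eq_le pos2 zero_less_power)
  from cell_index_surj[OF this] obtain s where s: "s \<subseteq> {..<n}" "cell_index n s = k" by blast
  then have "I = ivl n s" using I by (auto simp: ivl_def left_end_index add_divide_distrib power_one_over)
  with s show "I \<in> {ivl n s | n s. s \<subseteq> {..<n}}" by blast
next
  fix I assume "I \<in> {ivl n s | n s. s \<subseteq> {..<n}}"
  then obtain n s where s: "s \<subseteq> {..<n}" and I: "I = ivl n s" by blast
  have "I = {real (cell_index n s) / 2 ^ n ..< (real (cell_index n s) + 1) / 2 ^ n}"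
    by (simp add: I ivl_def left_end_index[OF s] add_divide_distrib power_one_over)
  moreover have "cell_index n s \<le> 2 ^ n - 1" using cell_index_less[of n s] by simp
  ultimately show "I \<in> dyadic_intervals" unfolding dyadic_intervals_def by blast
qed

lemma measure_ivl [simp]: "measure lborel (ivl n s) = (1 / 2) ^ n"
  by (simp add: ivl_def)

lemma emeasure_ivl: "emeasure lborel (ivl n s) = ennreal ((1 / 2) ^ n)"
  by (simp add: ivl_def)

lemma left_end_mem_ivl [simp]: "left_end s \<in> ivl n s"
  by (simp add: ivl_def)

text \<open>The length determines the level; then a common left end point lies in two cells of one
  level, which must agree.\<close>

lemma ivl_eq_iff:
  assumes "s \<subseteq> {..<n}" "t \<subseteq> {..<m}"
  shows "ivl n s = ivl m t \<longleftrightarrow> n = m \<and> s = t"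
proof
  assume eq: "ivl n s = ivl m t"
  then have "measure lborel (ivl n s) = measure lborel (ivl m t)" by simp
  then have "n = m" by (simp add: power_inject_exp')
  with eq assms show "n = m \<and> s = t" using ivl_cell_unique[of s n t "left_end s"] by (metis left_end_mem_ivl)
qed auto

text \<open>Digits from position \<open>n\<close> on add a nonnegative amount of at most
  \<open>(1 / 2) ^ n - (1 / 2) ^ M\<close>, a finite geometric sum.\<close>

lemma left_end_inter_le:
  assumes "w \<subseteq> {..<M}" "n \<le> M"
  shows "left_end (w \<inter> {..<n}) \<le> left_end w" "left_end w + (1 / 2) ^ M \<le> left_end (w \<inter> {..<n}) + (1 / 2) ^ n"
proof -
  have fin: "finite w" using assms finite_subset by blast
  have "left_end w = left_end ((w \<inter> {..<n}) \<union> (w \<inter> {n..<M}))"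
    using assms by (intro arg_cong[of _ _ left_end]) auto
  also have "\<dots> = left_end (w \<inter> {..<n}) + left_end (w \<inter> {n..<M})"
    unfolding left_end_def using fin by (intro sum.union_disjoint) auto
  finally have eq: "left_end w = left_end (w \<inter> {..<n}) + left_end (w \<inter> {n..<M})" .
  have "0 \<le> left_end (w \<inter> {n..<M})" by (simp add: left_end_def sum_nonneg)
  with eq show "left_end (w \<inter> {..<n}) \<le> left_end w" by simp
  have "left_end (w \<inter> {n..<M}) \<le> left_end {n..<M}"
    unfolding left_end_def by (intro sum_mono2) auto
  also have "left_end {n..<M} = (1 / 2) ^ n - (1 / 2) ^ M"
    using assms(2) by (induction M rule: dec_induct) (auto simp: left_end_def)
  finally show "left_end w + (1 / 2) ^ M \<le> left_end (w \<inter> {..<n}) + (1 / 2) ^ n" using eq by simp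
qed

lemma ivl_cell_nested:
  assumes "w \<subseteq> {..<M}" "n \<le> M" "x \<in> ivl M w"
  shows "x \<in> ivl n (w \<inter> {..<n})"
  using assms(3) left_end_inter_le[OF assms(1,2)] by (auto simp: ivl_def)

lemma ivl_cell_iff:
  assumes "w \<subseteq> {..<M}" "n \<le> M" "x \<in> ivl M w" "s \<subseteq> {..<n}"
  shows "x \<in> ivl n s \<longleftrightarrow> s = w \<inter> {..<n}"
  using ivl_cell_unique[OF assms(4), of "w \<inter> {..<n}" x] ivl_cell_nested[OF assms(1-3)] by auto

lemma ivl_subset_unit:
  assumes "s \<subseteq> {..<n}" shows "ivl n s \<subseteq> {0..<1}"
  using ivl_cell_nested[OF assms, of 0] by (force simp: ivl_def[of 0] left_end_def)

lemma haar_ivl: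
  "haar (ivl n s) x = (if x \<in> ivl n s then if x < left_end s + (1/2)^Suc n then 1 else -1 else 0)"
proof -
  have less: "left_end s < left_end s + (1/2)^n" by simp
  have "Inf (ivl n s) = left_end s" "Sup (ivl n s) = left_end s + (1/2)^n"
    unfolding ivl_def using less by (auto simp: cInf_atLeastLessThan cSup_atLeastLessThan simp del: less_add_same_cancel1)
  then show ?thesis by (auto simp: haar_def ivl_def)
qed

lemma haar_ivl_sq: "(haar (ivl n s) x)\<^sup>2 = indicator (ivl n s) x"
  by (simp add: haar_ivl)

definition drect :: "nat \<Rightarrow> nat set \<Rightarrow> nat \<Rightarrow> nat set \<Rightarrow> rect" where
  "drect k s l t = (ivl k s, ivl l t)"

lemma dyadic_rects_eq: "dyadic_rects = {drect k s l t | k s l t. s \<subseteq> {..<k} \<and> t \<subseteq> {..<l}}"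
  by (auto simp: dyadic_rects_def dyadic_intervals_eq drect_def)

lemma drect_mem [intro]: "s \<subseteq> {..<k} \<Longrightarrow> t \<subseteq> {..<l} \<Longrightarrow> drect k s l t \<in> dyadic_rects"
  by (auto simp: dyadic_rects_eq)

lemma drect_cases [cases set: dyadic_rects]:
  assumes "R \<in> dyadic_rects"
  obtains k s l t where "R = drect k s l t" "s \<subseteq> {..<k}" "t \<subseteq> {..<l}"
  using assms by (auto simp: dyadic_rects_eq)

lemma drect_eq_iff:
  assumes "s \<subseteq> {..<k}" "t \<subseteq> {..<l}" "s' \<subseteq> {..<k'}" "t' \<subseteq> {..<l'}"
  shows "drect k s l t = drect k' s' l' t' \<longleftrightarrow> k = k' \<and> s = s' \<and> l = l' \<and> t = t'"
  using assms by (auto simp: drect_def ivl_eq_iff)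

lemma area_drect: "area (drect k s l t) = (1 / 2) ^ (k + l)"
  by (simp add: area_def drect_def power_add)

lemma area_pos: "R \<in> dyadic_rects \<Longrightarrow> 0 < area R"
  by (erule drect_cases) (simp add: area_drect)

lemma haar2_drect_sq: "(haar2 (drect k s l t) x y)\<^sup>2 = indicator (ivl k s) x * indicator (ivl l t) y"
  by (simp add: haar2_def drect_def power_mult_distrib haar_ivl_sq)

definition rects_upto :: "nat \<Rightarrow> rect set" where
  "rects_upto n = {drect k s l t | k s l t. k \<le> n \<and> l \<le> n \<and> s \<subseteq> {..<k} \<and> t \<subseteq> {..<l}}"

lemma drect_mem_upto_iff:
  assumes "s \<subseteq> {..<k}" "t \<subseteq> {..<l}"
  shows "drect k s l t \<in> rects_upto n \<longleftrightarrow> k \<le> n \<and> l \<le> n"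
proof -
  have False if "drect k s l t = drect k' s' l' t'" "s' \<subseteq> {..<k'}" "t' \<subseteq> {..<l'}" "k' \<le> n" "l' \<le> n"
     "\<not> (k \<le> n \<and> l \<le> n)" for k' s' l' t'
    using drect_eq_iff[OF assms, of s' k' t' l'] that by auto
  then show ?thesis using assms by (auto simp: rects_upto_def)
qed

lemma finite_rects_upto [simp]: "finite (rects_upto n)"
proof (rule finite_subset)
  show "rects_upto n \<subseteq> (\<lambda>(k, s, l, t). drect k s l t) ` ({..n} \<times> Pow {..<n} \<times> {..n} \<times> Pow {..<n})"
    by (fastforce simp: rects_upto_def image_iff)
qed simp

lemma rects_upto_subset: "rects_upto n \<subseteq> dyadic_rects"
  by (auto simp: rects_upto_def dyadic_rects_eq)

lemma rects_upto_mono: "m \<le> n \<Longrightarrow> rects_upto m \<subseteq> rects_upto n"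
  by (force simp: rects_upto_def)

lemma ex_rects_upto:
  assumes "finite F" "F \<subseteq> dyadic_rects"
  shows "\<exists>n. F \<subseteq> rects_upto n"
  using assms
proof (induction F rule: finite_induct)
  case (insert R F)
  then obtain n where n: "F \<subseteq> rects_upto n" by auto
  from insert.prems obtain k s l t where R: "R = drect k s l t" "s \<subseteq> {..<k}" "t \<subseteq> {..<l}"
    by (auto simp: dyadic_rects_eq)
  have "R \<in> rects_upto (max n (max k l))" using R by (simp add: drect_mem_upto_iff le_max_iff_disj)
  moreover have "F \<subseteq> rects_upto (max n (max k l))" using n rects_upto_mono[of n "max n (max k l)"] by auto
  ultimately show ?case by blast
qed simp

section \<open>The mixed norm on finite grids\<close>

text \<open>Binary digits at disjoint sets of positions are independent: Fubini's theorem for the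
  uniform measure on digit sets.\<close>

lemma avg_Pow_Un:
  assumes "finite C" "finite D" "C \<inter> D = {}"
  shows "avg (Pow (C \<union> D)) f = avg (Pow C) (\<lambda>x. avg (Pow D) (\<lambda>y. f (x \<union> y)))"
proof -
  have "bij_betw (\<lambda>(x, y). x \<union> y) (Pow C \<times> Pow D) (Pow (C \<union> D))"
    using assms(3) by (intro bij_betw_byWitness[where f' = "\<lambda>z. (z \<inter> C, z \<inter> D)"]) auto
  from avg_bij[OF this, of f] show ?thesis
    by (simp add: avg_Times[symmetric] case_prod_unfold)
qed

lemma avg_Pow_inter:
  assumes "finite E" "C \<subseteq> E"
  shows "avg (Pow E) (\<lambda>x. f (x \<inter> C)) = avg (Pow C) f"
proof -
  have "avg (Pow (C \<union> (E - C))) (\<lambda>x. f (x \<inter> C)) = avg (Pow C) (\<lambda>x. avg (Pow (E - C)) (\<lambda>y. f ((x \<union> y) \<inter> C)))"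
    using assms finite_subset by (intro avg_Pow_Un) auto
  also have "\<dots> = avg (Pow C) (\<lambda>x. avg (Pow (E - C)) (\<lambda>y. f x))"
    by (intro avg_cong arg_cong[of _ _ f]) auto
  also have "\<dots> = avg (Pow C) f"
    using assms by (intro avg_cong avg_const) auto
  finally show ?thesis using assms by (simp add: Un_absorb1)
qed

section \<open>Powers on the extended half-line and integrals of grid functions\<close>

lemma epow_ennreal: "0 \<le> t \<Longrightarrow> epow (ennreal t) r = ennreal (t powr r)"
  by (simp add: epow_def)

lemma epow_mono: "0 \<le> r \<Longrightarrow> s \<le> t \<Longrightarrow> epow s r \<le> epow t r"
  by (cases s; cases t) (auto simp: epow_def top_unique intro!: ennreal_leI powr_mono2)

lemma epow_epow_inverse: "0 < r \<Longrightarrow> epow (epow t r) (1 / r) = t" "0 < r \<Longrightarrow> epow (epow t (1 / r)) r = t"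
  by (cases t; simp add: epow_def powr_powr)+

lemma epow_le_iff:
  assumes "0 < r" shows "epow s r \<le> t \<longleftrightarrow> s \<le> epow t (1 / r)"
  using epow_mono[of "1/r" "epow s r" t] epow_mono[of r s "epow t (1/r)"] epow_epow_inverse[OF assms] assms
  by auto

text \<open>By \<open>epow_le_iff\<close> the power has the inverse power as an upper adjoint, so it
  commutes with arbitrary suprema, infinite values included.\<close>

lemma epow_SUP:
  assumes "0 < r" shows "epow (SUP i\<in>A. f i) r = (SUP i\<in>A. epow (f i) r)"
proof (rule order_antisym)
  show "epow (SUP i\<in>A. f i) r \<le> (SUP i\<in>A. epow (f i) r)"
    unfolding epow_le_iff[OF assms]
  proof (rule SUP_least)
    fix i assume "i \<in> A"
    then have "epow (f i) r \<le> (SUP i\<in>A. epow (f i) r)" by (rule SUP_upper)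
    then show "f i \<le> epow (SUP i\<in>A. epow (f i) r) (1 / r)" by (simp only: epow_le_iff[OF assms])
  qed
  show "(SUP i\<in>A. epow (f i) r) \<le> epow (SUP i\<in>A. f i) r"
    using assms by (intro SUP_least epow_mono SUP_upper) auto
qed

text \<open>Over a general semiring, so that it serves both the nonnegative and the real-valued
  integral.\<close>

lemma grid_sum_indicator:
  fixes v :: "nat set \<Rightarrow> 'b :: semiring_1"
  assumes "\<And>w x. w \<subseteq> {..<M} \<Longrightarrow> x \<in> ivl M w \<Longrightarrow> g x = v w"
  shows "g x * indicator {0..<1} x = (\<Sum>w\<in>Pow {..<M}. v w * indicator (ivl M w) x)"
proof (cases "x \<in> {0..<1}")
  case True
  then obtain w where w: "w \<subseteq> {..<M}" "x \<in> ivl M w" using ex_ivl_cell[of x M] by auto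
  have "(\<Sum>w'\<in>Pow {..<M}. v w' * indicator (ivl M w') x) = (\<Sum>w'\<in>Pow {..<M}. if w' = w then v w else 0)"
  proof (intro sum.cong refl)
    fix w' assume "w' \<in> Pow {..<M}"
    then have "x \<in> ivl M w' \<longleftrightarrow> w' = w" using w ivl_cell_unique by blast
    then show "v w' * indicator (ivl M w') x = (if w' = w then v w else 0)" by (auto simp: indicator_def)
  qed
  also have "\<dots> = v w" using w by simp
  finally show ?thesis using True assms[OF w] by simp
next
  case False
  then have "x \<notin> ivl M w" if "w \<in> Pow {..<M}" for w using ivl_subset_unit[of w M] that by blast
  with False show ?thesis by simp
qed

lemma nn_integral_grid:
  assumes "\<And>w x. w \<subseteq> {..<M} \<Longrightarrow> x \<in> ivl M w \<Longrightarrow> g x = ennreal (v w)" and "\<And>w. 0 \<le> v w"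
  shows "(\<integral>\<^sup>+x\<in>{0..<1}. g x \<partial>lborel) = ennreal (avg (Pow {..<M}) v)"
    and "(\<lambda>x. g x * indicator {0..<1} x) \<in> borel_measurable lborel"
proof -
  have m [measurable]: "ivl M w \<in> sets borel" for w by (simp add: ivl_def)
  have eq: "g x * indicator {0..<1} x = (\<Sum>w\<in>Pow {..<M}. ennreal (v w) * indicator (ivl M w) x)" for x
    using assms(1) by (rule grid_sum_indicator)
  show "(\<lambda>x. g x * indicator {0..<1} x) \<in> borel_measurable lborel"
    unfolding eq by measurable
  have "(\<integral>\<^sup>+x\<in>{0..<1}. g x \<partial>lborel) =
      (\<Sum>w\<in>Pow {..<M}. \<integral>\<^sup>+x. ennreal (v w) * indicator (ivl M w) x \<partial>lborel)"
    unfolding eq by (rule nn_integral_sum) measurable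
  also have "\<dots> = (\<Sum>w\<in>Pow {..<M}. ennreal (v w * (1/2)^M))"
  proof (rule sum.cong)
    fix w
    have "(\<integral>\<^sup>+x. ennreal (v w) * indicator (ivl M w) x \<partial>lborel) = ennreal (v w) * emeasure lborel (ivl M w)"
      by (rule nn_integral_cmult_indicator) simp
    then show "(\<integral>\<^sup>+x. ennreal (v w) * indicator (ivl M w) x \<partial>lborel) = ennreal (v w * (1/2)^M)"
      using assms(2)[of w] by (simp only: emeasure_ivl) (simp only: ennreal_mult zero_le_power zero_le_divide_1_iff zero_le_numeral)
  qed simp
  also have "\<dots> = ennreal (\<Sum>w\<in>Pow {..<M}. v w * (1/2)^M)"
    using assms(2) by (intro sum_ennreal) simp
  also have "(\<Sum>w\<in>Pow {..<M}. v w * (1/2)^M) = avg (Pow {..<M}) v"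
    unfolding avg_def sum_distrib_right[symmetric] by (simp add: card_Pow power_one_over)
  finally show "(\<integral>\<^sup>+x\<in>{0..<1}. g x \<partial>lborel) = ennreal (avg (Pow {..<M}) v)" .
qed

text \<open>The value, on the cell given by \<open>v\<close> and \<open>w\<close>, of the square
  function of the series truncated to levels at most \<open>M\<close>. A point of the unit square
  lies in exactly one dyadic rectangle of each shape \<open>(k, l)\<close>, so the sum over
  rectangles becomes one over shapes.\<close>

definition cell_norm :: "nat \<Rightarrow> haar_series \<Rightarrow> nat set \<Rightarrow> nat set \<Rightarrow> real" where
  "cell_norm M a v w =
    L2_set (\<lambda>(k, l). a (drect k (v \<inter> {..<k}) l (w \<inter> {..<l}))) ({..M} \<times> {..M})"

lemma cell_norm_nonneg [simp]: "0 \<le> cell_norm M a v w"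
  by (simp add: cell_norm_def)

definition restr :: "rect set \<Rightarrow> haar_series \<Rightarrow> haar_series" where
  "restr F a = (\<lambda>R. if R \<in> F then a R else 0)"

lemma restr_apply [simp]: "R \<in> F \<Longrightarrow> restr F a R = a R" "R \<notin> F \<Longrightarrow> restr F a R = 0"
  by (auto simp: restr_def)

lemma square_sum_restr:
  assumes "finite F" "F \<subseteq> dyadic_rects"
  shows "square_sum (restr F a) x y = (\<Sum>R\<in>F. ennreal (\<bar>a R\<bar>\<^sup>2 * (haar2 R x y)\<^sup>2))"
proof -
  have "square_sum (restr F a) x y = (\<Sum>\<^sub>\<infinity>R\<in>F. ennreal (\<bar>a R\<bar>\<^sup>2 * (haar2 R x y)\<^sup>2))"
    unfolding square_sum_def using assms by (intro infsum_cong_neutral) (auto simp: restr_def)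
  then show ?thesis using assms by (simp add: infsum_finite)
qed

lemma square_sum_grid:
  assumes "v \<subseteq> {..<M}" "w \<subseteq> {..<M}" "x \<in> ivl M v" "y \<in> ivl M w"
  shows "square_sum (restr (rects_upto M) a) x y = ennreal ((cell_norm M a v w)\<^sup>2)"
proof -
  define h where "h = (\<lambda>(k, l). drect k (v \<inter> {..<k}) l (w \<inter> {..<l}))"
  have inj: "inj_on h ({..M} \<times> {..M})"
    by (auto simp: inj_on_def h_def drect_eq_iff)
  have "square_sum (restr (rects_upto M) a) x y = (\<Sum>R\<in>rects_upto M. ennreal (\<bar>a R\<bar>\<^sup>2 * (haar2 R x y)\<^sup>2))"
    by (rule square_sum_restr) (auto simp: rects_upto_subset)
  also have "\<dots> = (\<Sum>R\<in>h ` ({..M} \<times> {..M}). ennreal (\<bar>a R\<bar>\<^sup>2 * (haar2 R x y)\<^sup>2))"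
  proof (rule sum.mono_neutral_right)
    show "h ` ({..M} \<times> {..M}) \<subseteq> rects_upto M"
      by (auto simp: h_def drect_mem_upto_iff)
    show "\<forall>R\<in>rects_upto M - h ` ({..M} \<times> {..M}). ennreal (\<bar>a R\<bar>\<^sup>2 * (haar2 R x y)\<^sup>2) = 0"
    proof
      fix R assume R: "R \<in> rects_upto M - h ` ({..M} \<times> {..M})"
      then obtain k s l t where Req: "R = drect k s l t" and kl: "k \<le> M" "l \<le> M" and st: "s \<subseteq> {..<k}" "t \<subseteq> {..<l}"
        by (auto simp: rects_upto_def)
      have "\<not> (x \<in> ivl k s \<and> y \<in> ivl l t)"
      proof
        assume "x \<in> ivl k s \<and> y \<in> ivl l t"
        then have "R = h (k, l)" using ivl_cell_iff[OF assms(1) kl(1) assms(3) st(1)]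
          ivl_cell_iff[OF assms(2) kl(2) assms(4) st(2)] by (simp add: Req h_def)
        with R kl show False by auto
      qed
      then show "ennreal (\<bar>a R\<bar>\<^sup>2 * (haar2 R x y)\<^sup>2) = 0" by (auto simp: Req haar2_drect_sq)
    qed
  qed simp
  also have "\<dots> = (\<Sum>z\<in>{..M} \<times> {..M}. ennreal ((a (h z))\<^sup>2))"
    unfolding sum.reindex[OF inj] comp_def
  proof (rule sum.cong)
    fix z assume "z \<in> {..M} \<times> {..M}"
    then show "ennreal (\<bar>a (h z)\<bar>\<^sup>2 * (haar2 (h z) x y)\<^sup>2) = ennreal ((a (h z))\<^sup>2)"
      using ivl_cell_nested[OF assms(1) _ assms(3)] ivl_cell_nested[OF assms(2) _ assms(4)]
      by (auto simp: h_def haar2_drect_sq)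
  qed simp
  also have "\<dots> = ennreal ((cell_norm M a v w)\<^sup>2)"
    by (simp add: cell_norm_def L2_set_def sum_nonneg h_def case_prod_unfold)
  finally show ?thesis .
qed

text \<open>An unordered sum of nonnegative terms is the supremum of its finite partial sums, and
  the sets \<open>rects_upto n\<close> are cofinal among the finite ones.\<close>

lemma square_sum_SUP: "square_sum a x y = (SUP n. square_sum (restr (rects_upto n) a) x y)"
proof (rule order_antisym)
  have "sum (\<lambda>R. ennreal (\<bar>a R\<bar>\<^sup>2 * (haar2 R x y)\<^sup>2)) F \<le> (SUP n. square_sum (restr (rects_upto n) a) x y)"
    if F: "finite F" "F \<subseteq> dyadic_rects" for F
  proof -
    obtain n where n: "F \<subseteq> rects_upto n" using ex_rects_upto[OF F] by blast
    have "sum (\<lambda>R. ennreal (\<bar>a R\<bar>\<^sup>2 * (haar2 R x y)\<^sup>2)) F \<le> square_sum (restr (rects_upto n) a) x y"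
      using n by (subst square_sum_restr) (auto simp: rects_upto_subset simp del: sum_ennreal intro!: sum_mono2)
    also have "\<dots> \<le> (SUP n. square_sum (restr (rects_upto n) a) x y)" by (intro SUP_upper) auto
    finally show ?thesis .
  qed
  then show "square_sum a x y \<le> (SUP n. square_sum (restr (rects_upto n) a) x y)"
    unfolding square_sum_def[of a] by (subst nonneg_infsum_complete) (auto intro!: SUP_least)
  show "(SUP n. square_sum (restr (rects_upto n) a) x y) \<le> square_sum a x y"
    unfolding square_sum_def
    by (intro SUP_least infsum_mono) (auto simp: restr_def nonneg_summable_on_complete)
qed

lemma square_sum_mono:
  assumes "\<And>R. R \<in> dyadic_rects \<Longrightarrow> \<bar>a R\<bar> \<le> \<bar>b R\<bar>"
  shows "square_sum a x y \<le> square_sum b x y"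
  unfolding square_sum_def using assms
  by (intro infsum_mono ennreal_leI mult_right_mono power_mono) (auto simp: nonneg_summable_on_complete)

section \<open>The mixed norm as a supremum of finite mixed averages\<close>

locale mixed_norm =
  fixes p q :: real
  assumes p: "1 \<le> p" and q: "1 \<le> q"
begin

text \<open>\<open>cell_norm\<close> sees only levels up to \<open>M\<close>, so this is the norm of
  a truncated series, computed cell by cell.\<close>

definition grid_norm :: "nat \<Rightarrow> haar_series \<Rightarrow> real" where
  "grid_norm M a = lp p (Pow {..<M}) (\<lambda>v. lp q (Pow {..<M}) (cell_norm M a v))"

abbreviation me :: "haar_series \<Rightarrow> ennreal" where "me \<equiv> mixed_enorm p q"

lemma grid_norm_nonneg [simp]: "0 \<le> grid_norm M a" by (simp add: grid_norm_def)

lemma inner_grid: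
  assumes "v \<subseteq> {..<M}" "x \<in> ivl M v"
  shows "(\<integral>\<^sup>+y\<in>{0..<1}. epow (square_sum (restr (rects_upto M) a) x y) (q / 2) \<partial>lborel)
      = ennreal (lp q (Pow {..<M}) (cell_norm M a v) powr q)"
    and "(\<lambda>y. epow (square_sum (restr (rects_upto M) a) x y) (q / 2) * indicator {0..<1} y) \<in> borel_measurable lborel"
proof -
  have g: "epow (square_sum (restr (rects_upto M) a) x y) (q / 2) = ennreal (cell_norm M a v w powr q)"
    if "w \<subseteq> {..<M}" "y \<in> ivl M w" for y w
  proof -
    have "((cell_norm M a v w)\<^sup>2) powr (q / 2) = cell_norm M a v w powr q"
      using q by (simp add: powr_powr flip: powr_numeral)
    then show ?thesis
      using square_sum_grid[OF assms(1) that(1) assms(2) that(2)] by (simp add: epow_ennreal)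
  qed
  show "(\<integral>\<^sup>+y\<in>{0..<1}. epow (square_sum (restr (rects_upto M) a) x y) (q / 2) \<partial>lborel)
      = ennreal (lp q (Pow {..<M}) (cell_norm M a v) powr q)"
    using q by (subst nn_integral_grid(1)[OF g]) (auto simp: lp_powr)
  show "(\<lambda>y. epow (square_sum (restr (rects_upto M) a) x y) (q / 2) * indicator {0..<1} y) \<in> borel_measurable lborel"
    by (rule nn_integral_grid(2)[OF g]) auto
qed

lemma outer_grid:
  assumes "v \<subseteq> {..<M}" "x \<in> ivl M v"
  shows "epow (\<integral>\<^sup>+y\<in>{0..<1}. epow (square_sum (restr (rects_upto M) a) x y) (q / 2) \<partial>lborel) (p / q)
      = ennreal (lp q (Pow {..<M}) (cell_norm M a v) powr p)"
  unfolding inner_grid(1)[OF assms] using q by (simp add: epow_ennreal powr_powr)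

lemma me_restr_upto: "me (restr (rects_upto M) a) = ennreal (grid_norm M a)"
  unfolding mixed_enorm_def using p
  by (subst nn_integral_grid(1)[OF outer_grid]) (auto simp: epow_ennreal grid_norm_def avg_nonneg lp_avg_eq[of p])

lemma incseq_square_sum: "incseq (\<lambda>n. square_sum (restr (rects_upto n) a) x y)"
  by (intro monoI square_sum_mono) (use rects_upto_mono in \<open>auto simp: restr_def\<close>)

lemma inner_SUP:
  assumes "0 \<le> x" "x < 1"
  shows "(\<integral>\<^sup>+y\<in>{0..<1}. epow (square_sum a x y) (q / 2) \<partial>lborel) =
    (SUP n. \<integral>\<^sup>+y\<in>{0..<1}. epow (square_sum (restr (rects_upto n) a) x y) (q / 2) \<partial>lborel)"
proof -
  have "epow (square_sum a x y) (q / 2) * indicator {0..<1} y =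
     (SUP n. epow (square_sum (restr (rects_upto n) a) x y) (q / 2) * indicator {0..<1} y)" for y
    using q by (subst square_sum_SUP) (simp add: epow_SUP SUP_mult_right_ennreal)
  then have "(\<integral>\<^sup>+y\<in>{0..<1}. epow (square_sum a x y) (q / 2) \<partial>lborel) =
    (\<integral>\<^sup>+y. (SUP n. epow (square_sum (restr (rects_upto n) a) x y) (q / 2) * indicator {0..<1} y) \<partial>lborel)"
    by (simp only:)
  also have "\<dots> = (SUP n. \<integral>\<^sup>+y\<in>{0..<1}. epow (square_sum (restr (rects_upto n) a) x y) (q / 2) \<partial>lborel)"
  proof (rule nn_integral_monotone_convergence_SUP)
    show "incseq (\<lambda>n y. epow (square_sum (restr (rects_upto n) a) x y) (q / 2) * indicator {0..<1} y)"
      using q monoD[OF incseq_square_sum[of a x]]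
      by (intro monoI le_funI mult_right_mono epow_mono) auto
    \<comment> \<open>For fixed \<open>x\<close> the truncated square function is a step function of
      \<open>y\<close> that depends on \<open>x\<close> only through its cell.\<close>
    show "(\<lambda>y. epow (square_sum (restr (rects_upto n) a) x y) (q / 2) * indicator {0..<1} y) \<in> borel_measurable lborel" for n
    proof -
      obtain v where "v \<subseteq> {..<n}" "x \<in> ivl n v" using ex_ivl_cell[OF assms, of n] by blast
      then show ?thesis by (rule inner_grid(2))
    qed
  qed
  finally show ?thesis .
qed

text \<open>Monotone convergence in both integrals. Every inequality between norms is thereby
  reduced to finite averages, and measurability is required only of truncations, which are step
  functions.\<close>

lemma me_SUP: "me a = (SUP n. ennreal (grid_norm n a))"
proof -
  define J where "J a x = (\<integral>\<^sup>+y\<in>{0..<1}. epow (square_sum a x y) (q / 2) \<partial>lborel)" for a x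
  have J_mono: "J a x \<le> J b x" if "\<And>R. R \<in> dyadic_rects \<Longrightarrow> \<bar>a R\<bar> \<le> \<bar>b R\<bar>" for a b x
    unfolding J_def using q that by (intro nn_integral_mono mult_right_mono epow_mono square_sum_mono) auto
  have "epow (J a x) (p / q) * indicator {0..<1} x =
     (SUP n. epow (J (restr (rects_upto n) a) x) (p / q) * indicator {0..<1} x)" for x
  proof (cases "x \<in> {0..<1}")
    case True
    then show ?thesis using p q by (simp add: J_def inner_SUP epow_SUP)
  qed simp
  then have "(\<integral>\<^sup>+x\<in>{0..<1}. epow (J a x) (p / q) \<partial>lborel) =
    (\<integral>\<^sup>+x. (SUP n. epow (J (restr (rects_upto n) a) x) (p / q) * indicator {0..<1} x) \<partial>lborel)"
    by (simp only:)
  also have "\<dots> = (SUP n. \<integral>\<^sup>+x\<in>{0..<1}. epow (J (restr (rects_upto n) a) x) (p / q) \<partial>lborel)"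
  proof (rule nn_integral_monotone_convergence_SUP)
    show "incseq (\<lambda>n x. epow (J (restr (rects_upto n) a) x) (p / q) * indicator {0..<1} x)"
    proof (intro monoI le_funI mult_right_mono epow_mono J_mono)
      show "\<bar>restr (rects_upto m) a R\<bar> \<le> \<bar>restr (rects_upto n) a R\<bar>" if "m \<le> n" for m n R
        using rects_upto_mono[OF that] by (auto simp: restr_def)
    qed (use p q in auto)
    show "(\<lambda>x. epow (J (restr (rects_upto n) a) x) (p / q) * indicator {0..<1} x) \<in> borel_measurable lborel" for n
      unfolding J_def by (rule nn_integral_grid(2)[OF outer_grid]) auto
  qed
  finally have "(\<integral>\<^sup>+x\<in>{0..<1}. epow (J a x) (p / q) \<partial>lborel) =
    (SUP n. \<integral>\<^sup>+x\<in>{0..<1}. epow (J (restr (rects_upto n) a) x) (p / q) \<partial>lborel)" .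
  then have "me a = (SUP n. me (restr (rects_upto n) a))"
    using p by (simp add: mixed_enorm_def J_def[symmetric] epow_SUP)
  then show ?thesis by (simp add: me_restr_upto)
qed

lemma grid_norm_le_me: "ennreal (grid_norm n a) \<le> me a"
  unfolding me_SUP by (rule SUP_upper) simp

lemma me_leI: "(\<And>n. ennreal (grid_norm n a) \<le> C) \<Longrightarrow> me a \<le> C"
  unfolding me_SUP by (rule SUP_least) simp

lemma me_mono: "(\<And>R. R \<in> dyadic_rects \<Longrightarrow> \<bar>a R\<bar> \<le> \<bar>b R\<bar>) \<Longrightarrow> me a \<le> me b"
  unfolding mixed_enorm_def using p q
  by (intro epow_mono nn_integral_mono mult_right_mono square_sum_mono) auto

lemma me_cong: "(\<And>R. R \<in> dyadic_rects \<Longrightarrow> \<bar>a R\<bar> = \<bar>b R\<bar>) \<Longrightarrow> me a = me b"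
  by (intro order_antisym me_mono) auto

lemma cell_norm_cmult: "cell_norm M (\<lambda>R. c * a R) v w = \<bar>c\<bar> * cell_norm M a v w"
  unfolding cell_norm_def
  by (subst L2_set_right_distrib) (auto simp: L2_set_def power_mult_distrib intro!: sum.cong)

lemma grid_norm_cmult: "grid_norm M (\<lambda>R. c * a R) = \<bar>c\<bar> * grid_norm M a"
  using p q unfolding grid_norm_def cell_norm_cmult by (simp add: lp_cmult)

lemma me_cmult: "me (\<lambda>R. c * a R) = ennreal \<bar>c\<bar> * me a"
  unfolding me_SUP grid_norm_cmult by (simp add: ennreal_mult SUP_mult_left_ennreal)

lemma me_zero [simp]: "me (\<lambda>R. 0) = 0"
  using me_cmult[of 0 "\<lambda>R. 0"] by simp

lemma cell_norm_add: "cell_norm M (\<lambda>R. a R + b R) v w \<le> cell_norm M a v w + cell_norm M b v w"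
  unfolding cell_norm_def by (rule order_trans[OF _ L2_set_triangle_ineq]) (simp add: case_prod_unfold)

lemma grid_norm_add: "grid_norm M (\<lambda>R. a R + b R) \<le> grid_norm M a + grid_norm M b"
proof -
  have "grid_norm M (\<lambda>R. a R + b R) \<le> lp p (Pow {..<M}) (\<lambda>v. lp q (Pow {..<M}) (\<lambda>w. cell_norm M a v w + cell_norm M b v w))"
    unfolding grid_norm_def using p q by (intro lp_mono cell_norm_add) auto
  also have "\<dots> \<le> lp p (Pow {..<M}) (\<lambda>v. lp q (Pow {..<M}) (cell_norm M a v) + lp q (Pow {..<M}) (cell_norm M b v))"
    using p q by (intro lp_mono lp_add_le) auto
  also have "\<dots> \<le> grid_norm M a + grid_norm M b"
    unfolding grid_norm_def using p q by (intro lp_add_le) auto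
  finally show ?thesis .
qed

lemma me_add: "me (\<lambda>R. a R + b R) \<le> me a + me b"
proof (rule me_leI)
  fix n
  have "ennreal (grid_norm n (\<lambda>R. a R + b R)) \<le> ennreal (grid_norm n a) + ennreal (grid_norm n b)"
    using grid_norm_add[of n a b] by (simp add: ennreal_leI flip: ennreal_plus)
  also have "\<dots> \<le> me a + me b" by (intro add_mono grid_norm_le_me)
  finally show "ennreal (grid_norm n (\<lambda>R. a R + b R)) \<le> me a + me b" .
qed

lemma me_sum: "finite I \<Longrightarrow> me (\<lambda>R. \<Sum>i\<in>I. f i R) \<le> (\<Sum>i\<in>I. me (f i))"
proof (induction I rule: finite_induct)
  case (insert i I)
  then show ?case using order_trans[OF me_add[of "f i" "\<lambda>R. \<Sum>i\<in>I. f i R"]] by (simp add: add_left_mono)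
qed simp

section \<open>Estimates by shapes and by coefficients\<close>

lemma cell_norm_ge:
  assumes "k \<le> M" "l \<le> M"
  shows "\<bar>a (drect k (v \<inter> {..<k}) l (w \<inter> {..<l}))\<bar> \<le> cell_norm M a v w"
proof -
  have "L2_set (\<lambda>z. \<bar>(case z of (k, l) \<Rightarrow> a (drect k (v \<inter> {..<k}) l (w \<inter> {..<l})))\<bar>) ({..M} \<times> {..M}) = cell_norm M a v w"
    by (simp add: cell_norm_def L2_set_def)
  moreover have "\<bar>a (drect k (v \<inter> {..<k}) l (w \<inter> {..<l}))\<bar> \<le>
    L2_set (\<lambda>z. \<bar>(case z of (k, l) \<Rightarrow> a (drect k (v \<inter> {..<k}) l (w \<inter> {..<l})))\<bar>) ({..M} \<times> {..M})"
    using member_le_L2_set[of "{..M} \<times> {..M}" "(k, l)" "\<lambda>z. \<bar>(case z of (k, l) \<Rightarrow> a (drect k (v \<inter> {..<k}) l (w \<inter> {..<l})))\<bar>"] assms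
    by simp
  ultimately show ?thesis by simp
qed

text \<open>One shape contributes a single term of the square function, and on a probability space
  the mean is dominated by the norms with exponents \<open>q\<close> and \<open>p\<close>.\<close>

lemma avg_shape_le_grid_norm:
  assumes "k \<le> M" "l \<le> M"
  shows "avg (Pow {..<k}) (\<lambda>s. avg (Pow {..<l}) (\<lambda>t. \<bar>a (drect k s l t)\<bar>)) \<le> grid_norm M a"
proof -
  have "avg (Pow {..<k}) (\<lambda>s. avg (Pow {..<l}) (\<lambda>t. \<bar>a (drect k s l t)\<bar>)) =
    avg (Pow {..<M}) (\<lambda>v. avg (Pow {..<M}) (\<lambda>w. \<bar>a (drect k (v \<inter> {..<k}) l (w \<inter> {..<l}))\<bar>))"
    by (subst avg_Pow_inter[of "{..<M}" "{..<k}" "\<lambda>s. avg _ (\<lambda>w. \<bar>a (drect k s l (w \<inter> {..<l}))\<bar>)"])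
      (use assms in \<open>auto intro!: avg_cong avg_Pow_inter[symmetric]\<close>)
  also have "\<dots> \<le> avg (Pow {..<M}) (\<lambda>v. lp q (Pow {..<M}) (cell_norm M a v))"
    using assms q by (intro avg_mono order_trans[OF avg_mono avg_le_lp] cell_norm_ge) auto
  also have "\<dots> \<le> grid_norm M a"
    unfolding grid_norm_def using p by (intro avg_le_lp) auto
  finally show ?thesis .
qed

text \<open>Rectangles of one shape are disjoint, so the left side is at most the integral of the
  modulus of one frequency part. Bounds on single coefficients and on averages over blocks both come
  from here.\<close>

lemma sum_shape_le_me:
  assumes "finite B" "\<And>Q. Q \<in> B \<Longrightarrow> \<exists>s\<subseteq>{..<k}. \<exists>t\<subseteq>{..<l}. Q = drect k s l t"
  shows "ennreal (\<Sum>Q\<in>B. \<bar>a Q\<bar> * area Q) \<le> me a"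
proof -
  define h where "h = (\<lambda>(s, t). drect k s l t)"
  have inj: "inj_on h (Pow {..<k} \<times> Pow {..<l})"
    by (auto simp: inj_on_def h_def drect_eq_iff)
  have "(\<Sum>Q\<in>B. \<bar>a Q\<bar> * area Q) \<le> (\<Sum>Q\<in>h ` (Pow {..<k} \<times> Pow {..<l}). \<bar>a Q\<bar> * area Q)"
    using assms by (intro sum_mono2) (fastforce simp: h_def area_drect)+
  also have "\<dots> = (\<Sum>z\<in>Pow {..<k} \<times> Pow {..<l}. \<bar>a (h z)\<bar> / (2 ^ k * 2 ^ l))"
    unfolding sum.reindex[OF inj] by (intro sum.cong) (auto simp: h_def area_drect power_add power_one_over)
  also have "\<dots> = avg (Pow {..<k} \<times> Pow {..<l}) (\<lambda>(s, t). \<bar>a (drect k s l t)\<bar>)"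
    by (simp add: avg_def card_cartesian_product card_Pow h_def sum_divide_distrib case_prod_unfold)
  also have "\<dots> \<le> grid_norm (max k l) a"
    unfolding avg_Times by (intro avg_shape_le_grid_norm) auto
  finally show ?thesis by (rule order_trans[OF ennreal_leI grid_norm_le_me])
qed

lemma coeff_le_me: "R \<in> dyadic_rects \<Longrightarrow> ennreal (\<bar>a R\<bar> * area R) \<le> me a"
proof (erule drect_cases)
  fix k s l t assume "R = drect k s l t" "s \<subseteq> {..<k}" "t \<subseteq> {..<l}"
  then show ?thesis using sum_shape_le_me[of "{R}" k l a] by auto
qed

text \<open>At each point at most one rectangle of each shape in \<open>W\<close> is active, so the
  square function is at most \<open>sqrt (card W)\<close> everywhere, whatever the signs and the
  exponents.\<close>

lemma me_le_sqrt_card: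
  assumes "\<And>R. \<bar>a R\<bar> \<le> 1" "finite W"
    "\<And>k s l t. s \<subseteq> {..<k} \<Longrightarrow> t \<subseteq> {..<l} \<Longrightarrow> (k, l) \<notin> W \<Longrightarrow> a (drect k s l t) = 0"
  shows "me a \<le> ennreal (sqrt (card W))"
proof (rule me_leI)
  fix M
  have "cell_norm M a v w \<le> sqrt (card W)" for v w
  proof -
    have "(\<Sum>z\<in>{..M} \<times> {..M}. (case z of (k, l) \<Rightarrow> a (drect k (v \<inter> {..<k}) l (w \<inter> {..<l})))\<^sup>2)
      \<le> (\<Sum>z\<in>({..M} \<times> {..M}). if z \<in> W then 1 else 0)"
      using assms(1)[of "drect _ _ _ _"] assms(3) by (intro sum_mono) (auto simp: abs_square_le_1)
    also have "\<dots> = card ({..M} \<times> {..M} \<inter> W)" by (simp add: sum.If_cases)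
    also have "\<dots> \<le> card W" using assms(2) by (simp add: card_mono)
    finally show ?thesis by (simp add: cell_norm_def L2_set_def)
  qed
  then have "grid_norm M a \<le> lp p (Pow {..<M}) (\<lambda>v. lp q (Pow {..<M}) (\<lambda>w. sqrt (card W)))"
    unfolding grid_norm_def using p q by (intro lp_mono) auto
  also have "\<dots> = sqrt (card W)" using p q by (simp add: lp_const Pow_not_empty)
  finally show "ennreal (grid_norm M a) \<le> ennreal (sqrt (card W))" by (rule ennreal_leI)
qed

lemma me_unit_le_1: "R \<in> dyadic_rects \<Longrightarrow> me (haar_unit R) \<le> 1"
proof (erule drect_cases)
  fix k s l t assume R: "R = drect k s l t" "s \<subseteq> {..<k}" "t \<subseteq> {..<l}"
  show "me (haar_unit R) \<le> 1"
  proof -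
    have "me (haar_unit R) \<le> ennreal (sqrt (card {(k, l)}))"
      using R by (intro me_le_sqrt_card) (auto simp: haar_unit_def drect_eq_iff)
    then show ?thesis by simp
  qed
qed

lemma me_le_restr:
  assumes "\<And>F. finite F \<Longrightarrow> F \<subseteq> dyadic_rects \<Longrightarrow> me (restr F a) \<le> C"
  shows "me a \<le> C"
  using assms[of "rects_upto _"] rects_upto_subset by (intro me_leI) (simp add: me_restr_upto)

text \<open>The triangle inequality, as every Haar function has norm at most
  \<open>1\<close>.\<close>

lemma me_restr_le_sum:
  assumes "finite F" "F \<subseteq> dyadic_rects"
  shows "me (restr F a) \<le> ennreal (\<Sum>R\<in>F. \<bar>a R\<bar>)"
proof -
  have eq: "restr F a = (\<lambda>Q. \<Sum>R\<in>F. a R * haar_unit R Q)"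
    using assms by (auto simp: restr_def haar_unit_def if_distrib[of "\<lambda>x. _ * x"] cong: if_cong)
  have "me (restr F a) \<le> (\<Sum>R\<in>F. ennreal \<bar>a R\<bar> * me (haar_unit R))"
    unfolding eq using me_sum[OF assms(1), of "\<lambda>R Q. a R * haar_unit R Q"] by (simp add: me_cmult)
  also have "\<dots> \<le> (\<Sum>R\<in>F. ennreal \<bar>a R\<bar> * 1)"
    using assms by (intro sum_mono mult_left_mono me_unit_le_1) auto
  finally show ?thesis by simp
qed

text \<open>Convergence of finitely many coefficients is convergence in norm, so the bound passes to
  each finite truncation of the limit, and these determine its norm.\<close>

lemma me_Fatou:
  assumes lim: "\<And>R. R \<in> dyadic_rects \<Longrightarrow> (\<lambda>n. a n R) \<longlonglongrightarrow> b R" and le: "\<And>n. me (a n) \<le> ennreal C"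
  shows "me b \<le> ennreal C"
proof (rule me_le_restr)
  fix F assume F: "finite F" "F \<subseteq> dyadic_rects"
  have *: "me (restr F b) \<le> ennreal C + ennreal (\<Sum>R\<in>F. \<bar>b R - a n R\<bar>)" for n
  proof -
    have "me (restr F b) = me (\<lambda>R. restr F (a n) R + restr F (\<lambda>R. b R - a n R) R)"
      by (intro arg_cong[of _ _ me]) (auto simp: restr_def)
    also have "\<dots> \<le> me (restr F (a n)) + me (restr F (\<lambda>R. b R - a n R))" by (rule me_add)
    also have "\<dots> \<le> me (a n) + ennreal (\<Sum>R\<in>F. \<bar>b R - a n R\<bar>)"
      using F by (intro add_mono me_mono me_restr_le_sum) (auto simp: restr_def)
    also have "\<dots> \<le> ennreal C + ennreal (\<Sum>R\<in>F. \<bar>b R - a n R\<bar>)" using le by (intro add_right_mono)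
    finally show ?thesis .
  qed
  have "(\<lambda>n. \<Sum>R\<in>F. \<bar>b R - a n R\<bar>) \<longlonglongrightarrow> (\<Sum>R\<in>F. \<bar>b R - b R\<bar>)"
    using F lim by (intro tendsto_intros) auto
  then have "(\<lambda>n. ennreal C + ennreal (\<Sum>R\<in>F. \<bar>b R - a n R\<bar>)) \<longlonglongrightarrow> ennreal C + ennreal 0"
    by (intro tendsto_add tendsto_const tendsto_ennrealI) simp
  then show "me (restr F b) \<le> ennreal C"
    using * by (intro LIMSEQ_le_const[of _ "ennreal C"]) auto
qed

end

section \<open>The pairing with Haar functions\<close>

text \<open>\<open>k < M\<close> is strict because the sign on a cell is decided by digit
  \<open>k\<close>, which a cell of level \<open>M\<close> has to resolve.\<close>

lemma haar_grid:
  assumes "w \<subseteq> {..<M}" "x \<in> ivl M w" "s \<subseteq> {..<k}" "k < M"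
  shows "haar (ivl k s) x = (if s = w \<inter> {..<k} then if k \<in> w then -1 else 1 else 0)"
proof -
  have 1: "x \<in> ivl k s \<longleftrightarrow> s = w \<inter> {..<k}"
    using assms by (intro ivl_cell_iff) auto
  have 2: "x \<in> ivl (Suc k) s \<longleftrightarrow> s = w \<inter> {..<Suc k}"
    using assms by (intro ivl_cell_iff) auto
  show ?thesis
  proof (cases "x \<in> ivl k s")
    case True
    then have s: "s = w \<inter> {..<k}" using 1 by simp
    have "x < left_end s + (1/2)^Suc k \<longleftrightarrow> x \<in> ivl (Suc k) s"
      using True by (auto simp: ivl_def)
    also have "\<dots> \<longleftrightarrow> k \<notin> w" unfolding 2 using s by (auto simp: lessThan_Suc)
    finally show ?thesis using True s by (simp add: haar_ivl)
  qed (use 1 in \<open>auto simp: haar_ivl\<close>)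
qed

text \<open>Flipping digit \<open>k'\<close> is a measure-preserving involution that reverses the
  sign of the finer function and leaves the coarser one unchanged, so the average equals its own
  negative.\<close>

lemma avg_haar_haar_less:
  assumes "s \<subseteq> {..<k}" "s' \<subseteq> {..<k'}" "k < k'" "k' < M"
  shows "avg (Pow {..<M}) (\<lambda>w. haar (ivl k s) (left_end w) * haar (ivl k' s') (left_end w)) = 0"
proof -
  define f where "f = (\<lambda>w. haar (ivl k s) (left_end w) * haar (ivl k' s') (left_end w))"
  define \<tau> where "\<tau> w = (if k' \<in> w then w - {k'} else insert k' w)" for w
  have "bij_betw \<tau> (Pow {..<M}) (Pow {..<M})"
    using assms by (intro bij_betw_byWitness[where f' = \<tau>]) (auto simp: \<tau>_def)
  from avg_bij[OF this, of f] have "avg (Pow {..<M}) f = avg (Pow {..<M}) (\<lambda>w. f (\<tau> w))" .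
  also have "\<dots> = avg (Pow {..<M}) (\<lambda>w. (-1) * f w)"
  proof (rule avg_cong)
    fix w assume "w \<in> Pow {..<M}"
    then have w: "w \<subseteq> {..<M}" by simp
    have \<tau>w: "\<tau> w \<subseteq> {..<M}" using w assms by (auto simp: \<tau>_def)
    have eqs: "\<tau> w \<inter> {..<k} = w \<inter> {..<k}" "k \<in> \<tau> w \<longleftrightarrow> k \<in> w" "\<tau> w \<inter> {..<k'} = w \<inter> {..<k'}" "k' \<in> \<tau> w \<longleftrightarrow> k' \<notin> w"
      using assms by (auto simp: \<tau>_def)
    show "f (\<tau> w) = (-1) * f w"
      unfolding f_def using assms w \<tau>w
      by (simp add: haar_grid[OF w] haar_grid[OF \<tau>w] eqs)
  qed
  also have "\<dots> = (-1) * avg (Pow {..<M}) f" by (rule avg_cmult)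
  finally show ?thesis by (simp add: f_def)
qed

lemma avg_haar_haar:
  assumes "s \<subseteq> {..<k}" "s' \<subseteq> {..<k'}" "k < M" "k' < M"
  shows "avg (Pow {..<M}) (\<lambda>w. haar (ivl k s) (left_end w) * haar (ivl k' s') (left_end w)) =
    (if k = k' \<and> s = s' then (1/2)^k else 0)"
proof -
  consider "k < k'" | "k' < k" | "k = k'" by linarith
  then show ?thesis
  proof cases
    case 1
    then show ?thesis using avg_haar_haar_less[of s k s' k' M] assms by simp
  next
    case 2
    then show ?thesis using avg_haar_haar_less[of s' k' s k M] assms by (simp add: mult.commute)
  next
    case 3
    have "avg (Pow {..<M}) (\<lambda>w. haar (ivl k s) (left_end w) * haar (ivl k' s') (left_end w)) =
       avg (Pow {..<M}) (\<lambda>w. if s = w \<inter> {..<k} \<and> s' = w \<inter> {..<k} then 1 else 0)"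
    proof (rule avg_cong)
      fix w assume "w \<in> Pow {..<M}"
      then have w: "w \<subseteq> {..<M}" by simp
      show "haar (ivl k s) (left_end w) * haar (ivl k' s') (left_end w) = (if s = w \<inter> {..<k} \<and> s' = w \<inter> {..<k} then 1 else 0)"
        using assms 3 by (simp add: haar_grid[OF w])
    qed
    also have "\<dots> = avg (Pow {..<k}) (\<lambda>w. if s = w \<and> s' = w then 1 else 0)"
      using assms by (subst avg_Pow_inter[symmetric, of "{..<M}"]) auto
    also have "\<dots> = (if s = s' then (1/2)^k else 0)"
    proof (cases "s = s'")
      case True
      then show ?thesis using assms by (simp add: avg_def card_Pow power_one_over)
    next
      case False
      then have "(\<lambda>w. if s = w \<and> s' = w then 1 else 0) = (\<lambda>w. 0 :: real)" by (auto split: if_splits)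
      then show ?thesis using False by (simp only:) (simp add: avg_def)
    qed
    finally show ?thesis using 3 by simp
  qed
qed

lemma lebesgue_integral_grid:
  fixes g :: "real \<Rightarrow> real"
  assumes "\<And>w x. w \<subseteq> {..<M} \<Longrightarrow> x \<in> ivl M w \<Longrightarrow> g x = v w"
  shows "(LINT x:{0..<1}|lborel. g x) = avg (Pow {..<M}) v"
proof -
  have m [measurable]: "ivl M w \<in> sets borel" for w by (simp add: ivl_def)
  have "(LINT x:{0..<1}|lborel. g x) = (LINT x|lborel. (\<Sum>w\<in>Pow {..<M}. v w * indicator (ivl M w) x))"
    unfolding set_lebesgue_integral_def
    by (intro Bochner_Integration.integral_cong refl, subst grid_sum_indicator[OF assms, symmetric]) auto
  also have "\<dots> = (\<Sum>w\<in>Pow {..<M}. v w * (1/2)^M)"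
    by (subst Bochner_Integration.integral_sum)
      (auto simp: emeasure_ivl intro!: integrable_mult_right integrable_real_indicator)
  also have "\<dots> = avg (Pow {..<M}) v"
    unfolding avg_def sum_distrib_right[symmetric] by (simp add: card_Pow power_one_over)
  finally show ?thesis .
qed

lemma avg_sum: "avg A (\<lambda>x. \<Sum>i\<in>I. f i x) = (\<Sum>i\<in>I. avg A (f i))"
  by (simp add: avg_def sum_divide_distrib sum.swap[of _ I])

lemma haar_level_grid:
  assumes "w \<subseteq> {..<M}" "x \<in> ivl M w" "s \<subseteq> {..<k}" "k < M"
  shows "haar (ivl k s) x = haar (ivl k s) (left_end w)"
  using haar_grid[OF assms] haar_grid[OF assms(1) left_end_mem_ivl assms(3,4)] by simp

text \<open>Finite partial sums are constant on the cells of one grid, where orthogonality of the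
  Haar functions is a statement about finite averages.\<close>

lemma pairing_integral:
  assumes "finite F" "F \<subseteq> dyadic_rects" "R \<in> F"
  shows "(LINT x:{0..<1}|lborel. (LINT y:{0..<1}|lborel. partial_haar F a x y * partial_haar F (haar_unit R) x y))
    = a R * area R"
proof -
  obtain n where n: "F \<subseteq> rects_upto n" using ex_rects_upto[OF assms(1,2)] by blast
  \<comment> \<open>One level beyond the finest rectangle, so that the signs of all Haar functions
    involved are constant on cells.\<close>
  define M where "M = Suc n"
  from n assms(3) obtain k s l t where R: "R = drect k s l t" "k < M" "l < M" "s \<subseteq> {..<k}" "t \<subseteq> {..<l}"
    by (fastforce simp: rects_upto_def M_def)
  define f where "f x y = partial_haar F a x y * partial_haar F (haar_unit R) x y" for x y
  have unit: "partial_haar F (haar_unit R) x y = haar2 R x y" for x y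
    using assms by (simp add: partial_haar_def haar_unit_def if_distrib[of "\<lambda>x. x * _"] cong: if_cong)
  have h2: "haar2 Q x y = haar2 Q (left_end v) (left_end w)" if "v \<subseteq> {..<M}" "x \<in> ivl M v" "w \<subseteq> {..<M}" "y \<in> ivl M w" "Q \<in> F"
    for Q x y v w
  proof -
    from n that(5) obtain k s l t where Q: "Q = drect k s l t" "k < M" "l < M" "s \<subseteq> {..<k}" "t \<subseteq> {..<l}"
      by (fastforce simp: rects_upto_def M_def)
    show ?thesis using haar_level_grid[OF that(1,2) Q(4,2)] haar_level_grid[OF that(3,4) Q(5,3)]
      by (simp add: Q haar2_def drect_def)
  qed
  have fg: "f x y = f (left_end v) (left_end w)" if "v \<subseteq> {..<M}" "x \<in> ivl M v" "w \<subseteq> {..<M}" "y \<in> ivl M w" for x y v w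
    unfolding f_def unit partial_haar_def using h2[OF that] assms(3) by simp
  have inner: "(LINT y:{0..<1}|lborel. f x y) = avg (Pow {..<M}) (\<lambda>w. f (left_end v) (left_end w))"
    if "v \<subseteq> {..<M}" "x \<in> ivl M v" for x v
    using fg[OF that] by (rule lebesgue_integral_grid)
  have "(LINT x:{0..<1}|lborel. (LINT y:{0..<1}|lborel. f x y)) =
    avg (Pow {..<M}) (\<lambda>v. avg (Pow {..<M}) (\<lambda>w. f (left_end v) (left_end w)))"
    using inner by (rule lebesgue_integral_grid)
  also have "\<dots> = avg (Pow {..<M}) (\<lambda>v. avg (Pow {..<M}) (\<lambda>w. \<Sum>Q\<in>F. a Q * (haar2 Q (left_end v) (left_end w) * haar2 R (left_end v) (left_end w))))"
    unfolding f_def unit by (simp add: partial_haar_def sum_distrib_right mult.assoc)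
  also have "\<dots> = (\<Sum>Q\<in>F. a Q * avg (Pow {..<M}) (\<lambda>v. avg (Pow {..<M}) (\<lambda>w. haar2 Q (left_end v) (left_end w) * haar2 R (left_end v) (left_end w))))"
    by (simp add: avg_sum avg_cmult)
  also have "\<dots> = (\<Sum>Q\<in>F. if Q = R then a R * area R else 0)"
  proof (rule sum.cong)
    fix Q assume "Q \<in> F"
    with n obtain k' s' l' t' where Q: "Q = drect k' s' l' t'" "k' < M" "l' < M" "s' \<subseteq> {..<k'}" "t' \<subseteq> {..<l'}"
      by (fastforce simp: rects_upto_def M_def)
    have "avg (Pow {..<M}) (\<lambda>v. avg (Pow {..<M}) (\<lambda>w. haar2 Q (left_end v) (left_end w) * haar2 R (left_end v) (left_end w))) =
      avg (Pow {..<M}) (\<lambda>v. (haar (ivl k' s') (left_end v) * haar (ivl k s) (left_end v)) * avg (Pow {..<M}) (\<lambda>w. haar (ivl l' t') (left_end w) * haar (ivl l t) (left_end w)))"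
      unfolding avg_cmult[symmetric] by (simp add: Q R haar2_def drect_def mult_ac)
    also have "\<dots> = avg (Pow {..<M}) (\<lambda>w. haar (ivl l' t') (left_end w) * haar (ivl l t) (left_end w)) * avg (Pow {..<M}) (\<lambda>v. (haar (ivl k' s') (left_end v) * haar (ivl k s) (left_end v)))"
      by (subst avg_cmult[symmetric]) (simp add: mult_ac)
    also have "\<dots> = (if Q = R then area R else 0)"
      using Q R by (simp add: avg_haar_haar drect_eq_iff area_drect power_add)
    finally show "a Q * avg (Pow {..<M}) (\<lambda>v. avg (Pow {..<M}) (\<lambda>w. haar2 Q (left_end v) (left_end w) * haar2 R (left_end v) (left_end w))) =
      (if Q = R then a R * area R else 0)" by simp
  qed simp
  also have "\<dots> = a R * area R" using assms by simp
  finally show ?thesis by (simp add: f_def)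
qed

text \<open>The net is constant from \<open>{R}\<close> on, so no convergence of Haar series
  enters.\<close>

lemma pairing_haar_unit:
  assumes "R \<in> dyadic_rects"
  shows "pairing a (haar_unit R) = a R * area R"
  unfolding pairing_def
proof (rule tendsto_Lim)
  show "((\<lambda>F. LINT x:{0..<1}|lborel. (LINT y:{0..<1}|lborel. partial_haar F a x y * partial_haar F (haar_unit R) x y)) \<longlongrightarrow> a R * area R) (finite_subsets_at_top dyadic_rects)"
  proof (rule tendsto_eventually)
    show "\<forall>\<^sub>F F in finite_subsets_at_top dyadic_rects. (LINT x:{0..<1}|lborel. (LINT y:{0..<1}|lborel. partial_haar F a x y * partial_haar F (haar_unit R) x y)) = a R * area R"
      unfolding eventually_finite_subsets_at_top
      using assms by (intro exI[of _ "{R}"]) (auto intro!: pairing_integral)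
  qed
qed simp

section \<open>Block systems\<close>

definition read_digits :: "(nat \<Rightarrow> nat) \<Rightarrow> nat \<Rightarrow> nat set \<Rightarrow> nat set" where
  "read_digits \<nu> k u = {i. i < k \<and> \<nu> i \<in> u}"

text \<open>The cells of level \<open>m\<close> that encode \<open>s\<close>: digits at positions
  other than \<open>\<nu> 0, ..., \<nu> (k - 1)\<close> are free.\<close>

definition block :: "(nat \<Rightarrow> nat) \<Rightarrow> nat \<Rightarrow> nat set \<Rightarrow> nat \<Rightarrow> nat set set" where
  "block \<nu> k s m = {u. u \<subseteq> {..<m} \<and> read_digits \<nu> k u = s}"

lemma read_digits_cong: "(\<And>i. i < k \<Longrightarrow> \<nu> i = \<mu> i) \<Longrightarrow> read_digits \<nu> k u = read_digits \<mu> k u"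
  by (auto simp: read_digits_def)

lemma finite_block [simp]: "finite (block \<nu> k s m)"
  by (rule finite_subset[of _ "Pow {..<m}"]) (auto simp: block_def)

lemma block_bij:
  assumes inj: "inj_on \<nu> {..<k}" and lt: "\<nu> ` {..<k} \<subseteq> {..<m}" and s: "s \<subseteq> {..<k}"
  shows "bij_betw (\<lambda>c. \<nu> ` s \<union> c) (Pow ({..<m} - \<nu> ` {..<k})) (block \<nu> k s m)"
proof (rule bij_betw_byWitness[where f' = "\<lambda>u. u - \<nu> ` {..<k}"])
  show "\<forall>c\<in>Pow ({..<m} - \<nu> ` {..<k}). \<nu> ` s \<union> c - \<nu> ` {..<k} = c"
    using s by auto
  show "\<forall>u\<in>block \<nu> k s m. \<nu> ` s \<union> (u - \<nu> ` {..<k}) = u"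
    by (auto simp: block_def read_digits_def)
  show "(\<lambda>c. \<nu> ` s \<union> c) ` Pow ({..<m} - \<nu> ` {..<k}) \<subseteq> block \<nu> k s m"
  proof safe
    fix c assume c: "c \<subseteq> {..<m} - \<nu> ` {..<k}"
    have "read_digits \<nu> k (\<nu> ` s \<union> c) = s"
      using c s inj by (auto simp: read_digits_def inj_on_def)
    moreover have "\<nu> ` s \<union> c \<subseteq> {..<m}" using c s lt by blast
    ultimately show "\<nu> ` s \<union> c \<in> block \<nu> k s m" by (simp add: block_def)
  qed
  show "(\<lambda>u. u - \<nu> ` {..<k}) ` block \<nu> k s m \<subseteq> Pow ({..<m} - \<nu> ` {..<k})"
    by (auto simp: block_def)
qed

text \<open>Exactly \<open>k\<close> of the \<open>m\<close> digits are prescribed, so the cells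
  fill the share \<open>(1 / 2) ^ k\<close> of the unit interval, the length of the interval encoded
  by \<open>s\<close>.\<close>

lemma card_block:
  assumes "inj_on \<nu> {..<k}" "\<nu> ` {..<k} \<subseteq> {..<m}" "s \<subseteq> {..<k}"
  shows "real (card (block \<nu> k s m)) = 2 ^ m * (1 / 2) ^ k"
proof -
  have card: "card (\<nu> ` {..<k}) = k" using assms(1) by (simp add: card_image)
  then have le: "k \<le> m" using card_mono[OF _ assms(2)] by simp
  have "card (block \<nu> k s m) = 2 ^ (m - k)"
    using bij_betw_same_card[OF block_bij[OF assms]] assms(2) card by (simp add: card_Pow card_Diff_subset)
  then have "real (card (block \<nu> k s m)) = 2 ^ (m - k)" by simp
  then show ?thesis using le by (simp only: power_diff power_one_over) simp
qed

text \<open>Digits at distinct positions are independent and uniform, so reading them is measure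
  preserving.\<close>

lemma avg_read_digits:
  assumes inj: "inj_on \<nu> {..<k}" and lt: "\<nu> ` {..<k} \<subseteq> {..<M}"
  shows "avg (Pow {..<M}) (\<lambda>w. g (read_digits \<nu> k w)) = avg (Pow {..<k}) g"
proof -
  have "avg (Pow {..<M}) (\<lambda>w. g (read_digits \<nu> k w)) = avg (Pow {..<M}) (\<lambda>w. g (read_digits \<nu> k (w \<inter> \<nu> ` {..<k})))"
    by (intro avg_cong arg_cong[of _ _ g]) (auto simp: read_digits_def)
  also have "\<dots> = avg (Pow (\<nu> ` {..<k})) (\<lambda>w. g (read_digits \<nu> k w))"
    using lt by (intro avg_Pow_inter) auto
  also have "\<dots> = avg (Pow {..<k}) (\<lambda>s. g (read_digits \<nu> k (\<nu> ` s)))"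
    using inj by (intro avg_bij bij_betw_Pow) (simp add: inj_on_imp_bij_betw)
  also have "\<dots> = avg (Pow {..<k}) g"
    using inj by (intro avg_cong arg_cong[of _ _ g]) (auto simp: read_digits_def inj_on_def)
  finally show ?thesis .
qed

lemma lp_read_digits:
  assumes "inj_on \<nu> {..<k}" "\<nu> ` {..<k} \<subseteq> {..<M}"
  shows "lp r (Pow {..<M}) (\<lambda>w. g (read_digits \<nu> k w)) = lp r (Pow {..<k}) g"
  using avg_read_digits[OF assms, of "\<lambda>s. g s powr r"] by (simp add: lp_avg_eq)

text \<open>Conditional expectation onto the digits read by \<open>\<nu>\<close> is
  contractive.\<close>

lemma lp_split:
  fixes \<nu> :: "nat \<Rightarrow> nat"
  assumes r: "1 \<le> r" and inj: "inj_on \<nu> {..<k}" and lt: "\<nu> ` {..<k} \<subseteq> {..<M}" and g: "\<And>w. 0 \<le> g w"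
  shows "lp r (Pow {..<k}) (\<lambda>s. avg (Pow ({..<M} - \<nu> ` {..<k})) (\<lambda>c. g (\<nu> ` s \<union> c))) \<le> lp r (Pow {..<M}) g"
proof -
  define U where "U = {..<M} - \<nu> ` {..<k}"
  have bij: "bij_betw (\<lambda>(s, c). \<nu> ` s \<union> c) (Pow {..<k} \<times> Pow U) (Pow {..<M})"
  proof (rule bij_betw_byWitness[where f' = "\<lambda>w. (read_digits \<nu> k w, w \<inter> U)"])
    show "\<forall>z\<in>Pow {..<k} \<times> Pow U. (\<lambda>w. (read_digits \<nu> k w, w \<inter> U)) (case z of (s, c) \<Rightarrow> \<nu> ` s \<union> c) = z"
      using inj by (auto simp: read_digits_def inj_on_def U_def)
  qed (use lt in \<open>auto simp: read_digits_def U_def\<close>)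
  have "lp r (Pow {..<k}) (\<lambda>s. avg (Pow U) (\<lambda>c. g (\<nu> ` s \<union> c))) \<le> lp r (Pow {..<k} \<times> Pow U) (\<lambda>(s, c). g (\<nu> ` s \<union> c))"
    using r g by (intro lp_avg_le) (auto simp: U_def)
  also have "\<dots> = lp r (Pow {..<M}) g"
    unfolding lp_bij[OF bij] by (simp add: case_prod_unfold)
  finally show ?thesis by (simp add: U_def)
qed

text \<open>Averages over blocks of different levels run over different sets of cells; this moves
  them all to one common set of free digits. The digits prescribed at indices
  \<open>k, ..., K - 1\<close> sit at positions from \<open>m\<close> on, where a cell of level
  \<open>m\<close> does not see them.\<close>

lemma avg_block:
  assumes inj: "inj_on \<nu> {..<K}" and "k \<le> K" and below: "\<And>i. i < k \<Longrightarrow> \<nu> i < m" and above: "\<And>i. k \<le> i \<Longrightarrow> i < K \<Longrightarrow> m \<le> \<nu> i"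
    and "m \<le> M" "s \<subseteq> {..<K}"
  shows "avg (block \<nu> k (s \<inter> {..<k}) m) F = avg (Pow ({..<M} - \<nu> ` {..<K})) (\<lambda>c. F ((\<nu> ` s \<union> c) \<inter> {..<m}))"
proof -
  have bij: "bij_betw (\<lambda>c. \<nu> ` (s \<inter> {..<k}) \<union> c) (Pow ({..<m} - \<nu> ` {..<k})) (block \<nu> k (s \<inter> {..<k}) m)"
    using below inj_on_subset[OF inj, of "{..<k}"] \<open>k \<le> K\<close> by (intro block_bij) auto
  have sub: "{..<m} - \<nu> ` {..<k} \<subseteq> {..<M} - \<nu> ` {..<K}"
  proof
    fix d assume d: "d \<in> {..<m} - \<nu> ` {..<k}"
    then have "d \<noteq> \<nu> i" if "i < K" for i using above[of i] that by (cases "i < k") auto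
    with d \<open>m \<le> M\<close> show "d \<in> {..<M} - \<nu> ` {..<K}" by auto
  qed
  have "avg (block \<nu> k (s \<inter> {..<k}) m) F = avg (Pow ({..<m} - \<nu> ` {..<k})) (\<lambda>c. F (\<nu> ` (s \<inter> {..<k}) \<union> c))"
    by (rule avg_bij[OF bij])
  also have "\<dots> = avg (Pow ({..<M} - \<nu> ` {..<K})) (\<lambda>c. F (\<nu> ` (s \<inter> {..<k}) \<union> (c \<inter> ({..<m} - \<nu> ` {..<k}))))"
    using sub by (intro avg_Pow_inter[symmetric]) auto
  also have "\<dots> = avg (Pow ({..<M} - \<nu> ` {..<K})) (\<lambda>c. F ((\<nu> ` s \<union> c) \<inter> {..<m}))"
  proof (intro avg_cong arg_cong[of _ _ F])
    fix c assume c: "c \<in> Pow ({..<M} - \<nu> ` {..<K})"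
    have "\<nu> ` (s \<inter> {..<k}) = \<nu> ` s \<inter> {..<m}"
    proof safe
      fix i assume i: "i \<in> s" "\<nu> i < m"
      then have "i < k" using above[of i] \<open>s \<subseteq> {..<K}\<close> by force
      with i show "\<nu> i \<in> \<nu> ` (s \<inter> {..<k})" by blast
    qed (use below in auto)
    moreover have "c \<inter> ({..<m} - \<nu> ` {..<k}) = c \<inter> {..<m}"
      using c \<open>k \<le> K\<close> by auto
    ultimately show "\<nu> ` (s \<inter> {..<k}) \<union> (c \<inter> ({..<m} - \<nu> ` {..<k})) = (\<nu> ` s \<union> c) \<inter> {..<m}" by blast
  qed
  finally show ?thesis .
qed

definition rect_block :: "(nat \<Rightarrow> nat) \<Rightarrow> nat \<Rightarrow> nat \<Rightarrow> rect \<Rightarrow> rect set" where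
  "rect_block \<nu> m n R = {drect m u n w | u w k s l t. R = drect k s l t \<and> s \<subseteq> {..<k} \<and> t \<subseteq> {..<l} \<and>
     u \<in> block \<nu> k s m \<and> w \<in> block \<nu> l t n}"

lemma rect_block_drect:
  assumes "s \<subseteq> {..<k}" "t \<subseteq> {..<l}"
  shows "rect_block \<nu> m n (drect k s l t) = (\<lambda>(u, w). drect m u n w) ` (block \<nu> k s m \<times> block \<nu> l t n)"
proof
  show "rect_block \<nu> m n (drect k s l t) \<subseteq> (\<lambda>(u, w). drect m u n w) ` (block \<nu> k s m \<times> block \<nu> l t n)"
    using assms by (auto simp: rect_block_def drect_eq_iff)
  have "drect m u n w \<in> rect_block \<nu> m n (drect k s l t)" if "u \<in> block \<nu> k s m" "w \<in> block \<nu> l t n" for u w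
    unfolding rect_block_def using assms that by blast
  then show "(\<lambda>(u, w). drect m u n w) ` (block \<nu> k s m \<times> block \<nu> l t n) \<subseteq> rect_block \<nu> m n (drect k s l t)"
    by (intro image_subsetI) (simp add: case_prod_unfold mem_Times_iff)
qed

lemma inj_on_drect_block: "inj_on (\<lambda>(u, w). drect m u n w) (block \<nu> k s m \<times> block \<nu> l t n)"
  by (auto simp: inj_on_def block_def drect_eq_iff)

lemma rect_block_subset: "rect_block \<nu> m n R \<subseteq> dyadic_rects"
  by (auto simp: rect_block_def block_def)

lemma finite_rect_block [simp]: "R \<in> dyadic_rects \<Longrightarrow> finite (rect_block \<nu> m n R)"
  by (erule drect_cases) (simp add: rect_block_drect)

lemma avg_rect_block:
  assumes "s \<subseteq> {..<k}" "t \<subseteq> {..<l}"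
  shows "avg (rect_block \<nu> m n (drect k s l t)) f =
    avg (block \<nu> k s m) (\<lambda>u. avg (block \<nu> l t n) (\<lambda>w. f (drect m u n w)))"
proof -
  have "bij_betw (\<lambda>(u, w). drect m u n w) (block \<nu> k s m \<times> block \<nu> l t n) (rect_block \<nu> m n (drect k s l t))"
    using inj_on_drect_block by (simp add: bij_betw_def rect_block_drect[OF assms])
  from avg_bij[OF this] show ?thesis by (simp add: avg_Times[symmetric] case_prod_unfold)
qed

section \<open>The spreading and averaging operators of a block system\<close>

lemma abs_avg_le: "\<bar>avg A f\<bar> \<le> avg A (\<lambda>x. \<bar>f x\<bar>)"
  by (simp add: avg_def divide_right_mono)

text \<open>The equivalences say that a side of level \<open>k\<close> is replaced by cells which,
  among the positions \<open>\<nu> i\<close>, resolve precisely those with \<open>i < k\<close>.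
  Injectivity gives every rectangle its own shape, so blocks are disjoint and never compete for the
  same term of the square function.\<close>

locale block_system = mixed_norm +
  fixes \<nu> :: "nat \<Rightarrow> nat" and m1 m2 :: "rect \<Rightarrow> nat"
  assumes mono: "strict_mono \<nu>"
    and m1: "\<And>k s l t i. s \<subseteq> {..<k} \<Longrightarrow> t \<subseteq> {..<l} \<Longrightarrow> i < k \<longleftrightarrow> \<nu> i < m1 (drect k s l t)"
    and m2: "\<And>k s l t i. s \<subseteq> {..<k} \<Longrightarrow> t \<subseteq> {..<l} \<Longrightarrow> i < l \<longleftrightarrow> \<nu> i < m2 (drect k s l t)"
    and inj: "inj_on (\<lambda>R. (m1 R, m2 R)) dyadic_rects"
begin

definition BB :: "rect \<Rightarrow> rect set" where
  "BB R = rect_block \<nu> (m1 R) (m2 R) R"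

lemma inj_\<nu>: "inj_on \<nu> A"
  using mono strict_mono_imp_inj_on inj_on_subset by blast

lemma le_m1: "s \<subseteq> {..<k} \<Longrightarrow> t \<subseteq> {..<l} \<Longrightarrow> k \<le> m1 (drect k s l t)"
  using m1[of s k t l "k - 1"] strict_mono_imp_increasing[OF mono, of "k - 1"] by (cases k) auto

lemma le_m2: "s \<subseteq> {..<k} \<Longrightarrow> t \<subseteq> {..<l} \<Longrightarrow> l \<le> m2 (drect k s l t)"
  using m2[of s k t l "l - 1"] strict_mono_imp_increasing[OF mono, of "l - 1"] by (cases l) auto

lemma BB_shape: "Q \<in> BB R \<Longrightarrow> \<exists>u\<subseteq>{..<m1 R}. \<exists>w\<subseteq>{..<m2 R}. Q = drect (m1 R) u (m2 R) w"
  by (auto simp: BB_def rect_block_def block_def)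

lemma BB_unique:
  assumes "R \<in> dyadic_rects" "R' \<in> dyadic_rects" "Q \<in> BB R" "Q \<in> BB R'"
  shows "R = R'"
proof -
  have "m1 R = m1 R' \<and> m2 R = m2 R'"
    using BB_shape[OF assms(3)] BB_shape[OF assms(4)] by (auto simp: drect_eq_iff)
  then show ?thesis using inj_onD[OF inj _ assms(1,2)] by simp
qed

text \<open>At most one \<open>R\<close> contributes, by \<open>BB_unique\<close>; writing a sum
  makes linearity immediate and yields \<open>0\<close> off the blocks.\<close>

definition spread :: "(rect \<Rightarrow> real) \<Rightarrow> haar_series \<Rightarrow> haar_series" where
  "spread e f Q = e Q * (\<Sum>R | R \<in> dyadic_rects \<and> Q \<in> BB R. f R)"

text \<open>All rectangles in \<open>BB R\<close> have equal area, so the average is the normalized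
  pairing with the block signed by \<open>\<sigma>\<close>.\<close>

definition collect :: "(rect \<Rightarrow> real) \<Rightarrow> haar_series \<Rightarrow> haar_series" where
  "collect \<sigma> f R = (if R \<in> dyadic_rects then avg (BB R) (\<lambda>Q. \<sigma> Q * f Q) else 0)"

lemma spread_eq: "R \<in> dyadic_rects \<Longrightarrow> Q \<in> BB R \<Longrightarrow> spread e f Q = e Q * f R"
proof -
  assume R: "R \<in> dyadic_rects" "Q \<in> BB R"
  then have "{R. R \<in> dyadic_rects \<and> Q \<in> BB R} = {R}" using BB_unique by blast
  then show ?thesis by (simp add: spread_def)
qed

lemma spread_nonzeroE:
  assumes "spread e f Q \<noteq> 0"
  obtains R where "R \<in> dyadic_rects" "Q \<in> BB R"
proof -
  have "{R. R \<in> dyadic_rects \<and> Q \<in> BB R} \<noteq> {}" using assms by (auto simp: spread_def simp del: Collect_empty_eq)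
  then show thesis using that by blast
qed

text \<open>Block rectangles active at a cell come from rectangles active at the cell whose digits
  are those read by \<open>\<nu>\<close>, and different block shapes come from different rectangles.
  So the sums of squares compare term by term.\<close>

lemma cell_norm_spread:
  assumes e: "\<And>Q. \<bar>e Q\<bar> \<le> 1"
  shows "cell_norm M' (restr (rects_upto M) (spread e f)) v w \<le> cell_norm M f (read_digits \<nu> M v) (read_digits \<nu> M w)"
proof -
  define a where "a = restr (rects_upto M) (spread e f)"
  define g where "g = (\<lambda>(k, l). a (drect k (v \<inter> {..<k}) l (w \<inter> {..<l})))"
  define R where "R = (\<lambda>(k, l). drect k (read_digits \<nu> M v \<inter> {..<k}) l (read_digits \<nu> M w \<inter> {..<l}))"
  have "(\<Sum>z\<in>{..M'} \<times> {..M'}. (g z)\<^sup>2) = (\<Sum>z\<in>{z\<in>{..M'} \<times> {..M'}. g z \<noteq> 0}. (g z)\<^sup>2)"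
    by (intro sum.mono_neutral_right) auto
  also have "\<dots> \<le> (\<Sum>z\<in>{..M} \<times> {..M}. (f (R z))\<^sup>2)"
  \<comment> \<open>The map \<open>i\<close> leads from \<open>(k, l)\<close> to the shape of its
    block, so distinct shapes on the left are matched with distinct terms on the right.\<close>
  proof (rule sum_le_included[where i = "\<lambda>z. (m1 (R z), m2 (R z))"], simp_all, safe)
    fix m n assume mn: "m \<le> M'" "n \<le> M'" "g (m, n) \<noteq> 0"
    define Q where "Q = drect m (v \<inter> {..<m}) n (w \<inter> {..<n})"
    have aQ: "a Q \<noteq> 0" "g (m, n) = a Q" using mn by (auto simp: g_def Q_def)
    then have Qup: "Q \<in> rects_upto M" and sQ: "spread e f Q \<noteq> 0" and aeq: "a Q = spread e f Q"
      by (auto simp: a_def restr_def split: if_splits)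
    have mM: "m \<le> M" "n \<le> M" using Qup by (auto simp: Q_def drect_mem_upto_iff)
    from sQ obtain R0 where R0: "R0 \<in> dyadic_rects" "Q \<in> BB R0" by (rule spread_nonzeroE)
    from R0(1) obtain k s l t where R0eq: "R0 = drect k s l t" and st: "s \<subseteq> {..<k}" "t \<subseteq> {..<l}"
      by (rule drect_cases)
    have mn_eq: "m = m1 R0" "n = m2 R0" using BB_shape[OF R0(2)] by (auto simp: Q_def drect_eq_iff)
    have blk: "v \<inter> {..<m} \<in> block \<nu> k s m" "w \<inter> {..<n} \<in> block \<nu> l t n"
    proof -
      from R0(2) obtain u u' where "Q = drect (m1 R0) u (m2 R0) u'" and u: "u \<in> block \<nu> k s (m1 R0)" "u' \<in> block \<nu> l t (m2 R0)"
        unfolding BB_def R0eq rect_block_drect[OF st] by auto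
      then have "v \<inter> {..<m} = u" "w \<inter> {..<n} = u'"
        by (auto simp: Q_def mn_eq drect_eq_iff block_def)
      with u show "v \<inter> {..<m} \<in> block \<nu> k s m" "w \<inter> {..<n} \<in> block \<nu> l t n" by (simp_all add: mn_eq)
    qed
    have lt: "i < k \<longleftrightarrow> \<nu> i < m" "i < l \<longleftrightarrow> \<nu> i < n" for i
      using m1[OF st, of i] m2[OF st, of i] by (simp_all add: mn_eq R0eq)
    have "k \<le> m" "l \<le> n" using le_m1[OF st] le_m2[OF st] by (simp_all add: mn_eq R0eq)
    then have kl: "k \<le> M" "l \<le> M" using mM by auto
    have "s = read_digits \<nu> k (v \<inter> {..<m})" "t = read_digits \<nu> l (w \<inter> {..<n})" using blk by (simp_all add: block_def)
    moreover have "read_digits \<nu> k (v \<inter> {..<m}) = read_digits \<nu> M v \<inter> {..<k}"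
      using iffD1[OF lt(1)] kl(1) unfolding read_digits_def by fastforce
    moreover have "read_digits \<nu> l (w \<inter> {..<n}) = read_digits \<nu> M w \<inter> {..<l}"
      using iffD1[OF lt(2)] kl(2) unfolding read_digits_def by fastforce
    ultimately have "s = read_digits \<nu> M v \<inter> {..<k}" "t = read_digits \<nu> M w \<inter> {..<l}" by simp_all
    then have Req: "R (k, l) = R0" by (simp add: R_def R0eq)
    have "(g (m, n))\<^sup>2 = (e Q)\<^sup>2 * (f R0)\<^sup>2"
      by (simp add: aQ aeq spread_eq[OF R0] power_mult_distrib)
    also have "\<dots> \<le> 1 * (f R0)\<^sup>2"
      using e[of Q] by (intro mult_right_mono) (auto simp: abs_square_le_1)
    finally have "(g (m, n))\<^sup>2 \<le> (f R0)\<^sup>2" by simp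
    then show "\<exists>x\<in>{..M}. \<exists>y\<in>{..M}. m1 (R (x, y)) = m \<and> m2 (R (x, y)) = n \<and> (g (m, n))\<^sup>2 \<le> (f (R (x, y)))\<^sup>2"
      using kl Req mn_eq by (intro bexI[of _ k] bexI[of _ l]) auto
  qed
  finally have "L2_set g ({..M'} \<times> {..M'}) \<le> L2_set (\<lambda>z. f (R z)) ({..M} \<times> {..M})"
    by (simp add: L2_set_def)
  then show ?thesis by (simp add: cell_norm_def g_def a_def R_def case_prod_unfold)
qed

lemma me_spread_le:
  assumes e: "\<And>Q. \<bar>e Q\<bar> \<le> 1"
  shows "me (spread e f) \<le> me f"
proof (rule me_leI)
  fix M
  \<comment> \<open>A grid fine enough to contain the positions \<open>\<nu> i\<close> for
    \<open>i < M\<close>; the truncation of the series stays at level \<open>M\<close>.\<close>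
  define M' where "M' = \<nu> M + M"
  have sub: "\<nu> ` {..<M} \<subseteq> {..<M'}"
    using mono by (auto simp: M'_def strict_mono_def intro: trans_less_add1)
  define a where "a = restr (rects_upto M) (spread e f)"
  have "grid_norm M' a \<le> lp p (Pow {..<M'}) (\<lambda>v. lp q (Pow {..<M'}) (\<lambda>w. cell_norm M f (read_digits \<nu> M v) (read_digits \<nu> M w)))"
    unfolding grid_norm_def a_def using p q e by (intro lp_mono cell_norm_spread) auto
  also have "\<dots> = grid_norm M f"
    unfolding grid_norm_def by (simp add: lp_read_digits[OF inj_\<nu> sub, of q] lp_read_digits[OF inj_\<nu> sub, of p "\<lambda>v. lp q _ (\<lambda>w. cell_norm M f v w)"])
  finally have le: "grid_norm M' a \<le> grid_norm M f" .
  have "ennreal (grid_norm M (spread e f)) = me (restr (rects_upto M') a)"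
    unfolding me_restr_upto[symmetric] a_def using rects_upto_mono[of M M']
    by (intro me_cong) (auto simp: restr_def M'_def)
  also have "\<dots> \<le> ennreal (grid_norm M f)" unfolding me_restr_upto using le by (rule ennreal_leI)
  also have "\<dots> \<le> me f" by (rule grid_norm_le_me)
  finally show "ennreal (grid_norm M (spread e f)) \<le> me f" .
qed

text \<open>For fixed free digits \<open>c\<close> and \<open>d\<close>, the rectangles picked from
  the different blocks all contain one and the same cell and have distinct shapes, so their
  coefficients are among those counted by \<open>cell_norm\<close> there. Minkowski's inequality in
  \<open>L2_set\<close> then takes the averages outside.\<close>

lemma cell_norm_collect:
  assumes \<sigma>: "\<And>Q. \<bar>\<sigma> Q\<bar> \<le> 1" and s: "s \<subseteq> {..<K}" and t: "t \<subseteq> {..<K}"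
    and M: "\<And>R. R \<in> rects_upto K \<Longrightarrow> m1 R \<le> M \<and> m2 R \<le> M"
    and U: "U = {..<M} - \<nu> ` {..<K}"
  shows "cell_norm K (collect \<sigma> a) s t \<le>
    avg (Pow U) (\<lambda>c. avg (Pow U) (\<lambda>d. cell_norm M a (\<nu> ` s \<union> c) (\<nu> ` t \<union> d)))"
proof -
  define R where "R = (\<lambda>(k, l). drect k (s \<inter> {..<k}) l (t \<inter> {..<l}))"
  define Q where "Q c d z = drect (m1 (R z)) ((\<nu> ` s \<union> c) \<inter> {..<m1 (R z)}) (m2 (R z)) ((\<nu> ` t \<union> d) \<inter> {..<m2 (R z)})" for c d z
  have Rup: "R z \<in> rects_upto K" if "z \<in> {..K} \<times> {..K}" for z
    using that by (auto simp: R_def drect_mem_upto_iff)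
  have Rle: "\<bar>collect \<sigma> a (R z)\<bar> \<le> avg (Pow U) (\<lambda>c. avg (Pow U) (\<lambda>d. \<bar>a (Q c d z)\<bar>))" if z: "z \<in> {..K} \<times> {..K}" for z
  proof -
    obtain k l where kl: "z = (k, l)" "k \<le> K" "l \<le> K" using z by auto
    have Rz: "R z = drect k (s \<inter> {..<k}) l (t \<inter> {..<l})" by (simp add: kl R_def)
    have RD: "R z \<in> dyadic_rects" using Rup[OF z] rects_upto_subset by blast
    have mM: "m1 (R z) \<le> M" "m2 (R z) \<le> M" using M[OF Rup[OF z]] by auto
    have lt: "i < k \<longleftrightarrow> \<nu> i < m1 (R z)" "i < l \<longleftrightarrow> \<nu> i < m2 (R z)" for i
      unfolding Rz by (rule m1, simp, simp, rule m2, simp, simp)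
    have "\<bar>collect \<sigma> a (R z)\<bar> \<le> avg (BB (R z)) (\<lambda>Q. \<bar>\<sigma> Q * a Q\<bar>)"
      using RD abs_avg_le by (simp add: collect_def)
    also have "\<dots> \<le> avg (BB (R z)) (\<lambda>Q. \<bar>a Q\<bar>)"
      using \<sigma> by (intro avg_mono) (simp add: abs_mult mult_left_le_one_le)
    also have "\<dots> = avg (block \<nu> k (s \<inter> {..<k}) (m1 (R z))) (\<lambda>u. avg (block \<nu> l (t \<inter> {..<l}) (m2 (R z))) (\<lambda>w. \<bar>a (drect (m1 (R z)) u (m2 (R z)) w)\<bar>))"
      unfolding BB_def by (subst (3) Rz, subst avg_rect_block) auto
    also have "\<dots> = avg (Pow U) (\<lambda>c. avg (block \<nu> l (t \<inter> {..<l}) (m2 (R z))) (\<lambda>w. \<bar>a (drect (m1 (R z)) ((\<nu> ` s \<union> c) \<inter> {..<m1 (R z)}) (m2 (R z)) w)\<bar>))"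
      unfolding U using kl lt mM s by (intro avg_block inj_\<nu>) (auto simp: not_less[symmetric])
    also have "\<dots> = avg (Pow U) (\<lambda>c. avg (Pow U) (\<lambda>d. \<bar>a (Q c d z)\<bar>))"
      unfolding U Q_def using kl lt mM t by (intro avg_cong avg_block inj_\<nu>) (auto simp: not_less[symmetric])
    finally show ?thesis .
  qed
  have Qle: "L2_set (\<lambda>z. \<bar>a (Q c d z)\<bar>) ({..K} \<times> {..K}) \<le> cell_norm M a (\<nu> ` s \<union> c) (\<nu> ` t \<union> d)" for c d
  proof -
    define h where "h z = (m1 (R z), m2 (R z))" for z
    have inj_h: "inj_on h ({..K} \<times> {..K})"
    proof -
      have "inj_on R ({..K} \<times> {..K})" by (auto simp: inj_on_def R_def drect_eq_iff)
      moreover have "inj_on (\<lambda>R. (m1 R, m2 R)) (R ` ({..K} \<times> {..K}))"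
        using inj by (rule inj_on_subset) (use Rup rects_upto_subset in blast)
      ultimately have "inj_on ((\<lambda>R. (m1 R, m2 R)) \<circ> R) ({..K} \<times> {..K})" by (rule comp_inj_on)
      then show ?thesis by (simp add: h_def[abs_def] comp_def)
    qed
    define g where "g = (\<lambda>(k, l). a (drect k ((\<nu> ` s \<union> c) \<inter> {..<k}) l ((\<nu> ` t \<union> d) \<inter> {..<l})))"
    have "(\<Sum>z\<in>{..K} \<times> {..K}. (a (Q c d z))\<^sup>2) = (\<Sum>z\<in>h ` ({..K} \<times> {..K}). (g z)\<^sup>2)"
      unfolding sum.reindex[OF inj_h] comp_def by (simp add: g_def h_def Q_def)
    also have "\<dots> \<le> (\<Sum>z\<in>{..M} \<times> {..M}. (g z)\<^sup>2)"
      using M[OF Rup] by (intro sum_mono2) (auto simp: h_def)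
    finally show ?thesis by (simp add: cell_norm_def L2_set_def g_def)
  qed
  have "cell_norm K (collect \<sigma> a) s t = L2_set (\<lambda>z. \<bar>collect \<sigma> a (R z)\<bar>) ({..K} \<times> {..K})"
    by (simp add: cell_norm_def L2_set_def R_def case_prod_unfold)
  also have "\<dots> \<le> L2_set (\<lambda>z. avg (Pow U) (\<lambda>c. avg (Pow U) (\<lambda>d. \<bar>a (Q c d z)\<bar>))) ({..K} \<times> {..K})"
    using Rle by (intro L2_set_mono) auto
  also have "\<dots> \<le> avg (Pow U) (\<lambda>c. L2_set (\<lambda>z. avg (Pow U) (\<lambda>d. \<bar>a (Q c d z)\<bar>)) ({..K} \<times> {..K}))"
    using U by (intro L2_set_avg_Minkowski) auto
  also have "\<dots> \<le> avg (Pow U) (\<lambda>c. avg (Pow U) (\<lambda>d. L2_set (\<lambda>z. \<bar>a (Q c d z)\<bar>) ({..K} \<times> {..K})))"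
    using U by (intro avg_mono L2_set_avg_Minkowski) auto
  also have "\<dots> \<le> avg (Pow U) (\<lambda>c. avg (Pow U) (\<lambda>d. cell_norm M a (\<nu> ` s \<union> c) (\<nu> ` t \<union> d)))"
    by (intro avg_mono Qle)
  finally show ?thesis .
qed

text \<open>The average over \<open>d\<close> is absorbed by contractivity in the second variable.
  The one over \<open>c\<close> sits inside the inner norm and must be moved out by Minkowski's
  inequality before the first variable can absorb it.\<close>

lemma me_collect_le:
  assumes \<sigma>: "\<And>Q. \<bar>\<sigma> Q\<bar> \<le> 1"
  shows "me (collect \<sigma> a) \<le> me a"
proof (rule me_leI)
  fix K
  \<comment> \<open>Beyond all digit positions in use and all block shapes of rectangles up to level
    \<open>K\<close>.\<close>
  define M where "M = \<nu> K + (\<Sum>R\<in>rects_upto K. m1 R + m2 R)"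
  define U where "U = {..<M} - \<nu> ` {..<K}"
  have M: "m1 R \<le> M \<and> m2 R \<le> M" if "R \<in> rects_upto K" for R
    using member_le_sum[of R "rects_upto K" "\<lambda>R. m1 R + m2 R"] that by (auto simp: M_def)
  have sub: "\<nu> ` {..<K} \<subseteq> {..<M}"
    using mono by (auto simp: M_def strict_mono_def intro: trans_less_add1)
  have split: "lp r (Pow {..<K}) (\<lambda>s. avg (Pow U) (\<lambda>c. g (\<nu> ` s \<union> c))) \<le> lp r (Pow {..<M}) g"
    if "1 \<le> r" "\<And>w. 0 \<le> g w" for r g
    unfolding U_def using that by (intro lp_split inj_\<nu> sub)
  have "grid_norm K (collect \<sigma> a) \<le> lp p (Pow {..<K}) (\<lambda>s. lp q (Pow {..<K}) (\<lambda>t.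
      avg (Pow U) (\<lambda>c. avg (Pow U) (\<lambda>d. cell_norm M a (\<nu> ` s \<union> c) (\<nu> ` t \<union> d)))))"
    unfolding grid_norm_def using p q by (intro lp_mono cell_norm_collect \<sigma> M U_def) auto
  also have "\<dots> \<le> lp p (Pow {..<K}) (\<lambda>s. avg (Pow U) (\<lambda>c. lp q (Pow {..<K}) (\<lambda>t.
      avg (Pow U) (\<lambda>d. cell_norm M a (\<nu> ` s \<union> c) (\<nu> ` t \<union> d)))))"
    using p q by (intro lp_mono lp_avg_Minkowski avg_nonneg) (auto simp: U_def)
  also have "\<dots> \<le> lp p (Pow {..<K}) (\<lambda>s. avg (Pow U) (\<lambda>c. lp q (Pow {..<M}) (cell_norm M a (\<nu> ` s \<union> c))))"
    using p q by (intro lp_mono avg_mono split avg_nonneg) auto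
  also have "\<dots> \<le> grid_norm M a"
    unfolding grid_norm_def using p by (intro split) auto
  finally have "ennreal (grid_norm K (collect \<sigma> a)) \<le> ennreal (grid_norm M a)" by (rule ennreal_leI)
  also have "\<dots> \<le> me a" by (rule grid_norm_le_me)
  finally show "ennreal (grid_norm K (collect \<sigma> a)) \<le> me a" .
qed

end

section \<open>Operators on the mixed-norm Hardy space\<close>

lemma haar_unit_apply [simp]: "haar_unit R R = 1" "Q \<noteq> R \<Longrightarrow> haar_unit R Q = 0"
  by (simp_all add: haar_unit_def)

context mixed_norm
begin

abbreviation H :: "haar_series set" where "H \<equiv> hardy p q"
abbreviation hn :: "haar_series \<Rightarrow> real" where "hn \<equiv> hardy_norm p q"

lemma H_me: "a \<in> H \<Longrightarrow> me a = ennreal (hn a)"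
  by (auto simp: hardy_def hardy_norm_def)

lemma hn_nonneg [simp]: "0 \<le> hn a"
  by (simp add: hardy_norm_def)

lemma H_off: "a \<in> H \<Longrightarrow> R \<notin> dyadic_rects \<Longrightarrow> a R = 0"
  unfolding hardy_def by blast

lemma hn_leI: "me a \<le> ennreal C \<Longrightarrow> 0 \<le> C \<Longrightarrow> hn a \<le> C"
  unfolding hardy_norm_def by (metis enn2real_leI)

section \<open>The Hardy space as a closed linear space\<close>

lemma span_finite: "b \<in> haar_span \<Longrightarrow> finite {R. b R \<noteq> 0}"
  by (simp add: haar_span_def)

lemma span_off: "b \<in> haar_span \<Longrightarrow> R \<notin> dyadic_rects \<Longrightarrow> b R = 0"
  by (auto simp: haar_span_def)

lemma span_add:
  assumes "a \<in> haar_span" "b \<in> haar_span" shows "(\<lambda>R. a R + b R) \<in> haar_span"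
proof -
  have "finite ({R. a R \<noteq> 0} \<union> {R. b R \<noteq> 0})" using assms by (simp add: haar_span_def)
  then have "finite {R. a R + b R \<noteq> 0}" by (rule rev_finite_subset) auto
  moreover have "{R. a R + b R \<noteq> 0} \<subseteq> dyadic_rects" using assms by (force simp: haar_span_def)
  ultimately show ?thesis by (simp add: haar_span_def)
qed

lemma span_cmult:
  assumes "a \<in> haar_span" shows "(\<lambda>R. c * a R) \<in> haar_span"
  using assms unfolding haar_span_def by (auto elim: rev_finite_subset)

lemma span_subset_H: "b \<in> haar_span \<Longrightarrow> b \<in> H"
proof -
  assume b: "b \<in> haar_span"
  have "restr {R. b R \<noteq> 0} b = b" by (auto simp: restr_def)
  then have "me b < \<infinity>"
    using me_restr_le_sum[of "{R. b R \<noteq> 0}" b] b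
    by (simp add: haar_span_def) (metis ennreal_less_top le_less_trans)
  then show "b \<in> H" using b span_off[OF b] by (auto simp: hardy_def intro!: bexI[of _ b])
qed

lemma unit_span: "R \<in> dyadic_rects \<Longrightarrow> haar_unit R \<in> haar_span"
  by (auto simp: haar_span_def haar_unit_def split: if_splits)

lemma unit_H: "R \<in> dyadic_rects \<Longrightarrow> haar_unit R \<in> H"
  by (rule span_subset_H[OF unit_span])

text \<open>Closedness: approximants from the space itself suffice, since each is approximated by
  finite series; a single one already gives finiteness of the norm.\<close>

lemma HI:
  assumes "\<And>R. R \<notin> dyadic_rects \<Longrightarrow> a R = 0" and "\<And>\<epsilon>. 0 < \<epsilon> \<Longrightarrow> \<exists>b\<in>H. me (\<lambda>R. a R - b R) < ennreal \<epsilon>"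
  shows "a \<in> H"
proof -
  have ap: "\<exists>c\<in>haar_span. me (\<lambda>R. a R - c R) < ennreal \<epsilon>" if "0 < \<epsilon>" for \<epsilon>
  proof -
    obtain b where b: "b \<in> H" "me (\<lambda>R. a R - b R) < ennreal (\<epsilon>/2)" using assms(2)[of "\<epsilon>/2"] \<open>0 < \<epsilon>\<close> by auto
    obtain c where c: "c \<in> haar_span" "me (\<lambda>R. b R - c R) < ennreal (\<epsilon>/2)"
      using b(1) \<open>0 < \<epsilon>\<close> by (auto simp: hardy_def dest!: spec[of _ "\<epsilon>/2"])
    have "me (\<lambda>R. (a R - b R) + (b R - c R)) \<le> me (\<lambda>R. a R - b R) + me (\<lambda>R. b R - c R)"
      by (rule me_add)
    also have "\<dots> < ennreal (\<epsilon>/2) + ennreal (\<epsilon>/2)" by (intro add_strict_mono b c)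
    also have "\<dots> = ennreal \<epsilon>" using \<open>0 < \<epsilon>\<close> by (simp flip: ennreal_plus)
    finally show ?thesis using c(1) by auto
  qed
  obtain b where b: "b \<in> H" "me (\<lambda>R. a R - b R) < ennreal 1" using assms(2)[of 1] by auto
  have "me (\<lambda>R. (a R - b R) + b R) \<le> me (\<lambda>R. a R - b R) + me b" by (rule me_add)
  also have "\<dots> < \<infinity>" using b H_me[OF b(1)] by (auto simp: ennreal_add_eq_top less_top[symmetric])
  finally have "me a < \<infinity>" by simp
  then show ?thesis using assms(1) ap by (simp add: hardy_def)
qed

lemma H_add: "a \<in> H \<Longrightarrow> b \<in> H \<Longrightarrow> (\<lambda>R. a R + b R) \<in> H"
proof (rule HI)
  fix \<epsilon> :: real assume ab: "a \<in> H" "b \<in> H" and "0 < \<epsilon>"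
  obtain c where c: "c \<in> haar_span" "me (\<lambda>R. a R - c R) < ennreal (\<epsilon>/2)"
    using ab(1) \<open>0 < \<epsilon>\<close> by (auto simp: hardy_def dest!: spec[of _ "\<epsilon>/2"])
  obtain d where d: "d \<in> haar_span" "me (\<lambda>R. b R - d R) < ennreal (\<epsilon>/2)"
    using ab(2) \<open>0 < \<epsilon>\<close> by (auto simp: hardy_def dest!: spec[of _ "\<epsilon>/2"])
  have "me (\<lambda>R. (a R - c R) + (b R - d R)) \<le> me (\<lambda>R. a R - c R) + me (\<lambda>R. b R - d R)"
    by (rule me_add)
  also have "\<dots> < ennreal (\<epsilon>/2) + ennreal (\<epsilon>/2)" by (intro add_strict_mono c d)
  also have "\<dots> = ennreal \<epsilon>" using \<open>0 < \<epsilon>\<close> by (simp flip: ennreal_plus)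
  finally have "me (\<lambda>R. (a R + b R) - (c R + d R)) < ennreal \<epsilon>" by (simp add: algebra_simps)
  then show "\<exists>e\<in>H. me (\<lambda>R. a R + b R - e R) < ennreal \<epsilon>"
    using span_subset_H[OF span_add[OF c(1) d(1)]] by auto
qed (simp add: H_off)

lemma H_cmult: "a \<in> H \<Longrightarrow> (\<lambda>R. c * a R) \<in> H"
proof (rule HI)
  fix \<epsilon> :: real assume a: "a \<in> H" and "0 < \<epsilon>"
  define d where "d = \<epsilon> / (\<bar>c\<bar> + 1)"
  have d: "0 < d" "\<bar>c\<bar> * d < \<epsilon>" using \<open>0 < \<epsilon>\<close> by (auto simp: d_def field_simps)
  obtain b where b: "b \<in> haar_span" "me (\<lambda>R. a R - b R) < ennreal d"
    using a d(1) by (auto simp: hardy_def)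
  have "me (\<lambda>R. c * (a R - b R)) \<le> ennreal \<bar>c\<bar> * ennreal d"
    unfolding me_cmult using b(2) by (intro mult_left_mono) auto
  also have "\<dots> = ennreal (\<bar>c\<bar> * d)" using d by (simp add: ennreal_mult)
  also have "\<dots> < ennreal \<epsilon>" using d \<open>0 < \<epsilon>\<close> by (intro ennreal_lessI) auto
  finally show "\<exists>e\<in>H. me (\<lambda>R. c * a R - e R) < ennreal \<epsilon>"
    using span_subset_H[OF span_cmult[OF b(1), of c]] by (auto simp: algebra_simps intro!: bexI[of _ "\<lambda>R. c * b R"])
qed (simp add: H_off)

lemma H_zero: "(\<lambda>R. 0) \<in> H"
  by (rule span_subset_H) (simp add: haar_span_def)

lemma H_uminus: "a \<in> H \<Longrightarrow> (\<lambda>R. - a R) \<in> H"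
  using H_cmult[of a "-1"] by simp

lemma H_diff: "a \<in> H \<Longrightarrow> b \<in> H \<Longrightarrow> (\<lambda>R. a R - b R) \<in> H"
  using H_add[of a "\<lambda>R. - b R"] H_uminus[of b] by simp

lemma H_sum: "finite I \<Longrightarrow> (\<And>i. i \<in> I \<Longrightarrow> f i \<in> H) \<Longrightarrow> (\<lambda>R. \<Sum>i\<in>I. f i R) \<in> H"
  by (induction I rule: finite_induct) (auto simp: H_zero H_add)

lemma hn_add: "a \<in> H \<Longrightarrow> b \<in> H \<Longrightarrow> hn (\<lambda>R. a R + b R) \<le> hn a + hn b"
  using me_add[of a b] by (intro hn_leI) (auto simp: H_me)

lemma hn_cmult: "hn (\<lambda>R. c * a R) = \<bar>c\<bar> * hn a"
  by (simp add: hardy_norm_def me_cmult enn2real_mult)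

lemma hn_uminus: "hn (\<lambda>R. - a R) = hn a"
  using hn_cmult[of "-1" a] by simp

lemma hn_zero [simp]: "hn (\<lambda>R. 0) = 0"
  using hn_cmult[of 0 "\<lambda>R. 0"] by simp

lemma hn_diff: "a \<in> H \<Longrightarrow> b \<in> H \<Longrightarrow> hn (\<lambda>R. a R - b R) \<le> hn a + hn b"
  using hn_add[of a "\<lambda>R. - b R"] H_uminus[of b] hn_uminus[of b] by simp

lemma hn_sum: "finite I \<Longrightarrow> (\<And>i. i \<in> I \<Longrightarrow> f i \<in> H) \<Longrightarrow> hn (\<lambda>R. \<Sum>i\<in>I. f i R) \<le> (\<Sum>i\<in>I. hn (f i))"
proof (induction I rule: finite_induct)
  case (insert i I)
  then show ?case using order_trans[OF hn_add[of "f i" "\<lambda>R. \<Sum>i\<in>I. f i R"]] H_sum[of I f] by simp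
qed simp

lemma coeff_le_hn: "a \<in> H \<Longrightarrow> R \<in> dyadic_rects \<Longrightarrow> \<bar>a R\<bar> * area R \<le> hn a"
  using coeff_le_me[of R a] by (simp add: H_me)

lemma H_approx:
  assumes "a \<in> H" "0 < \<epsilon>" obtains b where "b \<in> haar_span" "hn (\<lambda>R. a R - b R) < \<epsilon>"
proof -
  from assms obtain b where b: "b \<in> haar_span" "me (\<lambda>R. a R - b R) < ennreal \<epsilon>" by (auto simp: hardy_def)
  then have "hn (\<lambda>R. a R - b R) < \<epsilon>"
    using H_me[OF H_diff[OF assms(1) span_subset_H[OF b(1)]]] assms(2) by (simp add: ennreal_less_iff)
  with b(1) show thesis by (rule that)
qed

section \<open>Bounded operators with explicit constants\<close>

definition op_bound :: "(haar_series \<Rightarrow> haar_series) \<Rightarrow> real \<Rightarrow> bool" where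
  "op_bound T C \<longleftrightarrow> 0 \<le> C \<and> (\<forall>f\<in>H. T f \<in> H \<and> hn (T f) \<le> C * hn f) \<and>
    (\<forall>f\<in>H. \<forall>g\<in>H. T (\<lambda>R. f R + g R) = (\<lambda>R. T f R + T g R)) \<and>
    (\<forall>f\<in>H. \<forall>c. T (\<lambda>R. c * f R) = (\<lambda>R. c * T f R))"

lemma bounded_op_iff: "bounded_op p q T \<longleftrightarrow> (\<exists>C. op_bound T C)"
proof
  assume T: "bounded_op p q T"
  then obtain C where C: "\<forall>f\<in>H. hn (T f) \<le> C * hn f" by (auto simp: bounded_op_def)
  have "hn (T f) \<le> \<bar>C\<bar> * hn f" if "f \<in> H" for f
    using C that mult_right_mono[of C "\<bar>C\<bar>" "hn f"] by force
  then have "op_bound T \<bar>C\<bar>" using T by (auto simp: op_bound_def bounded_op_def)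
  then show "\<exists>C. op_bound T C" ..
qed (auto simp: op_bound_def bounded_op_def)

lemma op_boundD:
  assumes "op_bound T C"
  shows "0 \<le> C" "f \<in> H \<Longrightarrow> T f \<in> H" "f \<in> H \<Longrightarrow> hn (T f) \<le> C * hn f"
    "f \<in> H \<Longrightarrow> g \<in> H \<Longrightarrow> T (\<lambda>R. f R + g R) = (\<lambda>R. T f R + T g R)"
    "f \<in> H \<Longrightarrow> T (\<lambda>R. c * f R) = (\<lambda>R. c * T f R)"
  using assms by (auto simp: op_bound_def)

lemma op_zero: "op_bound T C \<Longrightarrow> T (\<lambda>R. 0) = (\<lambda>R. 0)"
  using op_boundD(5)[of T C "\<lambda>R. 0" 0] H_zero by simp

lemma op_diff:
  assumes "op_bound T C" "f \<in> H" "g \<in> H"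
  shows "T (\<lambda>R. f R - g R) = (\<lambda>R. T f R - T g R)"
  using op_boundD(4)[OF assms(1,2) H_uminus[OF assms(3)]] op_boundD(5)[OF assms(1,3), of "-1"] by simp

lemma op_sum:
  assumes "op_bound T C" "finite I" "\<And>i. i \<in> I \<Longrightarrow> f i \<in> H"
  shows "T (\<lambda>R. \<Sum>i\<in>I. c i * f i R) = (\<lambda>R. \<Sum>i\<in>I. c i * T (f i) R)"
  using assms(2,3)
proof (induction I rule: finite_induct)
  case empty
  then show ?case using op_zero[OF assms(1)] by simp
next
  case (insert i I)
  have "T (\<lambda>R. c i * f i R + (\<Sum>i\<in>I. c i * f i R)) = (\<lambda>R. T (\<lambda>R. c i * f i R) R + T (\<lambda>R. \<Sum>i\<in>I. c i * f i R) R)"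
    using insert by (intro op_boundD(4)[OF assms(1)] H_cmult H_sum) auto
  then show ?case using insert op_boundD(5)[OF assms(1), of "f i" "c i"] by simp
qed

lemma span_expand:
  assumes "b \<in> haar_span" shows "b = (\<lambda>Q. \<Sum>R\<in>{R. b R \<noteq> 0}. b R * haar_unit R Q)"
proof
  fix Q show "b Q = (\<Sum>R\<in>{R. b R \<noteq> 0}. b R * haar_unit R Q)"
    using span_finite[OF assms] by (simp add: haar_unit_def if_distrib[of "\<lambda>x. _ * x"] cong: if_cong)
qed

lemma op_comp: "op_bound S C \<Longrightarrow> op_bound T D \<Longrightarrow> op_bound (\<lambda>f. S (T f)) (C * D)"
proof -
  assume S: "op_bound S C" and T: "op_bound T D"
  have "hn (S (T f)) \<le> C * D * hn f" if "f \<in> H" for f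
  proof -
    have "hn (S (T f)) \<le> C * hn (T f)" using that by (intro op_boundD(3)[OF S] op_boundD(2)[OF T])
    also have "\<dots> \<le> C * (D * hn f)"
      using that by (intro mult_left_mono op_boundD(3)[OF T] op_boundD(1)[OF S])
    finally show ?thesis by simp
  qed
  then show ?thesis using op_boundD[OF S] op_boundD[OF T] unfolding op_bound_def by simp
qed

text \<open>At a series of norm zero the quotient is \<open>0\<close> by convention, and
  \<open>0 \<le> C\<close> covers that case; the zero series bounds the supremum from below.\<close>

lemma op_norm_bounds:
  assumes "op_bound T C" shows "0 \<le> op_norm p q T" "op_norm p q T \<le> C"
proof -
  have le: "hn (T f) / hn f \<le> C" if "f \<in> H" for f
    using op_boundD(1,3)[OF assms] that hn_nonneg[of f] by (cases "hn f = 0") (simp_all add: divide_le_eq less_le)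
  then have "bdd_above ((\<lambda>f. hn (T f) / hn f) ` H)" by (auto simp: bdd_above_def)
  then have "hn (T (\<lambda>R. 0)) / hn (\<lambda>R. 0) \<le> op_norm p q T"
    unfolding op_norm_def using H_zero by (intro cSUP_upper)
  then show "0 \<le> op_norm p q T" by simp
  show "op_norm p q T \<le> C"
    unfolding op_norm_def using H_zero le by (intro cSUP_least) auto
qed

text \<open>The map is linear on all coefficient families and bounded in the extended norm, so the
  images of finite approximants approximate the image. This is what places it in the closure of the
  span.\<close>

lemma coefficientwise_op_bound:
  assumes add: "\<And>f g. L (\<lambda>R. f R + g R) = (\<lambda>R. L f R + L g R)" and cmult: "\<And>f c. L (\<lambda>R. c * f R) = (\<lambda>R. c * L f R)"
    and le: "\<And>f. me (L f) \<le> ennreal C * me f" and "0 \<le> C"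
    and span: "\<And>b. b \<in> haar_span \<Longrightarrow> L b \<in> haar_span" and off: "\<And>f R. f \<in> H \<Longrightarrow> R \<notin> dyadic_rects \<Longrightarrow> L f R = 0"
  shows "op_bound L C"
proof -
  have LH: "L f \<in> H" if f: "f \<in> H" for f
  proof (rule HI)
    fix \<epsilon> :: real assume "0 < \<epsilon>"
    define d where "d = \<epsilon> / (C + 1)"
    have d: "0 < d" "C * d < \<epsilon>" using \<open>0 < \<epsilon>\<close> \<open>0 \<le> C\<close> by (auto simp: d_def field_simps)
    obtain b where b: "b \<in> haar_span" "me (\<lambda>R. f R - b R) < ennreal d"
      using f d(1) by (auto simp: hardy_def)
    have "L (\<lambda>R. f R - b R) = (\<lambda>R. L f R - L b R)"
      using add[of f "\<lambda>R. -1 * b R"] cmult[of "-1" b] by simp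
    then have "me (\<lambda>R. L f R - L b R) \<le> ennreal C * me (\<lambda>R. f R - b R)" using le by metis
    also have "\<dots> \<le> ennreal C * ennreal d" using b(2) by (intro mult_left_mono) auto
    also have "\<dots> = ennreal (C * d)" using d \<open>0 \<le> C\<close> by (simp add: ennreal_mult)
    also have "\<dots> < ennreal \<epsilon>" using d \<open>0 \<le> C\<close> \<open>0 < \<epsilon>\<close> by (intro ennreal_lessI) auto
    finally show "\<exists>e\<in>H. me (\<lambda>R. L f R - e R) < ennreal \<epsilon>" using span_subset_H[OF span[OF b(1)]] by auto
  qed (rule off[OF f])
  have "hn (L f) \<le> C * hn f" if "f \<in> H" for f
    using le[of f] H_me[OF that] \<open>0 \<le> C\<close> by (intro hn_leI) (auto simp: ennreal_mult)
  then show ?thesis using LH \<open>0 \<le> C\<close> add cmult by (simp add: op_bound_def)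
qed

text \<open>The powers of \<open>- E\<close> are summed coefficient by coefficient. Convergence in
  norm comes from \<open>me_Fatou\<close> applied to the tails and membership of the sum from
  \<open>HI\<close>, so completeness enters only through these two facts.\<close>

lemma Neumann:
  assumes E: "op_bound E \<epsilon>" and "\<epsilon> < 1"
  shows "\<exists>V. op_bound V (1 / (1 - \<epsilon>)) \<and> (\<forall>f\<in>H. V (\<lambda>R. f R + E f R) = f)"
proof -
  define F where "F f = (\<lambda>R. - E f R)" for f
  have F: "op_bound F \<epsilon>"
    using op_boundD[OF E] by (auto simp: op_bound_def F_def H_uminus hn_uminus algebra_simps)
  have e0: "0 \<le> \<epsilon>" by (rule op_boundD(1)[OF E])
  define G where "G n = F ^^ n" for n
  have G: "op_bound (G n) (\<epsilon> ^ n)" for n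
  proof (induction n)
    case 0
    then show ?case by (simp add: op_bound_def G_def)
  next
    case (Suc n)
    from op_comp[OF F this] show ?case by (simp add: G_def comp_def)
  qed
  have GH: "G n f \<in> H" if "f \<in> H" for n f using op_boundD(2)[OF G that] .
  define V where "V f = (\<lambda>R. \<Sum>n. G n f R)" for f
  have Gle: "\<bar>G n f R\<bar> \<le> hn f / area R * \<epsilon> ^ n" if "f \<in> H" "R \<in> dyadic_rects" for f n R
  proof -
    have "\<bar>G n f R\<bar> * area R \<le> \<epsilon> ^ n * hn f"
      using coeff_le_hn[OF GH[OF that(1)] that(2)] op_boundD(3)[OF G that(1)] by (rule order_trans)
    then show ?thesis using area_pos[OF that(2)] by (simp add: field_simps)
  qed
  have geo: "summable (\<lambda>n. \<epsilon> ^ n)" using e0 \<open>\<epsilon> < 1\<close> by (intro summable_geometric) auto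
  have summable: "summable (\<lambda>n. G n f R)" if "f \<in> H" for f R
  proof (cases "R \<in> dyadic_rects")
    case True
    show ?thesis
      by (rule summable_comparison_test'[OF summable_mult[OF geo, of "hn f / area R"], of 0]) (use Gle[OF that True] in simp)
  qed (simp add: H_off[OF GH[OF that]])
  \<comment> \<open>Each coefficient of the tail is a limit over finite sections of the series, and
    these obey the geometric bound.\<close>
  have tail: "me (\<lambda>R. V f R - (\<Sum>n<N. G n f R)) \<le> ennreal (\<epsilon> ^ N * (1 / (1 - \<epsilon>)) * hn f)" if f: "f \<in> H" for f N
  proof (rule me_Fatou)
    fix M
    have "hn (\<lambda>R. \<Sum>n\<in>{N..<N+M}. G n f R) \<le> (\<Sum>n\<in>{N..<N+M}. hn (G n f))"
      using GH[OF f] by (intro hn_sum) auto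
    also have "\<dots> \<le> (\<Sum>n\<in>{N..<N+M}. \<epsilon> ^ n * hn f)"
      by (intro sum_mono op_boundD(3)[OF G f])
    also have "\<dots> = (\<Sum>n<M. \<epsilon> ^ (n + N)) * hn f"
      by (simp add: sum_distrib_right sum.shift_bounds_nat_ivl[of _ 0 N M, simplified] lessThan_atLeast0 add.commute)
    also have "(\<Sum>n<M. \<epsilon> ^ (n + N)) = \<epsilon> ^ N * (\<Sum>n<M. \<epsilon> ^ n)" by (simp add: sum_distrib_left power_add mult.commute)
    also have "(\<Sum>n<M. \<epsilon> ^ n) \<le> (\<Sum>n. \<epsilon> ^ n)" using e0 by (intro sum_le_suminf geo) auto
    also have "(\<Sum>n. \<epsilon> ^ n) = 1 / (1 - \<epsilon>)" using e0 \<open>\<epsilon> < 1\<close> by (intro suminf_geometric) auto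
    finally have "hn (\<lambda>R. \<Sum>n\<in>{N..<N+M}. G n f R) \<le> \<epsilon> ^ N * (1 / (1 - \<epsilon>)) * hn f"
      using e0 by (simp add: mult_left_mono mult_right_mono)
    moreover have "(\<lambda>R. \<Sum>n\<in>{N..<N+M}. G n f R) \<in> H" using GH[OF f] by (intro H_sum) auto
    ultimately show "me (\<lambda>R. \<Sum>n\<in>{N..<N+M}. G n f R) \<le> ennreal (\<epsilon> ^ N * (1 / (1 - \<epsilon>)) * hn f)"
      using H_me by (simp add: ennreal_leI)
  next
    fix R
    have "(\<lambda>M. (\<Sum>n<M + N. G n f R) - (\<Sum>n<N. G n f R)) \<longlonglongrightarrow> V f R - (\<Sum>n<N. G n f R)"
      unfolding V_def by (intro tendsto_diff tendsto_const LIMSEQ_ignore_initial_segment summable_LIMSEQ summable[OF f])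
    moreover have "(\<Sum>n<M + N. G n f R) - (\<Sum>n<N. G n f R) = (\<Sum>n\<in>{N..<N+M}. G n f R)" for M
      using sum.atLeastLessThan_concat[of 0 N "N + M" "\<lambda>n. G n f R"] by (simp add: lessThan_atLeast0 add.commute)
    ultimately show "(\<lambda>M. \<Sum>n\<in>{N..<N+M}. G n f R) \<longlonglongrightarrow> V f R - (\<Sum>n<N. G n f R)" by simp
  qed
  have VH: "V f \<in> H" if f: "f \<in> H" for f
  proof (rule HI)
    fix d :: real assume "0 < d"
    have "(\<lambda>N. \<epsilon> ^ N * (1 / (1 - \<epsilon>)) * hn f) \<longlonglongrightarrow> 0 * (1 / (1 - \<epsilon>)) * hn f"
      using e0 \<open>\<epsilon> < 1\<close> by (intro tendsto_intros LIMSEQ_power_zero) auto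
    then have "(\<lambda>N. \<epsilon> ^ N * (1 / (1 - \<epsilon>)) * hn f) \<longlonglongrightarrow> 0" by simp
    from order_tendstoD(2)[OF this \<open>0 < d\<close>] obtain N where N: "\<epsilon> ^ N * (1 / (1 - \<epsilon>)) * hn f < d"
      by (auto simp: eventually_sequentially)
    have "me (\<lambda>R. V f R - (\<Sum>n<N. G n f R)) < ennreal d"
      using tail[OF f, of N] ennreal_lessI[OF \<open>0 < d\<close> N] by (rule le_less_trans)
    then show "\<exists>b\<in>H. me (\<lambda>R. V f R - b R) < ennreal d"
      using H_sum[of "{..<N}" "\<lambda>n. G n f"] GH[OF f] by auto
  qed (simp add: V_def H_off[OF GH[OF f]])
  have Vle: "hn (V f) \<le> 1 / (1 - \<epsilon>) * hn f" if "f \<in> H" for f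
    using tail[OF that, of 0] \<open>\<epsilon> < 1\<close> by (intro hn_leI) auto
  have Vadd: "V (\<lambda>R. f R + g R) = (\<lambda>R. V f R + V g R)" if "f \<in> H" "g \<in> H" for f g
    using suminf_add[OF summable[OF that(1)] summable[OF that(2)]] by (simp add: V_def op_boundD(4)[OF G that])
  have Vcmult: "V (\<lambda>R. c * f R) = (\<lambda>R. c * V f R)" if "f \<in> H" for f c
    using suminf_mult[OF summable[OF that]] by (simp add: V_def op_boundD(5)[OF G that])
  have op: "op_bound V (1 / (1 - \<epsilon>))"
    using \<open>\<epsilon> < 1\<close> VH Vle Vadd Vcmult by (simp add: op_bound_def)
  have "V (\<lambda>R. f R + E f R) = f" if f: "f \<in> H" for f
  proof
    fix R
    \<comment> \<open>Since \<open>f + E f\<close> is \<open>f - F f\<close>, the series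
      telescopes.\<close>
    have "G n (\<lambda>R. f R + E f R) R = G n f R - G (Suc n) f R" for n
    proof -
      have Ff: "F f \<in> H" by (rule op_boundD(2)[OF F f])
      have "(\<lambda>R. f R + E f R) = (\<lambda>R. f R - F f R)" by (simp add: F_def)
      moreover have "G (Suc n) f = G n (F f)" by (simp only: G_def funpow_Suc_right comp_def)
      ultimately show ?thesis using op_diff[OF G f Ff, of n] by simp
    qed
    moreover have "(\<lambda>n. G n f R - G (Suc n) f R) sums (G 0 f R - 0)"
      by (rule telescope_sums'[OF summable_LIMSEQ_zero[OF summable[OF f]]])
    ultimately show "V (\<lambda>R. f R + E f R) R = f R"
      by (simp add: V_def sums_iff G_def)
  qed
  with op show ?thesis by blast
qed

text \<open>As \<open>\<bar>b R\<bar> * area R \<le> hn b\<close>, the weights turn the triangle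
  inequality on finite series into the constant \<open>\<epsilon>\<close>; the crude bound
  \<open>K\<close> serves only to pass to limits by density.\<close>

lemma op_bound_from_units:
  assumes E: "op_bound E K" and "0 \<le> \<epsilon>"
    and w: "\<And>R. 0 \<le> w R" "\<And>F. finite F \<Longrightarrow> F \<subseteq> dyadic_rects \<Longrightarrow> sum w F \<le> 1"
    and unit: "\<And>R. R \<in> dyadic_rects \<Longrightarrow> hn (E (haar_unit R)) \<le> \<epsilon> * area R * w R"
  shows "op_bound E \<epsilon>"
proof -
  have span: "hn (E b) \<le> \<epsilon> * hn b" if b: "b \<in> haar_span" for b
  proof -
    let ?F = "{R. b R \<noteq> 0}"
    have F: "finite ?F" "?F \<subseteq> dyadic_rects" using b by (auto simp: haar_span_def)
    have bH: "b \<in> H" by (rule span_subset_H[OF b])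
    have "E b = (\<lambda>Q. \<Sum>R\<in>?F. b R * E (haar_unit R) Q)"
      by (subst span_expand[OF b], rule op_sum[OF E F(1)]) (use F unit_H in auto)
    then have "hn (E b) \<le> (\<Sum>R\<in>?F. hn (\<lambda>Q. b R * E (haar_unit R) Q))"
      using F unit_H by (simp only:) (intro hn_sum H_cmult op_boundD(2)[OF E], auto)
    also have "\<dots> \<le> (\<Sum>R\<in>?F. \<epsilon> * hn b * w R)"
    proof (rule sum_mono)
      fix R assume "R \<in> ?F"
      then have R: "R \<in> dyadic_rects" using F by auto
      have "\<bar>b R\<bar> * hn (E (haar_unit R)) \<le> \<bar>b R\<bar> * (\<epsilon> * area R * w R)"
        by (intro mult_left_mono unit R) simp
      also have "\<dots> = \<epsilon> * (\<bar>b R\<bar> * area R) * w R" by simp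
      also have "\<dots> \<le> \<epsilon> * hn b * w R"
        using \<open>0 \<le> \<epsilon>\<close> w by (intro mult_left_mono mult_right_mono coeff_le_hn[OF bH R]) auto
      finally show "hn (\<lambda>Q. b R * E (haar_unit R) Q) \<le> \<epsilon> * hn b * w R" by (simp add: hn_cmult)
    qed
    also have "\<dots> = \<epsilon> * hn b * sum w ?F" by (simp add: sum_distrib_left)
    also have "\<dots> \<le> \<epsilon> * hn b * 1" using \<open>0 \<le> \<epsilon>\<close> by (intro mult_left_mono w(2) F) auto
    finally show ?thesis by simp
  qed
  have K: "0 \<le> K" by (rule op_boundD(1)[OF E])
  have "hn (E f) \<le> \<epsilon> * hn f" if f: "f \<in> H" for f
  proof (rule field_le_epsilon)
    fix d :: real assume "0 < d"
    define d' where "d' = d / (\<epsilon> + K + 1)"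
    have pos: "0 < \<epsilon> + K + 1" using K \<open>0 \<le> \<epsilon>\<close> by simp
    have d': "0 < d'" "(\<epsilon> + K) * d' \<le> d" using \<open>0 < d\<close> pos by (auto simp: d'_def field_simps)
    obtain b where b: "b \<in> haar_span" "hn (\<lambda>R. f R - b R) < d'" using H_approx[OF f d'(1)] .
    have bH: "b \<in> H" by (rule span_subset_H[OF b(1)])
    have diffH: "(\<lambda>R. f R - b R) \<in> H" "(\<lambda>R. b R - f R) \<in> H" using f bH by (auto intro: H_diff)
    have "hn (\<lambda>R. b R - f R) = hn (\<lambda>R. f R - b R)" using hn_uminus[of "\<lambda>R. f R - b R"] by simp
    then have hb: "hn b \<le> hn f + d'" using hn_add[OF f diffH(2)] b(2) by simp
    have "hn (E f) = hn (\<lambda>R. E b R + E (\<lambda>R. f R - b R) R)"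
      using op_boundD(4)[OF E bH diffH(1)] by (simp add: op_diff[OF E f bH])
    also have "\<dots> \<le> hn (E b) + hn (E (\<lambda>R. f R - b R))"
      by (intro hn_add op_boundD(2)[OF E] bH diffH)
    also have "\<dots> \<le> \<epsilon> * (hn f + d') + K * d'"
    proof (rule add_mono)
      show "hn (E b) \<le> \<epsilon> * (hn f + d')"
        using span[OF b(1)] mult_left_mono[OF hb \<open>0 \<le> \<epsilon>\<close>] by (rule order_trans)
      show "hn (E (\<lambda>R. f R - b R)) \<le> K * d'"
        using op_boundD(3)[OF E diffH(1)] mult_left_mono[OF less_imp_le[OF b(2)] K] by (rule order_trans)
    qed
    also have "\<dots> \<le> \<epsilon> * hn f + d" using d' by (simp add: algebra_simps)
    finally show "hn (E f) \<le> \<epsilon> * hn f + d" .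
  qed
  then show ?thesis using E \<open>0 \<le> \<epsilon>\<close> by (simp add: op_bound_def)
qed

text \<open>The norm is monotone in the moduli of the coefficients.\<close>

lemma op_multiplier:
  assumes "0 \<le> C" "\<And>R. R \<in> dyadic_rects \<Longrightarrow> \<bar>c R\<bar> \<le> C"
  shows "op_bound (\<lambda>f R. c R * f R) C"
proof (rule coefficientwise_op_bound)
  fix f
  have "me (\<lambda>R. c R * f R) \<le> me (\<lambda>R. C * f R)"
    using assms by (intro me_mono) (auto simp: abs_mult intro!: mult_right_mono)
  then show "me (\<lambda>R. c R * f R) \<le> ennreal C * me f" using assms(1) by (simp add: me_cmult)
next
  fix b assume b: "b \<in> haar_span"
  have "{R. c R * b R \<noteq> 0} \<subseteq> {R. b R \<noteq> 0}" by auto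
  then show "(\<lambda>R. c R * b R) \<in> haar_span" using b finite_subset by (fastforce simp: haar_span_def)
qed (auto simp: algebra_simps H_off assms(1))

text \<open>Dividing by the diagonal gives the identity plus an operator \<open>E\<close> with zero
  diagonal, and the factor \<open>\<delta>\<close> in the tolerance pays for this division. The
  weight \<open>w Q\<close> makes the coefficients of one image summable;
  \<open>area R * w R\<close> does the same for the images of all Haar functions.\<close>

lemma almost_diagonal_left_inverse:
  assumes U: "op_bound U K" and "0 < \<delta>" "0 \<le> \<epsilon>" "\<epsilon> < 1"
    and w: "\<And>R. 0 \<le> w R" "\<And>F. finite F \<Longrightarrow> F \<subseteq> dyadic_rects \<Longrightarrow> sum w F \<le> 1"
    and diag: "\<And>R. R \<in> dyadic_rects \<Longrightarrow> \<delta> \<le> U (haar_unit R) R"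
    and off: "\<And>R Q. R \<in> dyadic_rects \<Longrightarrow> Q \<in> dyadic_rects \<Longrightarrow> Q \<noteq> R \<Longrightarrow>
      \<bar>U (haar_unit R) Q\<bar> \<le> \<epsilon> * \<delta> * area R * w R * w Q"
  shows "\<exists>S. op_bound S (1 / (\<delta> * (1 - \<epsilon>))) \<and> (\<forall>f\<in>H. S (U f) = f)"
proof -
  define u where "u R = U (haar_unit R) R" for R
  have u: "\<delta> \<le> u R" "0 < u R" if "R \<in> dyadic_rects" for R
    using diag[OF that] \<open>0 < \<delta>\<close> by (auto simp: u_def)
  define D where "D = (\<lambda>f R. (1 / u R) * f R :: real)"
  have D: "op_bound D (1 / \<delta>)"
    unfolding D_def
  proof (rule op_multiplier)
    show "\<bar>1 / u R\<bar> \<le> 1 / \<delta>" if "R \<in> dyadic_rects" for R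
      using u[OF that] \<open>0 < \<delta>\<close> by (simp add: frac_le)
  qed (use \<open>0 < \<delta>\<close> in simp)
  define E where "E f = (\<lambda>R. D (U f) R - f R)" for f
  have DU: "op_bound (\<lambda>f. D (U f)) (1 / \<delta> * K)" by (rule op_comp[OF D U])
  have "op_bound E (1 / \<delta> * K + 1)"
    unfolding op_bound_def
  proof (intro conjI ballI allI)
    fix f assume f: "f \<in> H"
    show "E f \<in> H" unfolding E_def by (intro H_diff op_boundD(2)[OF DU] f)
    show "hn (E f) \<le> (1 / \<delta> * K + 1) * hn f"
      using hn_diff[OF op_boundD(2)[OF DU f] f] op_boundD(3)[OF DU f] by (simp add: E_def algebra_simps)
    show "E (\<lambda>R. c * f R) = (\<lambda>R. c * E f R)" for c
      unfolding E_def op_boundD(5)[OF DU f] by (simp add: algebra_simps)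
    show "E (\<lambda>R. f R + g R) = (\<lambda>R. E f R + E g R)" if "g \<in> H" for g
      unfolding E_def op_boundD(4)[OF DU f that] by (simp add: algebra_simps)
  qed (use op_boundD(1)[OF DU] in simp)
  then have "op_bound E \<epsilon>"
  proof (rule op_bound_from_units[where w = w])
    fix R assume R: "R \<in> dyadic_rects"
    have "me (E (haar_unit R)) \<le> ennreal (\<epsilon> * area R * w R)"
    proof (rule me_le_restr)
      fix F assume F: "finite F" "F \<subseteq> dyadic_rects"
      have "me (restr F (E (haar_unit R))) \<le> ennreal (\<Sum>Q\<in>F. \<bar>E (haar_unit R) Q\<bar>)"
        using F by (rule me_restr_le_sum)
      also have "\<dots> \<le> ennreal (\<Sum>Q\<in>F. \<epsilon> * area R * w R * w Q)"
      proof (intro ennreal_leI sum_mono)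
        fix Q assume "Q \<in> F"
        then have Q: "Q \<in> dyadic_rects" using F by auto
        show "\<bar>E (haar_unit R) Q\<bar> \<le> \<epsilon> * area R * w R * w Q"
        proof (cases "Q = R")
          case True
          then show ?thesis using u[OF R] \<open>0 \<le> \<epsilon>\<close> w(1) area_pos[OF R]
            by (simp add: E_def D_def u_def[symmetric])
        next
          case False
          have "\<bar>E (haar_unit R) Q\<bar> = \<bar>U (haar_unit R) Q\<bar> / u Q"
            using False u[OF Q] by (simp add: E_def D_def abs_mult)
          also have "\<dots> \<le> \<bar>U (haar_unit R) Q\<bar> / \<delta>"
            using u[OF Q] \<open>0 < \<delta>\<close> by (intro divide_left_mono) auto
          also have "\<dots> \<le> (\<epsilon> * \<delta> * area R * w R * w Q) / \<delta>"
            using \<open>0 < \<delta>\<close> by (intro divide_right_mono off R Q False) simp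
          finally show ?thesis using \<open>0 < \<delta>\<close> by simp
        qed
      qed
      also have "\<dots> \<le> ennreal (\<epsilon> * area R * w R)"
      proof (rule ennreal_leI)
        have "(\<Sum>Q\<in>F. \<epsilon> * area R * w R * w Q) = \<epsilon> * area R * w R * sum w F" by (simp add: sum_distrib_left)
        also have "\<dots> \<le> \<epsilon> * area R * w R * 1"
          using \<open>0 \<le> \<epsilon>\<close> area_pos[OF R] w(1) by (intro mult_left_mono w(2) F mult_nonneg_nonneg) auto
        finally show "(\<Sum>Q\<in>F. \<epsilon> * area R * w R * w Q) \<le> \<epsilon> * area R * w R" by simp
      qed
      finally show "me (restr F (E (haar_unit R))) \<le> ennreal (\<epsilon> * area R * w R)" .
    qed
    then show "hn (E (haar_unit R)) \<le> \<epsilon> * area R * w R"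
      using \<open>0 \<le> \<epsilon>\<close> area_pos[OF R] w(1) by (intro hn_leI mult_nonneg_nonneg) auto
  qed (use assms in auto)
  from Neumann[OF this \<open>\<epsilon> < 1\<close>] obtain V where V: "op_bound V (1 / (1 - \<epsilon>))"
    and inv: "\<And>f. f \<in> H \<Longrightarrow> V (\<lambda>R. f R + E f R) = f" by blast
  have "V (D (U f)) = f" if "f \<in> H" for f using inv[OF that] by (simp add: E_def)
  moreover have "op_bound (\<lambda>f. V (D f)) (1 / (1 - \<epsilon>) * (1 / \<delta>))" by (rule op_comp[OF V D])
  ultimately show ?thesis by (intro exI[of _ "\<lambda>f. V (D f)"]) (simp add: mult.commute)
qed

end

section \<open>Boundedness of the block operators on the Hardy space\<close>

context block_system
begin

lemma spread_op_bound:
  assumes "\<And>Q. \<bar>e Q\<bar> \<le> 1" shows "op_bound (spread e) 1"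
proof (rule coefficientwise_op_bound)
  show "me (spread e f) \<le> ennreal 1 * me f" for f using me_spread_le[OF assms] by simp
  fix b assume b: "b \<in> haar_span"
  have "{Q. spread e b Q \<noteq> 0} \<subseteq> (\<Union>R\<in>{R. b R \<noteq> 0}. BB R)"
  proof
    fix Q assume Q: "Q \<in> {Q. spread e b Q \<noteq> 0}"
    then obtain R where R: "R \<in> dyadic_rects" "Q \<in> BB R" using spread_nonzeroE by blast
    then have "b R \<noteq> 0" using Q by (simp add: spread_eq)
    with R show "Q \<in> (\<Union>R\<in>{R. b R \<noteq> 0}. BB R)" by blast
  qed
  moreover have "finite (\<Union>R\<in>{R. b R \<noteq> 0}. BB R)"
    using b by (auto simp: haar_span_def BB_def)
  moreover have "(\<Union>R\<in>{R. b R \<noteq> 0}. BB R) \<subseteq> dyadic_rects"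
    unfolding BB_def by (intro UN_least rect_block_subset)
  ultimately show "spread e b \<in> haar_span" unfolding haar_span_def using finite_subset by blast
next
  fix f Q assume "Q \<notin> dyadic_rects"
  then show "spread e f Q = 0" using rect_block_subset spread_nonzeroE by (metis BB_def subsetD)
qed (auto simp: spread_def sum.distrib algebra_simps sum_distrib_left fun_eq_iff)

lemma collect_op_bound:
  assumes "\<And>Q. \<bar>\<sigma> Q\<bar> \<le> 1" shows "op_bound (collect \<sigma>) 1"
proof (rule coefficientwise_op_bound)
  show "me (collect \<sigma> f) \<le> ennreal 1 * me f" for f using me_collect_le[OF assms] by simp
  fix b assume b: "b \<in> haar_span"
  have "{R. collect \<sigma> b R \<noteq> 0} \<subseteq> (\<Union>Q\<in>{Q. b Q \<noteq> 0}. {R \<in> dyadic_rects. Q \<in> BB R})"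
  proof
    fix R assume R: "R \<in> {R. collect \<sigma> b R \<noteq> 0}"
    then have RD: "R \<in> dyadic_rects" by (auto simp: collect_def split: if_splits)
    have "\<exists>Q\<in>BB R. b Q \<noteq> 0"
    proof (rule ccontr)
      assume "\<not> ?thesis"
      then have "avg (BB R) (\<lambda>Q. \<sigma> Q * b Q) = 0" by (simp add: avg_def)
      with R RD show False by (simp add: collect_def)
    qed
    then show "R \<in> (\<Union>Q\<in>{Q. b Q \<noteq> 0}. {R \<in> dyadic_rects. Q \<in> BB R})" using RD by blast
  qed
  moreover have "finite {R \<in> dyadic_rects. Q \<in> BB R}" for Q
  proof (cases "{R \<in> dyadic_rects. Q \<in> BB R} = {}")
    case False
    then obtain R where "R \<in> dyadic_rects" "Q \<in> BB R" by blast
    then have "{R \<in> dyadic_rects. Q \<in> BB R} = {R}" using BB_unique by blast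
    then show ?thesis by simp
  qed (simp only: finite.emptyI)
  ultimately have "finite {R. collect \<sigma> b R \<noteq> 0}"
    using span_finite[OF b] by (meson finite_UN_I finite_subset)
  then show "collect \<sigma> b \<in> haar_span" by (auto simp: haar_span_def collect_def)
qed (auto simp: collect_def avg_add[symmetric] avg_cmult[symmetric] algebra_simps fun_eq_iff)

lemma spread_unit:
  assumes "R \<in> dyadic_rects" shows "spread e (haar_unit R) = (\<lambda>Q. if Q \<in> BB R then e Q else 0)"
proof
  fix Q
  show "spread e (haar_unit R) Q = (if Q \<in> BB R then e Q else 0)"
  proof (cases "\<exists>R'\<in>dyadic_rects. Q \<in> BB R'")
    case True
    then obtain R' where R': "R' \<in> dyadic_rects" "Q \<in> BB R'" by blast
    then show ?thesis using BB_unique[OF assms R'(1) _ R'(2)] by (auto simp: spread_eq haar_unit_def)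
  next
    case False
    then show ?thesis using assms spread_nonzeroE by metis
  qed
qed

end

section \<open>Frequencies and selection of small blocks\<close>

text \<open>Greedy choice: the new sign is that of the total cross term with the earlier elements,
  so every element adds at least its diagonal entry.\<close>

lemma exists_signs:
  fixes X :: "'a \<Rightarrow> 'a \<Rightarrow> real"
  assumes "finite B" "\<And>Q. Q \<in> B \<Longrightarrow> \<delta> \<le> X Q Q"
  shows "\<exists>e. (\<forall>Q. \<bar>e Q\<bar> = 1) \<and> \<delta> * card B \<le> (\<Sum>Q\<in>B. \<Sum>Q'\<in>B. e Q * e Q' * X Q Q')"
  using assms
proof (induction B rule: finite_induct)
  case empty
  then show ?case by (intro exI[of _ "\<lambda>_. 1"]) simp
next
  case (insert P B)
  then obtain e where e: "\<And>Q. \<bar>e Q\<bar> = 1" "\<delta> * card B \<le> (\<Sum>Q\<in>B. \<Sum>Q'\<in>B. e Q * e Q' * X Q Q')" by auto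
  define c where "c = (\<Sum>Q\<in>B. e Q * (X Q P + X P Q))"
  define s :: real where "s = (if 0 \<le> c then 1 else -1)"
  have s: "\<bar>s\<bar> = 1" "s * s = 1" "0 \<le> s * c" by (auto simp: s_def)
  define e' where "e' = e(P := s)"
  have e'B: "e' Q = e Q" if "Q \<in> B" for Q using that insert.hyps by (auto simp: e'_def)
  have e'P: "e' P = s" by (simp add: e'_def)
  have "(\<Sum>Q\<in>insert P B. \<Sum>Q'\<in>insert P B. e' Q * e' Q' * X Q Q') =
    s * s * X P P + (\<Sum>Q'\<in>B. s * e Q' * X P Q') + ((\<Sum>Q\<in>B. e Q * s * X Q P) + (\<Sum>Q\<in>B. \<Sum>Q'\<in>B. e Q * e Q' * X Q Q'))"
    using insert.hyps by (simp add: e'B e'P sum.distrib)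
  also have "(\<Sum>Q'\<in>B. s * e Q' * X P Q') = s * (\<Sum>Q\<in>B. e Q * X P Q)" by (simp add: sum_distrib_left mult.assoc)
  also have "(\<Sum>Q\<in>B. e Q * s * X Q P) = s * (\<Sum>Q\<in>B. e Q * X Q P)" by (simp add: sum_distrib_left mult_ac)
  also have "s * s * X P P + s * (\<Sum>Q\<in>B. e Q * X P Q) + (s * (\<Sum>Q\<in>B. e Q * X Q P) + (\<Sum>Q\<in>B. \<Sum>Q'\<in>B. e Q * e Q' * X Q Q')) =
    X P P + s * c + (\<Sum>Q\<in>B. \<Sum>Q'\<in>B. e Q * e Q' * X Q Q')"
    using s(2) by (simp add: c_def algebra_simps sum.distrib)
  finally have "\<delta> * card (insert P B) \<le> (\<Sum>Q\<in>insert P B. \<Sum>Q'\<in>insert P B. e' Q * e' Q' * X Q Q')"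
    using insert.prems[of P] insert.hyps e(2) s(3) by (simp add: algebra_simps)
  then show ?case using e(1) s(1) by (intro exI[of _ e']) (auto simp: e'_def)
qed

text \<open>Provides the order of the selection: smaller levels come first, so the digits needed for
  a level are settled before its rectangles are treated.\<close>

lemma exists_rank:
  fixes lev :: "'a \<Rightarrow> nat"
  assumes fin: "\<And>n. finite {x \<in> D. lev x = n}"
  shows "\<exists>rk \<tau> :: nat \<Rightarrow> nat. inj_on rk D \<and> strict_mono \<tau> \<and> (\<forall>x\<in>D. \<tau> (lev x) \<le> rk x \<and> rk x < \<tau> (Suc (lev x)))"
proof -
  define L where "L n = {x \<in> D. lev x = n}" for n
  have "\<forall>n. \<exists>h. bij_betw h (L n) {0..<card (L n)}"
    using ex_bij_betw_finite_nat[OF fin] by (simp add: L_def)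
  then obtain h where h: "\<And>n. bij_betw (h n) (L n) {0..<card (L n)}" by metis
  \<comment> \<open>The \<open>Suc\<close> keeps \<open>\<tau>\<close> strictly increasing across
    empty levels, at the price of one rank per level that belongs to no element.\<close>
  define \<tau> where "\<tau> n = (\<Sum>m<n. Suc (card (L m)))" for n
  have \<tau>: "strict_mono \<tau>" by (rule strict_mono_Suc_iff[THEN iffD2]) (simp add: \<tau>_def)
  define rk where "rk x = \<tau> (lev x) + h (lev x) x" for x
  have bnd: "\<tau> (lev x) \<le> rk x \<and> rk x < \<tau> (Suc (lev x))" if "x \<in> D" for x
  proof -
    have "h (lev x) x \<in> {0..<card (L (lev x))}" using bij_betwE[OF h] that by (auto simp: L_def)
    then show ?thesis by (simp add: rk_def \<tau>_def)
  qed
  have "inj_on rk D"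
  proof (rule inj_onI)
    fix x y assume xy: "x \<in> D" "y \<in> D" "rk x = rk y"
    have lev: "lev x = lev y"
    proof (rule ccontr)
      assume "lev x \<noteq> lev y"
      then have "Suc (lev x) \<le> lev y \<or> Suc (lev y) \<le> lev x" by linarith
      then have "\<tau> (Suc (lev x)) \<le> \<tau> (lev y) \<or> \<tau> (Suc (lev y)) \<le> \<tau> (lev x)"
        using monoD[OF strict_mono_mono[OF \<tau>]] by blast
      then show False using bnd[OF xy(1)] bnd[OF xy(2)] xy(3) by linarith
    qed
    then have "h (lev x) x = h (lev x) y" using xy(3) by (simp add: rk_def)
    moreover have "x \<in> L (lev x)" "y \<in> L (lev x)" using xy lev by (auto simp: L_def)
    ultimately show "x = y" using bij_betw_imp_inj_on[OF h] by (meson inj_onD)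
  qed
  with \<tau> bnd show ?thesis by blast
qed

section \<open>Levels of rectangles and shapes of blocks\<close>

definition lev1 :: "rect \<Rightarrow> nat" where
  "lev1 R = (THE k. \<exists>s l t. s \<subseteq> {..<k} \<and> t \<subseteq> {..<l} \<and> R = drect k s l t)"

definition lev2 :: "rect \<Rightarrow> nat" where
  "lev2 R = (THE l. \<exists>k s t. s \<subseteq> {..<k} \<and> t \<subseteq> {..<l} \<and> R = drect k s l t)"

lemma lev1_drect: "s \<subseteq> {..<k} \<Longrightarrow> t \<subseteq> {..<l} \<Longrightarrow> lev1 (drect k s l t) = k"
  unfolding lev1_def by (rule the_equality) (use drect_eq_iff in blast)+

lemma lev2_drect: "s \<subseteq> {..<k} \<Longrightarrow> t \<subseteq> {..<l} \<Longrightarrow> lev2 (drect k s l t) = l"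
  unfolding lev2_def by (rule the_equality) (use drect_eq_iff in blast)+

definition lev :: "rect \<Rightarrow> nat" where "lev R = max (lev1 R) (lev2 R)"

lemma finite_lev: "finite {R \<in> dyadic_rects. lev R = n}"
proof (rule finite_subset)
  show "{R \<in> dyadic_rects. lev R = n} \<subseteq> rects_upto n"
  proof
    fix R assume "R \<in> {R \<in> dyadic_rects. lev R = n}"
    then have R: "R \<in> dyadic_rects" "lev R = n" by auto
    from R(1) obtain k s l t where "R = drect k s l t" "s \<subseteq> {..<k}" "t \<subseteq> {..<l}" by (rule drect_cases)
    then show "R \<in> rects_upto n" using R(2) by (auto simp: lev_def lev1_drect lev2_drect drect_mem_upto_iff)
  qed
qed simp

text \<open>For increasing \<open>\<mu>\<close>, the least level that resolves the positions
  \<open>\<mu> 0, ..., \<mu> (l - 1)\<close>; for \<open>l = 0\<close> the side is the whole unit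
  interval.\<close>

definition min_freq :: "(nat \<Rightarrow> nat) \<Rightarrow> nat \<Rightarrow> nat" where
  "min_freq \<mu> l = (case l of 0 \<Rightarrow> 0 | Suc j \<Rightarrow> Suc (\<mu> j))"

text \<open>The fresh frequency \<open>N\<close> goes to the side of larger level, the first one in
  case of a tie. In use it exceeds every \<open>\<mu> i\<close> with \<open>i < lev R\<close>, so on
  a side of smaller level it would resolve digits which that side must not see.\<close>

definition shape1 :: "(nat \<Rightarrow> nat) \<Rightarrow> nat \<Rightarrow> rect \<Rightarrow> nat" where
  "shape1 \<mu> N R = (if lev2 R \<le> lev1 R then N else min_freq \<mu> (lev1 R))"

definition shape2 :: "(nat \<Rightarrow> nat) \<Rightarrow> nat \<Rightarrow> rect \<Rightarrow> nat" where
  "shape2 \<mu> N R = (if lev2 R \<le> lev1 R then min_freq \<mu> (lev2 R) else N)"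

definition freq_block :: "(nat \<Rightarrow> nat) \<Rightarrow> nat \<Rightarrow> rect \<Rightarrow> rect set" where
  "freq_block \<mu> N R = rect_block \<mu> (shape1 \<mu> N R) (shape2 \<mu> N R) R"

lemma min_freq_cong: "(\<And>i. i < l \<Longrightarrow> \<mu> i = \<nu> i) \<Longrightarrow> min_freq \<mu> l = min_freq \<nu> l"
  by (cases l) (auto simp: min_freq_def)

lemma less_min_freq: "strict_mono_on {..<n} \<mu> \<Longrightarrow> l \<le> n \<Longrightarrow> i < l \<Longrightarrow> \<mu> i < min_freq \<mu> l"
  by (cases l) (auto simp: min_freq_def less_Suc_eq strict_mono_on_def less_Suc_eq_le le_less)

text \<open>Only digits settled before \<open>R\<close> matter, which makes the recursive choice of
  the frequencies well defined.\<close>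

lemma freq_block_cong:
  assumes R: "R \<in> dyadic_rects" and eq: "\<And>i. i < lev R \<Longrightarrow> \<mu> i = \<nu> i"
  shows "freq_block \<mu> N R = freq_block \<nu> N R"
proof -
  from R obtain k s l t where Req: "R = drect k s l t" and st: "s \<subseteq> {..<k}" "t \<subseteq> {..<l}" by (rule drect_cases)
  have eq: "\<mu> i = \<nu> i" if "i < k \<or> i < l" for i
    using eq[of i] that by (auto simp: lev_def Req lev1_drect[OF st] lev2_drect[OF st])
  have "min_freq \<mu> k = min_freq \<nu> k" "min_freq \<mu> l = min_freq \<nu> l" by (rule min_freq_cong, simp add: eq)+
  then have sh: "shape1 \<mu> N R = shape1 \<nu> N R" "shape2 \<mu> N R = shape2 \<nu> N R"
    by (auto simp: shape1_def shape2_def Req lev1_drect[OF st] lev2_drect[OF st])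
  have "read_digits \<mu> k u = read_digits \<nu> k u" "read_digits \<mu> l u = read_digits \<nu> l u" for u
    using eq by (auto intro!: read_digits_cong)
  then show ?thesis
    unfolding freq_block_def sh unfolding Req rect_block_drect[OF st] block_def by simp
qed

context mixed_norm
begin

text \<open>The block has the same total area as \<open>R\<close>, so the average is
  \<open>1 / area R\<close> times a sum over one shape weighted by area.\<close>

lemma avg_freq_block_le:
  assumes R: "R \<in> dyadic_rects" and mono: "strict_mono_on {..<lev R} \<mu>" and N: "\<And>i. i < lev R \<Longrightarrow> \<mu> i < N"
    and a: "a \<in> H"
  shows "0 < card (freq_block \<mu> N R)" "avg (freq_block \<mu> N R) (\<lambda>Q. \<bar>a Q\<bar>) \<le> hn a / area R"
proof -
  from R obtain k s l t where Req: "R = drect k s l t" and st: "s \<subseteq> {..<k}" "t \<subseteq> {..<l}" by (rule drect_cases)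
  define m n where "m = shape1 \<mu> N R" and "n = shape2 \<mu> N R"
  have B: "freq_block \<mu> N R = (\<lambda>(u, w). drect m u n w) ` (block \<mu> k s m \<times> block \<mu> l t n)"
    unfolding freq_block_def m_def n_def by (simp only: Req rect_block_drect[OF st])
  have lev: "lev1 R = k" "lev2 R = l" "lev R = max k l"
    by (simp_all add: lev_def Req lev1_drect[OF st] lev2_drect[OF st])
  have inj: "inj_on \<mu> {..<k}" "inj_on \<mu> {..<l}"
    using strict_mono_on_imp_inj_on[OF mono] lev by (auto intro: inj_on_subset)
  have below: "\<mu> ` {..<k} \<subseteq> {..<m}" "\<mu> ` {..<l} \<subseteq> {..<n}"
    using N less_min_freq[OF mono] lev by (auto simp: m_def n_def shape1_def shape2_def)
  have "real (card (freq_block \<mu> N R)) = (2 ^ m * (1 / 2) ^ k) * (2 ^ n * (1 / 2) ^ l)"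
    unfolding B card_image[OF inj_on_drect_block] card_cartesian_product
    using card_block[OF inj(1) below(1) st(1)] card_block[OF inj(2) below(2) st(2)] by simp
  then have card: "real (card (freq_block \<mu> N R)) * (1 / 2) ^ (m + n) = area R"
    by (simp add: Req area_drect power_add power_one_over field_simps)
  then show pos: "0 < card (freq_block \<mu> N R)"
    using area_pos[OF R] by (cases "card (freq_block \<mu> N R) = 0") auto
  have sh: "\<exists>u\<subseteq>{..<m}. \<exists>w\<subseteq>{..<n}. Q = drect m u n w" if "Q \<in> freq_block \<mu> N R" for Q
    using that unfolding B by (auto simp: block_def)
  have fin: "finite (freq_block \<mu> N R)" by (simp add: B)
  have "(\<Sum>Q\<in>freq_block \<mu> N R. \<bar>a Q\<bar> * area Q) \<le> hn a"
    using sum_shape_le_me[OF fin sh, of a] by (simp add: H_me[OF a])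
  also have "(\<Sum>Q\<in>freq_block \<mu> N R. \<bar>a Q\<bar> * area Q) = (\<Sum>Q\<in>freq_block \<mu> N R. \<bar>a Q\<bar>) * (1 / 2) ^ (m + n)"
    unfolding sum_distrib_right
  proof (intro sum.cong refl)
    fix Q assume "Q \<in> freq_block \<mu> N R"
    then have "area Q = (1 / 2) ^ (m + n)" using sh by (fastforce simp: area_drect)
    then show "\<bar>a Q\<bar> * area Q = \<bar>a Q\<bar> * (1 / 2) ^ (m + n)" by simp
  qed
  finally have "(\<Sum>Q\<in>freq_block \<mu> N R. \<bar>a Q\<bar>) * (1 / 2) ^ (m + n) \<le> hn a" .
  then show "avg (freq_block \<mu> N R) (\<lambda>Q. \<bar>a Q\<bar>) \<le> hn a / area R"
    unfolding avg_def card[symmetric] using pos by (simp add: field_simps power_one_over)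
qed

lemma freq_block_shape:
  assumes R: "R \<in> dyadic_rects" and Q: "Q \<in> freq_block \<mu> N R"
  shows "\<exists>u\<subseteq>{..<shape1 \<mu> N R}. \<exists>w\<subseteq>{..<shape2 \<mu> N R}. Q = drect (shape1 \<mu> N R) u (shape2 \<mu> N R) w"
  using Q by (auto simp: freq_block_def rect_block_def block_def)

lemma finite_freq_block: "R \<in> dyadic_rects \<Longrightarrow> finite (freq_block \<mu> N R)"
  by (simp add: freq_block_def)

lemma freq_block_subset: "freq_block \<mu> N R \<subseteq> dyadic_rects"
  by (simp add: freq_block_def rect_block_subset)

text \<open>One of the two sides has level \<open>N\<close>, whichever it is.\<close>

lemma freq_block_high:
  assumes R: "R \<in> dyadic_rects" "n < N"
  shows "freq_block \<mu> N R \<inter> rects_upto n = {}"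
proof -
  have "Q \<notin> rects_upto n" if "Q \<in> freq_block \<mu> N R" for Q
    using freq_block_shape[OF R(1) that] R(2)
    by (auto simp: drect_mem_upto_iff) (auto simp: shape1_def shape2_def split: if_splits)
  then show ?thesis by blast
qed

text \<open>Blocks of high frequency avoid the support of a finite approximant of \<open>g\<close>,
  so they meet only the small remainder.\<close>

lemma eventually_avg_small:
  assumes R: "R \<in> dyadic_rects" and mono: "strict_mono_on {..<lev R} \<mu>" and g: "g \<in> H" and "0 < c"
  shows "\<exists>N0. \<forall>N\<ge>N0. avg (freq_block \<mu> N R) (\<lambda>Q. \<bar>g Q\<bar>) \<le> c"
proof -
  have pos: "0 < c * area R" using \<open>0 < c\<close> area_pos[OF R] by simp
  obtain b where b: "b \<in> haar_span" "hn (\<lambda>R. g R - b R) < c * area R" using H_approx[OF g pos] .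
  obtain n where n: "{R. b R \<noteq> 0} \<subseteq> rects_upto n" using ex_rects_upto[of "{R. b R \<noteq> 0}"] b(1) by (auto simp: haar_span_def)
  have "avg (freq_block \<mu> N R) (\<lambda>Q. \<bar>g Q\<bar>) \<le> c" if N: "Suc n + (\<Sum>i<lev R. Suc (\<mu> i)) \<le> N" for N
  proof -
    have Nmu: "\<mu> i < N" if "i < lev R" for i
      using member_le_sum[of i "{..<lev R}" "\<lambda>i. Suc (\<mu> i)"] that N by auto
    have "b Q = 0" if "Q \<in> freq_block \<mu> N R" for Q
      using freq_block_high[OF R, of n N \<mu>] N n that by auto
    then have "avg (freq_block \<mu> N R) (\<lambda>Q. \<bar>g Q\<bar>) = avg (freq_block \<mu> N R) (\<lambda>Q. \<bar>g Q - b Q\<bar>)"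
      by (intro avg_cong) simp
    also have "\<dots> \<le> hn (\<lambda>R. g R - b R) / area R"
      using H_diff[OF g span_subset_H[OF b(1)]] by (intro avg_freq_block_le(2)[OF R mono Nmu]) auto
    also have "\<dots> \<le> c" using b(2) area_pos[OF R] by (simp add: divide_le_eq)
    finally show ?thesis .
  qed
  then show ?thesis by blast
qed

definition functional :: "(haar_series \<Rightarrow> real) \<Rightarrow> bool" where
  "functional \<psi> \<longleftrightarrow> (\<forall>f\<in>H. \<forall>g\<in>H. \<psi> (\<lambda>R. f R + g R) = \<psi> f + \<psi> g) \<and>
    (\<forall>f\<in>H. \<forall>c. \<psi> (\<lambda>R. c * f R) = c * \<psi> f) \<and> (\<exists>K. \<forall>f\<in>H. \<bar>\<psi> f\<bar> \<le> K * hn f)"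

lemma functional_span:
  assumes "functional \<psi>" "finite F" "F \<subseteq> dyadic_rects"
  shows "\<psi> (\<lambda>Q. if Q \<in> F then e Q else 0) = (\<Sum>Q\<in>F. e Q * \<psi> (haar_unit Q))"
  using assms(2,3)
proof (induction F rule: finite_induct)
  case empty
  have "\<forall>f\<in>H. \<forall>c. \<psi> (\<lambda>R. c * f R) = c * \<psi> f" using assms(1) by (simp add: functional_def)
  from this[rule_format, OF H_zero, of 0] show ?case by simp
next
  case (insert P F)
  have "(\<lambda>Q. if Q \<in> insert P F then e Q else 0) = (\<lambda>Q. e P * haar_unit P Q + (if Q \<in> F then e Q else 0))"
    using insert.hyps by (auto simp: haar_unit_def)
  moreover have "(\<lambda>Q. if Q \<in> F then e Q else 0) \<in> H"
    using insert by (intro span_subset_H) (auto simp: haar_span_def elim: rev_finite_subset)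
  moreover have "(\<lambda>Q. e P * haar_unit P Q) \<in> H" "haar_unit P \<in> H"
    using insert.prems unit_H H_cmult by auto
  ultimately have "\<psi> (\<lambda>Q. if Q \<in> insert P F then e Q else 0) = e P * \<psi> (haar_unit P) + \<psi> (\<lambda>Q. if Q \<in> F then e Q else 0)"
    using assms(1) by (simp add: functional_def)
  then show ?case using insert by simp
qed

text \<open>
  The blocks \<open>B N\<close> carry disjoint frequencies, so sums over \<open>n\<close> of them have norm at most \<open>sqrt n\<close>
  for any choice of signs; a bounded functional therefore cannot be large on all of them.
\<close>

lemma exists_small_block:
  assumes I: "finite I" and \<psi>: "\<And>i. i \<in> I \<Longrightarrow> functional (\<psi> i)" and c: "\<And>i. i \<in> I \<Longrightarrow> 0 < c i"
    and fin: "\<And>N. finite (B N)"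
    and shape: "\<And>N Q. Q \<in> B N \<Longrightarrow> \<exists>u\<subseteq>{..<m N}. \<exists>w\<subseteq>{..<n N}. Q = drect (m N) u (n N) w"
    and inj: "inj (\<lambda>N :: nat. (m N, n N))"
  shows "\<exists>N\<ge>N0. \<forall>i\<in>I. \<forall>e. (\<forall>Q. \<bar>e Q\<bar> \<le> 1) \<longrightarrow> \<bar>\<psi> i (\<lambda>Q. if Q \<in> B N then e Q else 0)\<bar> \<le> c i"
proof -
  have BD: "B N \<subseteq> dyadic_rects" for N using shape by blast
  \<comment> \<open>Dominates the functional for all signs at once, so that the block can be fixed
    before its signs.\<close>
  define \<theta> where "\<theta> i N = (\<Sum>Q\<in>B N. \<bar>\<psi> i (haar_unit Q)\<bar>)" for i N
  have \<theta>0: "0 \<le> \<theta> i N" for i N by (simp add: \<theta>_def sum_nonneg)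
  have le_\<theta>: "\<bar>\<psi> i (\<lambda>Q. if Q \<in> B N then e Q else 0)\<bar> \<le> \<theta> i N" if "i \<in> I" "\<forall>Q. \<bar>e Q\<bar> \<le> 1" for i N e
  proof -
    have e: "\<bar>e Q\<bar> \<le> 1" for Q using that(2) by blast
    have "\<bar>\<psi> i (\<lambda>Q. if Q \<in> B N then e Q else 0)\<bar> \<le> (\<Sum>Q\<in>B N. \<bar>e Q * \<psi> i (haar_unit Q)\<bar>)"
      unfolding functional_span[OF \<psi>[OF that(1)] fin BD] by (rule sum_abs)
    also have "\<dots> \<le> \<theta> i N" unfolding \<theta>_def
      using e by (intro sum_mono) (simp add: abs_mult mult_left_le_one_le)
    finally show ?thesis .
  qed
  have "\<exists>K. \<forall>f\<in>H. \<bar>\<psi> i f\<bar> \<le> K * hn f" if "i \<in> I" for i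
    using \<psi>[OF that] by (simp add: functional_def)
  then obtain K where K: "\<And>i f. i \<in> I \<Longrightarrow> f \<in> H \<Longrightarrow> \<bar>\<psi> i f\<bar> \<le> K i * hn f" by metis
  have sum_\<theta>: "(\<Sum>N\<in>W. \<theta> i N) \<le> \<bar>K i\<bar> * sqrt (card W)" if i: "i \<in> I" and W: "finite W" for i W
  proof -
    define F where "F = (\<Union>N\<in>W. B N)"
    have F: "finite F" "F \<subseteq> dyadic_rects" using W fin BD by (auto simp: F_def)
    \<comment> \<open>With these signs the functional attains the sum of its moduli over all blocks
      in \<open>W\<close>.\<close>
    define e where "e Q = sgn (\<psi> i (haar_unit Q))" for Q
    define f where "f = (\<lambda>Q. if Q \<in> F then e Q else 0)"
    have fH: "f \<in> H" using F by (intro span_subset_H) (auto simp: haar_span_def f_def elim: rev_finite_subset)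
    have disj: "B N \<inter> B N' = {}" if "N \<noteq> N'" for N N'
    proof (rule ccontr)
      assume "B N \<inter> B N' \<noteq> {}"
      then obtain Q where "Q \<in> B N" "Q \<in> B N'" by blast
      from shape[OF this(1)] shape[OF this(2)] have "m N = m N' \<and> n N = n N'"
        using drect_eq_iff by metis
      then show False using injD[OF inj, of N N'] \<open>N \<noteq> N'\<close> by simp
    qed
    have "(\<Sum>N\<in>W. \<theta> i N) = (\<Sum>Q\<in>F. \<bar>\<psi> i (haar_unit Q)\<bar>)"
      unfolding F_def \<theta>_def using W fin disj by (intro sum.UNION_disjoint[symmetric]) auto
    also have "\<dots> = \<psi> i f" unfolding f_def functional_span[OF \<psi>[OF i] F]
      by (simp add: e_def abs_sgn mult.commute)
    also have "\<dots> \<le> K i * hn f" using K[OF i fH] by simp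
    also have "\<dots> \<le> \<bar>K i\<bar> * sqrt (card W)"
    proof (rule mult_mono)
      have "me f \<le> ennreal (sqrt (card ((\<lambda>N. (m N, n N)) ` W)))"
      proof (rule me_le_sqrt_card)
        show "\<bar>f R\<bar> \<le> 1" for R by (auto simp: f_def e_def sgn_if)
        fix k s l t assume st: "s \<subseteq> {..<k}" "t \<subseteq> {..<l}" and kl: "(k, l) \<notin> (\<lambda>N. (m N, n N)) ` W"
        have "drect k s l t \<notin> F"
        proof
          assume "drect k s l t \<in> F"
          then obtain N where "N \<in> W" "drect k s l t \<in> B N" by (auto simp: F_def)
          then have "(k, l) = (m N, n N)" using shape[of "drect k s l t" N] drect_eq_iff[OF st] by auto
          with kl \<open>N \<in> W\<close> show False by blast
        qed
        then show "f (drect k s l t) = 0" by (simp add: f_def)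
      qed (use W in simp)
      also have "card ((\<lambda>N. (m N, n N)) ` W) = card W"
        using inj by (intro card_image) (auto intro: inj_on_subset)
      finally show "hn f \<le> sqrt (card W)" by (intro hn_leI) auto
    qed auto
    finally show ?thesis .
  qed
  define L where "L = (\<Sum>i\<in>I. \<bar>K i\<bar> / c i)"
  have "\<exists>N\<ge>N0. (\<Sum>i\<in>I. \<theta> i N / c i) \<le> 1"
  proof (rule ccontr)
    assume "\<not> ?thesis"
    then have gt: "1 < (\<Sum>i\<in>I. \<theta> i N / c i)" if "N0 \<le> N" for N using that by force
    obtain r :: nat where r: "max L 0 < r" using reals_Archimedean2 by blast
    \<comment> \<open>On \<open>r * r\<close> blocks the sum would have to be at least
      \<open>r * r\<close> but is at most \<open>L * r\<close>, which contradicts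
      \<open>L < r\<close>.\<close>
    define W where "W = {N0..<N0 + r * r}"
    have "real (card W) \<le> (\<Sum>N\<in>W. \<Sum>i\<in>I. \<theta> i N / c i)"
      using gt sum_mono[of W "\<lambda>_. 1" "\<lambda>N. \<Sum>i\<in>I. \<theta> i N / c i"] by (auto simp: W_def intro: less_imp_le)
    also have "\<dots> = (\<Sum>i\<in>I. (\<Sum>N\<in>W. \<theta> i N) / c i)"
      by (subst sum.swap) (simp add: sum_divide_distrib)
    also have "\<dots> \<le> (\<Sum>i\<in>I. \<bar>K i\<bar> * sqrt (card W) / c i)"
      using c by (intro sum_mono divide_right_mono sum_\<theta>) (auto simp: W_def less_imp_le)
    also have "\<dots> = L * sqrt (card W)" by (simp add: L_def sum_distrib_right)
    finally have "real r * real r \<le> L * real r" by (simp add: W_def)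
    then have "real r \<le> L" using r by simp
    then show False using r by simp
  qed
  then obtain N where N: "N0 \<le> N" "(\<Sum>i\<in>I. \<theta> i N / c i) \<le> 1" by blast
  have "\<theta> i N \<le> c i" if i: "i \<in> I" for i
  proof -
    have "\<theta> i N / c i \<le> (\<Sum>i\<in>I. \<theta> i N / c i)"
      using i I \<theta>0 c by (intro member_le_sum) (auto simp: less_imp_le)
    then have "\<theta> i N / c i \<le> 1" using N(2) by simp
    then show ?thesis using c[OF i] by simp
  qed
  then show ?thesis using N(1) le_\<theta> by (intro exI[of _ N]) (meson order_trans)
qed

end

section \<open>Almost diagonalization\<close>

text \<open>Frequency, block and signs chosen for one rank.\<close>

type_synonym block_choice = "nat \<times> rect set \<times> (rect \<Rightarrow> real)"

text \<open>
  The rectangles of level at most \<open>i\<close> are those of rank below \<open>\<tau> (Suc i)\<close>, so \<open>digit \<tau> f i\<close> is the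
  largest frequency used for them; finer levels are split along digits after it.
\<close>

definition digit :: "(nat \<Rightarrow> nat) \<Rightarrow> (nat \<Rightarrow> block_choice) \<Rightarrow> nat \<Rightarrow> nat" where
  "digit \<tau> f i = fst (f (\<tau> (Suc i) - 1))"

definition block_fun :: "block_choice \<Rightarrow> haar_series" where
  "block_fun r = (\<lambda>Q. if Q \<in> fst (snd r) then snd (snd r) Q else 0)"

section \<open>Recursive selection of frequencies, blocks and signs\<close>

locale block_selection = mixed_norm +
  fixes T :: "haar_series \<Rightarrow> haar_series" and K \<delta> :: real and \<kappa> :: "rect \<Rightarrow> rect \<Rightarrow> real"
    and rk :: "rect \<Rightarrow> nat" and \<tau> :: "nat \<Rightarrow> nat"
  assumes T: "op_bound T K"
    and diag: "\<And>R. R \<in> dyadic_rects \<Longrightarrow> \<delta> \<le> \<bar>T (haar_unit R) R\<bar>"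
    and \<kappa>: "\<And>R Q. R \<in> dyadic_rects \<Longrightarrow> Q \<in> dyadic_rects \<Longrightarrow> 0 < \<kappa> R Q"
    and rk: "inj_on rk dyadic_rects"
    and \<tau>: "strict_mono \<tau>"
    and rk_bounds: "\<And>R. R \<in> dyadic_rects \<Longrightarrow> \<tau> (lev R) \<le> rk R \<and> rk R < \<tau> (Suc (lev R))"
begin

text \<open>Placed in the averaging operator only, these signs make the diagonal terms of the
  compressed operator positive although \<open>T\<close> may have diagonal entries of both
  signs.\<close>

definition diag_sign :: "rect \<Rightarrow> real" where "diag_sign Q = sgn (T (haar_unit Q) Q)"

lemma abs_diag_sign_le: "\<bar>diag_sign Q\<bar> \<le> 1" by (simp add: diag_sign_def sgn_if)

text \<open>One coefficient of the future averaging operator, expressed through the data of a single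
  rank.\<close>

definition coef :: "block_choice \<Rightarrow> haar_series \<Rightarrow> real" where
  "coef r g = avg (fst (snd r)) (\<lambda>Q. diag_sign Q * snd (snd r) Q * g Q)"

text \<open>Mentions \<open>f\<close> only at ranks below \<open>t\<close>, so that well-founded
  choice applies. At a rank without a rectangle only the growth of the frequency remains. The first
  argument of \<open>\<kappa>\<close> is the rectangle whose block function is mapped by
  \<open>T\<close>, the second the one on which the image is tested.\<close>

definition admissible :: "(nat \<Rightarrow> block_choice) \<Rightarrow> nat \<Rightarrow> block_choice \<Rightarrow> bool" where
  "admissible f t r \<longleftrightarrow> (\<forall>s<t. fst (f s) < fst r) \<and>
    (\<forall>R\<in>dyadic_rects. rk R = t \<longrightarrow>
      fst (snd r) = freq_block (digit \<tau> f) (fst r) R \<and> (\<forall>Q. \<bar>snd (snd r) Q\<bar> = 1) \<and>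
      \<delta> \<le> coef r (T (block_fun r)) \<and>
      (\<forall>R'\<in>dyadic_rects. rk R' < t \<longrightarrow>
        \<bar>coef (f (rk R')) (T (block_fun r))\<bar> \<le> \<kappa> R R' \<and>
        \<bar>coef r (T (block_fun (f (rk R'))))\<bar> \<le> \<kappa> R' R))"

lemma \<tau>_pos: "0 < \<tau> (Suc i)"
  using strict_monoD[OF \<tau>, of i "Suc i"] by simp

text \<open>The last rank reserved for a smaller level precedes \<open>R\<close>, so the digits
  encoding \<open>R\<close> are known when its block is chosen.\<close>

lemma digit_index_less:
  assumes "R \<in> dyadic_rects" "i < lev R" shows "\<tau> (Suc i) - 1 < rk R"
proof -
  have "\<tau> (Suc i) \<le> \<tau> (lev R)" using assms(2) by (intro monoD[OF strict_mono_mono[OF \<tau>]]) simp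
  then show ?thesis using rk_bounds[OF assms(1)] \<tau>_pos[of i] by linarith
qed

lemma admissible_cong:
  assumes eq: "\<And>s. s < t \<Longrightarrow> f s = g s" shows "admissible f t r = admissible g t r"
proof -
  have "freq_block (digit \<tau> f) N R = freq_block (digit \<tau> g) N R" if "R \<in> dyadic_rects" "rk R = t" for R N
    using that(1) by (rule freq_block_cong) (use digit_index_less[OF that(1)] that eq in \<open>simp add: digit_def\<close>)
  then show ?thesis using eq unfolding admissible_def by (auto simp: Ball_def)
qed

lemma functional_coef:
  assumes "finite (fst (snd r))" "fst (snd r) \<subseteq> dyadic_rects" "\<And>Q. \<bar>snd (snd r) Q\<bar> = 1"
  shows "functional (\<lambda>g. coef r (T g))"
proof -
  define B where "B = fst (snd r)"
  have "\<bar>coef r (T g)\<bar> \<le> avg B (\<lambda>Q. K / area Q) * hn g" if g: "g \<in> H" for g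
  proof -
    have "\<bar>coef r (T g)\<bar> \<le> avg B (\<lambda>Q. \<bar>diag_sign Q * snd (snd r) Q * T g Q\<bar>)"
      unfolding coef_def B_def by (rule abs_avg_le)
    also have "\<dots> \<le> avg B (\<lambda>Q. hn g * (K / area Q))"
    proof (rule avg_mono)
      fix Q assume "Q \<in> B"
      then have Q: "Q \<in> dyadic_rects" using assms(2) by (auto simp: B_def)
      have "\<bar>T g Q\<bar> * area Q \<le> K * hn g"
        using coeff_le_hn[OF op_boundD(2)[OF T g] Q] op_boundD(3)[OF T g] by (rule order_trans)
      then have "\<bar>T g Q\<bar> \<le> hn g * (K / area Q)" using area_pos[OF Q] by (simp add: field_simps)
      moreover have "\<bar>diag_sign Q * snd (snd r) Q * T g Q\<bar> \<le> \<bar>T g Q\<bar>"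
        using abs_diag_sign_le[of Q] assms(3) by (simp add: abs_mult mult_left_le_one_le)
      ultimately show "\<bar>diag_sign Q * snd (snd r) Q * T g Q\<bar> \<le> hn g * (K / area Q)" by simp
    qed
    also have "\<dots> = avg B (\<lambda>Q. K / area Q) * hn g" by (simp only: avg_cmult mult.commute)
    finally show ?thesis .
  qed
  then have "\<exists>K'. \<forall>g\<in>H. \<bar>coef r (T g)\<bar> \<le> K' * hn g" by blast
  moreover have "coef r (T (\<lambda>R. g R + h R)) = coef r (T g) + coef r (T h)" if "g \<in> H" "h \<in> H" for g h
    unfolding op_boundD(4)[OF T that] coef_def by (simp add: algebra_simps flip: avg_add)
  moreover have "coef r (T (\<lambda>R. c * g R)) = c * coef r (T g)" if "g \<in> H" for c g
    unfolding op_boundD(5)[OF T that] coef_def by (simp add: algebra_simps flip: avg_cmult)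
  ultimately show ?thesis by (simp add: functional_def)
qed

lemma block_fun_span:
  "finite (fst (snd r)) \<Longrightarrow> fst (snd r) \<subseteq> dyadic_rects \<Longrightarrow> block_fun r \<in> haar_span"
  by (auto simp: haar_span_def block_fun_def elim: rev_finite_subset)

text \<open>The order of the choices matters: first the frequency, with both interactions small for
  all signs, and only then the signs, which are left free to serve the diagonal.\<close>

lemma admissible_step:
  assumes prev: "\<And>s. s < t \<Longrightarrow> admissible f s (f s)"
  shows "\<exists>r. admissible f t r"
proof -
  define N0 where "N0 = Suc (\<Sum>s<t. fst (f s))"
  have N0: "fst (f s) < N" if "s < t" "N0 \<le> N" for s N
    using member_le_sum[of s "{..<t}" "\<lambda>s. fst (f s)"] that by (simp add: N0_def)
  show ?thesis
  proof (cases "\<exists>R\<in>dyadic_rects. rk R = t")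
    case False
    \<comment> \<open>A rank without a rectangle: only a larger frequency has to be
      supplied.\<close>
    then show ?thesis using N0 by (intro exI[of _ "(N0, {}, \<lambda>_. 0)"]) (auto simp: admissible_def)
  next
    case True
    then obtain R where R: "R \<in> dyadic_rects" "rk R = t" by blast
    define \<mu> where "\<mu> = digit \<tau> f"
    have mono: "strict_mono_on {..<lev R} \<mu>"
    proof (rule strict_mono_onI)
      fix i j assume ij: "i \<in> {..<lev R}" "j \<in> {..<lev R}" "i < j"
      have "\<tau> (Suc i) < \<tau> (Suc j)" using \<open>i < j\<close> by (intro strict_monoD[OF \<tau>]) simp
      then have "\<tau> (Suc i) - 1 < \<tau> (Suc j) - 1" using \<tau>_pos[of i] by linarith
      moreover have "\<tau> (Suc j) - 1 < t" using digit_index_less[OF R(1), of j] ij R(2) by simp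
      ultimately show "\<mu> i < \<mu> j" using prev[of "\<tau> (Suc j) - 1"] by (simp add: \<mu>_def digit_def admissible_def)
    qed
    have \<mu>N: "\<mu> i < N" if "i < lev R" "N0 \<le> N" for i N
      using N0[OF _ that(2)] digit_index_less[OF R(1) that(1)] R(2) by (simp add: \<mu>_def digit_def)
    define I where "I = {R' \<in> dyadic_rects. rk R' < t}"
    have I: "finite I"
      by (rule inj_on_finite[of rk _ "{..<t}"]) (use rk in \<open>auto simp: I_def intro: inj_on_subset\<close>)
    have old: "finite (fst (snd (f (rk R'))))" "fst (snd (f (rk R'))) \<subseteq> dyadic_rects" "\<bar>snd (snd (f (rk R'))) Q\<bar> = 1"
      if "R' \<in> I" for R' Q
    proof -
      have R': "R' \<in> dyadic_rects" "rk R' < t" using that by (auto simp: I_def)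
      have "fst (snd (f (rk R'))) = freq_block (digit \<tau> f) (fst (f (rk R'))) R' \<and> (\<forall>Q. \<bar>snd (snd (f (rk R'))) Q\<bar> = 1)"
        using prev[OF R'(2)] R'(1) unfolding admissible_def by blast
      then show "finite (fst (snd (f (rk R'))))" "fst (snd (f (rk R'))) \<subseteq> dyadic_rects" "\<bar>snd (snd (f (rk R'))) Q\<bar> = 1"
        using finite_freq_block[OF R'(1)] freq_block_subset by (simp, simp, blast)
    qed
    have oldH: "T (block_fun (f (rk R'))) \<in> H" if "R' \<in> I" for R'
      by (intro op_boundD(2)[OF T] span_subset_H block_fun_span old[OF that])
    \<comment> \<open>Images of earlier blocks, tested on the new one: small from some frequency
      on.\<close>
    have "\<forall>R'\<in>I. \<exists>n. \<forall>N\<ge>n. avg (freq_block \<mu> N R) (\<lambda>Q. \<bar>T (block_fun (f (rk R'))) Q\<bar>) \<le> \<kappa> R' R"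
      using oldH \<kappa> R(1) by (intro ballI eventually_avg_small mono) (auto simp: I_def)
    then obtain n where n: "\<And>R' N. R' \<in> I \<Longrightarrow> n R' \<le> N \<Longrightarrow>
        avg (freq_block \<mu> N R) (\<lambda>Q. \<bar>T (block_fun (f (rk R'))) Q\<bar>) \<le> \<kappa> R' R" by metis
    \<comment> \<open>The image of the new block, tested on earlier ones: small for some arbitrarily
      large \<open>N\<close>, which is taken beyond all thresholds \<open>n R'\<close>.\<close>
    have "\<exists>N\<ge>N0 + sum n I. \<forall>R'\<in>I. \<forall>e. (\<forall>Q. \<bar>e Q\<bar> \<le> 1) \<longrightarrow>
      \<bar>coef (f (rk R')) (T (\<lambda>Q. if Q \<in> freq_block \<mu> N R then e Q else 0))\<bar> \<le> \<kappa> R R'"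
    proof (rule exists_small_block[OF I])
      show "functional (\<lambda>g. coef (f (rk R')) (T g))" if "R' \<in> I" for R'
        by (intro functional_coef old[OF that])
      show "0 < \<kappa> R R'" if "R' \<in> I" for R' using \<kappa> R(1) that by (auto simp: I_def)
      show "inj (\<lambda>N. (shape1 \<mu> N R, shape2 \<mu> N R))" by (auto simp: inj_def shape1_def shape2_def)
    qed (auto simp: finite_freq_block[OF R(1)] intro!: freq_block_shape[OF R(1)])
    then obtain N where N: "N0 + sum n I \<le> N" and small: "\<And>R' e. R' \<in> I \<Longrightarrow> (\<forall>Q. \<bar>e Q\<bar> \<le> 1) \<Longrightarrow>
      \<bar>coef (f (rk R')) (T (\<lambda>Q. if Q \<in> freq_block \<mu> N R then e Q else 0))\<bar> \<le> \<kappa> R R'" by blast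
    define B where "B = freq_block \<mu> N R"
    have B: "finite B" "B \<subseteq> dyadic_rects" using finite_freq_block[OF R(1)] freq_block_subset by (auto simp: B_def)
    have cardB: "0 < card B"
      unfolding B_def using H_zero N by (intro avg_freq_block_le(1)[OF R(1) mono] \<mu>N) auto
    \<comment> \<open>The quadratic form in the signs is \<open>card B\<close> times the diagonal
      entry of the compressed operator.\<close>
    have "\<exists>e. (\<forall>Q. \<bar>e Q\<bar> = 1) \<and> \<delta> * card B \<le> (\<Sum>Q\<in>B. \<Sum>Q'\<in>B. e Q * e Q' * (diag_sign Q * T (haar_unit Q') Q))"
    proof (rule exists_signs[OF B(1)])
      fix Q assume "Q \<in> B"
      then have "\<delta> \<le> \<bar>T (haar_unit Q) Q\<bar>" using diag B(2) by blast
      then show "\<delta> \<le> diag_sign Q * T (haar_unit Q) Q" by (simp add: diag_sign_def abs_sgn mult.commute)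
    qed
    then obtain e where e: "\<And>Q. \<bar>e Q\<bar> = 1"
      and e\<delta>: "\<delta> * card B \<le> (\<Sum>Q\<in>B. \<Sum>Q'\<in>B. e Q * e Q' * (diag_sign Q * T (haar_unit Q') Q))" by blast
    define r where "r = (N, B, e)"
    have "block_fun r = (\<lambda>Q. \<Sum>Q'\<in>B. e Q' * haar_unit Q' Q)"
      using B(1) by (auto simp: r_def block_fun_def haar_unit_def if_distrib[of "\<lambda>x. _ * x"] cong: if_cong)
    then have "T (block_fun r) = (\<lambda>Q. \<Sum>Q'\<in>B. e Q' * T (haar_unit Q') Q)"
      using B unit_H by (simp only:) (intro op_sum[OF T], auto)
    then have "coef r (T (block_fun r)) = (\<Sum>Q\<in>B. \<Sum>Q'\<in>B. e Q * e Q' * (diag_sign Q * T (haar_unit Q') Q)) / card B"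
      by (simp add: coef_def r_def avg_def sum_distrib_left mult_ac)
    then have diag_r: "\<delta> \<le> coef r (T (block_fun r))" using e\<delta> cardB by (simp add: le_divide_eq)
    have off1: "\<bar>coef (f (rk R')) (T (block_fun r))\<bar> \<le> \<kappa> R R'" if "R' \<in> I" for R'
      using small[OF that, of e] e unfolding block_fun_def r_def B_def fst_conv snd_conv by simp
    have off2: "\<bar>coef r (T (block_fun (f (rk R'))))\<bar> \<le> \<kappa> R' R" if "R' \<in> I" for R'
    proof -
      have "\<bar>coef r g\<bar> \<le> avg B (\<lambda>Q. \<bar>g Q\<bar>)" for g
      proof -
        have "\<bar>coef r g\<bar> \<le> avg B (\<lambda>Q. \<bar>diag_sign Q * e Q * g Q\<bar>)"
          unfolding coef_def r_def fst_conv snd_conv by (rule abs_avg_le)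
        also have "\<dots> \<le> avg B (\<lambda>Q. \<bar>g Q\<bar>)"
          using abs_diag_sign_le e by (intro avg_mono) (simp add: abs_mult mult_left_le_one_le)
        finally show ?thesis .
      qed
      moreover have "n R' \<le> N" using member_le_sum[of R' I n] that I N by simp
      ultimately show ?thesis using n[OF that] unfolding B_def by (meson order_trans)
    qed
    have "admissible f t r"
      unfolding admissible_def
    proof (intro conjI allI impI ballI)
      show "fst (f s) < fst r" if "s < t" for s using N0[OF that] N by (simp add: r_def)
      fix R0 assume "R0 \<in> dyadic_rects" "rk R0 = t"
      then have [simp]: "R0 = R" using inj_onD[OF rk, of R0 R] R by simp
      show "fst (snd r) = freq_block (digit \<tau> f) (fst r) R0" by (simp add: r_def B_def \<mu>_def)
      show "\<bar>snd (snd r) Q\<bar> = 1" for Q using e by (simp add: r_def)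
      show "\<delta> \<le> coef r (T (block_fun r))" by (rule diag_r)
      fix R' assume "R' \<in> dyadic_rects" "rk R' < t"
      then have "R' \<in> I" by (simp add: I_def)
      then show "\<bar>coef (f (rk R')) (T (block_fun r))\<bar> \<le> \<kappa> R0 R'"
        "\<bar>coef r (T (block_fun (f (rk R'))))\<bar> \<le> \<kappa> R' R0" using off1 off2 by simp_all
    qed
    then show ?thesis by blast
  qed
qed

lemma exists_admissible: "\<exists>f. \<forall>t. admissible f t (f t)"
proof (rule dependent_wf_choice[OF wf_less_than])
  show "admissible f t r = admissible g t r" if "\<And>s. (s, t) \<in> less_than \<Longrightarrow> f s = g s" for f g t r
    using that by (intro admissible_cong) simp
  show "\<exists>r. admissible f t r" if "\<And>s. (s, t) \<in> less_than \<Longrightarrow> admissible f s (f s)" for t f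
    using that by (intro admissible_step) simp
qed

lemma exists_almost_diagonal:
  "\<exists>A P. op_bound A 1 \<and> op_bound P 1 \<and>
    (\<forall>R\<in>dyadic_rects. \<delta> \<le> P (T (A (haar_unit R))) R \<and>
      (\<forall>Q\<in>dyadic_rects. Q \<noteq> R \<longrightarrow> \<bar>P (T (A (haar_unit R))) Q\<bar> \<le> \<kappa> R Q))"
proof -
  from exists_admissible obtain f where admissible: "\<And>t. admissible f t (f t)" by blast
  define N where "N t = fst (f t)" for t
  define \<nu> where "\<nu> = digit \<tau> f"
  have N: "strict_mono N" using admissible by (intro strict_monoI) (simp add: admissible_def N_def)
  have \<nu>: "\<nu> i = N (\<tau> (Suc i) - 1)" for i by (simp add: \<nu>_def digit_def N_def)
  have mono: "strict_mono \<nu>"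
  proof (rule strict_monoI)
    fix i j :: nat assume "i < j"
    then have "\<tau> (Suc i) < \<tau> (Suc j)" by (intro strict_monoD[OF \<tau>]) simp
    then show "\<nu> i < \<nu> j" unfolding \<nu> using \<tau>_pos[of i] by (intro strict_monoD[OF N]) linarith
  qed
  \<comment> \<open>Frequencies increase with the rank, and \<open>\<nu> i\<close> is the frequency
    at the last rank reserved for level \<open>i\<close>. This is the equivalence that a block
    system asks of the side of larger level.\<close>
  have \<nu>_less: "i < lev R \<longleftrightarrow> \<nu> i < N (rk R)" if R: "R \<in> dyadic_rects" for i R
  proof
    assume "i < lev R"
    then show "\<nu> i < N (rk R)" unfolding \<nu> by (intro strict_monoD[OF N] digit_index_less R)
  next
    assume "\<nu> i < N (rk R)"
    then have "\<tau> (Suc i) - 1 < rk R" unfolding \<nu> by (simp add: strict_mono_less[OF N])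
    then have "\<tau> (Suc i) < \<tau> (Suc (lev R))" using rk_bounds[OF R] by linarith
    then show "i < lev R" by (simp add: strict_mono_less[OF \<tau>])
  qed
  have min_freq_less: "i < l \<longleftrightarrow> \<nu> i < min_freq \<nu> l" for i l
    by (cases l) (auto simp: min_freq_def less_Suc_eq_le strict_mono_less_eq[OF mono])
  define m1 m2 where "m1 R = shape1 \<nu> (N (rk R)) R" and "m2 R = shape2 \<nu> (N (rk R)) R" for R
  interpret block_system p q \<nu> m1 m2
  proof unfold_locales
    fix k l i :: nat and s t :: "nat set" assume st: "s \<subseteq> {..<k}" "t \<subseteq> {..<l}"
    have D: "drect k s l t \<in> dyadic_rects" using st by (rule drect_mem)
    show "i < k \<longleftrightarrow> \<nu> i < m1 (drect k s l t)" "i < l \<longleftrightarrow> \<nu> i < m2 (drect k s l t)"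
      using \<nu>_less[OF D, of i] min_freq_less[of i]
      by (auto simp: m1_def m2_def shape1_def shape2_def lev_def lev1_drect[OF st] lev2_drect[OF st] max_def split: if_splits)
  next
    \<comment> \<open>The larger entry of a shape is the fresh frequency, so the shape determines
      the rank and thereby the rectangle.\<close>
    have max: "max (m1 R) (m2 R) = N (rk R)" if R: "R \<in> dyadic_rects" for R
    proof -
      have "min_freq \<nu> l \<le> N (rk R)" if "l \<le> lev R" for l
        using \<nu>_less[OF R] that by (cases l) (auto simp: min_freq_def Suc_le_eq)
      then show ?thesis by (auto simp: m1_def m2_def shape1_def shape2_def lev_def)
    qed
    show "inj_on (\<lambda>R. (m1 R, m2 R)) dyadic_rects"
    proof (rule inj_onI)
      fix R R' assume RR: "R \<in> dyadic_rects" "R' \<in> dyadic_rects" "(m1 R, m2 R) = (m1 R', m2 R')"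
      then have "N (rk R) = N (rk R')" using max[OF RR(1)] max[OF RR(2)] by simp
      then have "rk R = rk R'" using strict_mono_eq[OF N] by simp
      then show "R = R'" using inj_onD[OF rk] RR by blast
    qed
  qed (rule mono)
  have BB: "BB R = freq_block (digit \<tau> f) (fst (f (rk R))) R" for R
    unfolding BB_def by (simp add: m1_def m2_def freq_block_def \<nu>_def N_def)
  have f: "fst (snd (f (rk R))) = BB R" "\<bar>snd (snd (f (rk R))) Q\<bar> = 1" "\<delta> \<le> coef (f (rk R)) (T (block_fun (f (rk R))))"
    "R' \<in> dyadic_rects \<Longrightarrow> rk R' < rk R \<Longrightarrow> \<bar>coef (f (rk R')) (T (block_fun (f (rk R))))\<bar> \<le> \<kappa> R R' \<and>
        \<bar>coef (f (rk R)) (T (block_fun (f (rk R'))))\<bar> \<le> \<kappa> R' R"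
    if "R \<in> dyadic_rects" for R R' Q
    using admissible[of "rk R"] that unfolding admissible_def BB by blast+
  \<comment> \<open>Blocks are disjoint, so the signs chosen rank by rank combine into one
    function.\<close>
  define e where "e Q = snd (snd (f (rk (SOME R. R \<in> dyadic_rects \<and> Q \<in> BB R)))) Q" for Q
  have e: "e Q = snd (snd (f (rk R))) Q" if R: "R \<in> dyadic_rects" "Q \<in> BB R" for R Q
  proof -
    have "(SOME R. R \<in> dyadic_rects \<and> Q \<in> BB R) = R"
      by (rule some_equality) (use R BB_unique in blast)+
    then show ?thesis by (simp add: e_def)
  qed
  \<comment> \<open>Off the blocks the choice in \<open>e\<close> is arbitrary; the value
    \<open>0\<close> secures the bound \<open>1\<close>.\<close>
  define e' where "e' Q = (if \<exists>R\<in>dyadic_rects. Q \<in> BB R then e Q else 0)" for Q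
  have e': "e' Q = snd (snd (f (rk R))) Q" if "R \<in> dyadic_rects" "Q \<in> BB R" for R Q
    using e[OF that] that by (auto simp: e'_def)
  have e'_le: "\<bar>e' Q\<bar> \<le> 1" for Q
  proof (cases "\<exists>R\<in>dyadic_rects. Q \<in> BB R")
    case True
    then obtain R where "R \<in> dyadic_rects" "Q \<in> BB R" by blast
    then show ?thesis using e' f(2) by simp
  qed (simp add: e'_def)
  have A: "op_bound (spread e') 1" using e'_le by (rule spread_op_bound)
  have P: "op_bound (collect (\<lambda>Q. diag_sign Q * e' Q)) 1"
    using e'_le abs_diag_sign_le by (intro collect_op_bound) (simp add: abs_mult mult_le_one)
  have Au: "spread e' (haar_unit R) = block_fun (f (rk R))" if "R \<in> dyadic_rects" for R
    unfolding spread_unit[OF that] block_fun_def f(1)[OF that] using e'[OF that] by auto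
  have Pg: "collect (\<lambda>Q. diag_sign Q * e' Q) g R = coef (f (rk R)) g" if "R \<in> dyadic_rects" for R g
    using that unfolding collect_def coef_def f(1)[OF that] by (auto simp: e'[OF that] intro!: avg_cong)
  have off: "\<bar>coef (f (rk Q)) (T (block_fun (f (rk R))))\<bar> \<le> \<kappa> R Q"
    if RQ: "R \<in> dyadic_rects" "Q \<in> dyadic_rects" "Q \<noteq> R" for R Q
  proof -
    have "rk Q \<noteq> rk R" using inj_onD[OF rk] RQ by blast
    then consider "rk Q < rk R" | "rk R < rk Q" by linarith
    then show ?thesis using f(4)[OF RQ(1,2)] f(4)[OF RQ(2,1)] by cases auto
  qed
  show ?thesis
    by (rule exI[of _ "spread e'"], rule exI[of _ "collect (\<lambda>Q. diag_sign Q * e' Q)"]) (simp add: A P Au Pg f(3) off)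
qed

end

section \<open>Factorization of the identity\<close>

context mixed_norm
begin

text \<open>The tolerances handed to the selection are exactly those under which the compressed
  operator has a bounded left inverse; composing it with the averaging operator gives
  \<open>S\<close>.\<close>

lemma identity_factors:
  assumes T: "op_bound T K" and "0 < \<delta>" "0 < \<epsilon>" "\<epsilon> < 1"
    and diag: "\<And>R. R \<in> dyadic_rects \<Longrightarrow> \<delta> \<le> \<bar>T (haar_unit R) R\<bar>"
  shows "\<exists>A S. op_bound A 1 \<and> op_bound S (1 / (\<delta> * (1 - \<epsilon>))) \<and> (\<forall>f\<in>H. S (T (A f)) = f)"
proof -
  obtain rk :: "rect \<Rightarrow> nat" and \<tau> :: "nat \<Rightarrow> nat" where rk: "inj_on rk dyadic_rects" "strict_mono \<tau>"
    "\<forall>R\<in>dyadic_rects. \<tau> (lev R) \<le> rk R \<and> rk R < \<tau> (Suc (lev R))"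
    using exists_rank[of dyadic_rects lev, OF finite_lev] by blast
  \<comment> \<open>Ranks are distinct, so these weights sum to at most \<open>1\<close> over every
    finite set of rectangles.\<close>
  define w :: "rect \<Rightarrow> real" where "w R = (1 / 2) ^ Suc (rk R)" for R
  have w: "0 < w R" for R by (simp add: w_def)
  have sum_w: "sum w F \<le> 1" if F: "finite F" "F \<subseteq> dyadic_rects" for F
  proof -
    have "sum w F = (\<Sum>n\<in>rk ` F. (1 / 2) ^ Suc n)"
      using inj_on_subset[OF rk(1) F(2)] by (simp add: sum.reindex w_def)
    also have "\<dots> \<le> (\<Sum>n. (1 / 2) ^ Suc n)"
      using F sums_summable[OF power_half_series] by (intro sum_le_suminf) auto
    also have "\<dots> = 1" using power_half_series by (rule sums_unique[symmetric])
    finally show ?thesis .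
  qed
  interpret block_selection p q T K \<delta> "\<lambda>R Q. \<epsilon> * \<delta> * area R * w R * w Q" rk \<tau>
    by unfold_locales (use assms rk w area_pos in auto)
  obtain A P where AP: "op_bound A 1" "op_bound P 1"
    and ad: "\<forall>R\<in>dyadic_rects. \<delta> \<le> P (T (A (haar_unit R))) R \<and>
      (\<forall>Q\<in>dyadic_rects. Q \<noteq> R \<longrightarrow> \<bar>P (T (A (haar_unit R))) Q\<bar> \<le> \<epsilon> * \<delta> * area R * w R * w Q)"
    using exists_almost_diagonal by blast
  have "\<exists>S. op_bound S (1 / (\<delta> * (1 - \<epsilon>))) \<and> (\<forall>f\<in>H. S (P (T (A f))) = f)"
    by (rule almost_diagonal_left_inverse[OF op_comp[OF AP(2) op_comp[OF T AP(1)]], where w = w])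
      (use assms ad w sum_w in \<open>auto simp: less_imp_le\<close>)
  then obtain S where S: "op_bound S (1 / (\<delta> * (1 - \<epsilon>)))" "\<forall>f\<in>H. S (P (T (A f))) = f" by blast
  have "op_bound (\<lambda>f. S (P f)) (1 / (\<delta> * (1 - \<epsilon>)) * 1)" by (rule op_comp[OF S(1) AP(2)])
  with S(2) AP(1) show ?thesis by (intro exI[of _ A] exI[of _ "\<lambda>f. S (P f)"]) simp
qed

end

theorem theorem3p1:
  fixes p q \<delta> :: real and T :: "haar_series \<Rightarrow> haar_series"
  assumes "1 \<le> p" and "1 \<le> q" and "0 < \<delta>"
    and "bounded_op p q T"
    and "\<forall>R\<in>dyadic_rects. \<bar>pairing (T (haar_unit R)) (haar_unit R)\<bar> \<ge> \<delta> * area R"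
  shows "(\<exists>R S. bounded_op p q R \<and> bounded_op p q S \<and> (\<forall>f\<in>hardy p q. f = S (T (R f)))) \<and>
    (\<forall>\<eta>\<in>{0<..1}. \<exists>R S. bounded_op p q R \<and> bounded_op p q S \<and>
       (\<forall>f\<in>hardy p q. f = S (T (R f))) \<and>
       op_norm p q R * op_norm p q S \<le> (1 + \<eta>) / \<delta>)"
proof -
  interpret mixed_norm p q using assms by unfold_locales
  obtain K where K: "op_bound T K" using assms(4) by (auto simp: bounded_op_iff)
  \<comment> \<open>The pairing is the coefficient times \<open>area R\<close>, so the area
    cancels.\<close>
  have diag: "\<delta> \<le> \<bar>T (haar_unit R) R\<bar>" if R: "R \<in> dyadic_rects" for R
    using assms(5) R area_pos[OF R] by (auto simp: pairing_haar_unit abs_mult)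
  have main: "\<exists>R S. bounded_op p q R \<and> bounded_op p q S \<and>
       (\<forall>f\<in>hardy p q. f = S (T (R f))) \<and> op_norm p q R * op_norm p q S \<le> (1 + \<eta>) / \<delta>"
    if \<eta>: "\<eta> \<in> {0<..1}" for \<eta>
  proof -
    \<comment> \<open>Chosen so that the loss \<open>1 / (1 - \<epsilon>)\<close> of the Neumann
      series equals \<open>1 + \<eta>\<close>.\<close>
    define \<epsilon> where "\<epsilon> = \<eta> / (1 + \<eta>)"
    have \<epsilon>: "0 < \<epsilon>" "\<epsilon> < 1" "1 / (\<delta> * (1 - \<epsilon>)) = (1 + \<eta>) / \<delta>"
      using \<eta> \<open>0 < \<delta>\<close> by (auto simp: \<epsilon>_def field_simps)
    from identity_factors[OF K \<open>0 < \<delta>\<close> \<epsilon>(1,2) diag] obtain R S where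
      R: "op_bound R 1" and S: "op_bound S ((1 + \<eta>) / \<delta>)" and id: "\<forall>f\<in>hardy p q. S (T (R f)) = f"
      unfolding \<epsilon>(3) by blast
    have "op_norm p q R * op_norm p q S \<le> 1 * ((1 + \<eta>) / \<delta>)"
      using op_norm_bounds[OF R] op_norm_bounds[OF S] by (intro mult_mono) auto
    then show ?thesis using R S id bounded_op_iff by (intro exI[of _ R] exI[of _ S]) auto
  qed
  from main[of 1] have "\<exists>R S. bounded_op p q R \<and> bounded_op p q S \<and> (\<forall>f\<in>hardy p q. f = S (T (R f)))"
    by auto
  with main show ?thesis by blast
qed

end
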